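(* Let $R$ be a commutative ring with unit, let $\delta\in R$, and let $n$ be an odd positive integer. Let $\mathrm{Br}_n(\delta)$ be the Brauer algebra over $R$. Then $$\mathrm{Tor}^{\mathrm{Br}_n(\delta)}_*(\mathbf{1},\mathbf{1})\cong \mathrm{Tor}^{R\Sigma_n}_*(\mathbf{1},\mathbf{1})=: H_*(\Sigma_n;R),$$ where $\Sigma_n$ is the symmetric group on $n$ letters and $R\Sigma_n$ is its group algebra.
   Context: A Brauer $n$-diagram is a graph on two columns (left and right) of $n$ nodes each, in which each node is connected to exactly one other node by an edge. The Brauer algebra $\mathrm{Br}_n(\delta)$ is the free $R$-module on the Brauer $n$-diagrams, with the bilinear multiplication given on diagrams $x,y$ as follows: identify the right nodes of $x$ with the left nodes of $y$; the product $xy$ is $\delta^a$ times the diagram in which two outer nodes are joined exactly when they are connected by a path in the concatenated graph, where $a$ is the number of closed loops (consisting entirely of middle nodes) in the concatenated graph. The trivial module $\mathbf{1}$ for $\mathrm{Br}_n(\delta)$ (both as a left and as a right module) is a single copy of $R$, on which diagrams with no left-to-left or right-to-right edges act as multiplication by $1$ and all other diagrams act as multiplication by $0$. The trivial module $\mathbf{1}$ for $R\Sigma_n$ is $R$ with every element of $\Sigma_n$ acting as the identity. *)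

theory Defs
  imports "HOL-Algebra.Module" "HOL-Algebra.AbelCoset" "HOL-Algebra.Sym_Groups"
begin

hide_const (open) Multiset.mult

section \<open>Modules over a ring that need not be commutative\<close>

text \<open>The locale \<^locale>\<open>module\<close> of the library requires the scalars to commute. Right
  \<open>A\<close>-modules are left modules over \<open>op_ring A\<close>: the scalar product
  \<open>a \<odot>\<^bsub>M\<^esub> x\<close> then stands for \<open>x \<cdot> a\<close>.\<close>

locale lmodule = A?: ring A + M?: abelian_group M
  for A :: "('a, 'e) ring_scheme" (structure) and M :: "('a, 'm, 'f) module_scheme" (structure) +
  assumes smult_closed:
      "\<lbrakk>a \<in> carrier A; x \<in> carrier M\<rbrakk> \<Longrightarrow> a \<odot>\<^bsub>M\<^esub> x \<in> carrier M"
    and smult_l_distr: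
      "\<lbrakk>a \<in> carrier A; b \<in> carrier A; x \<in> carrier M\<rbrakk> \<Longrightarrow>
       (a \<oplus>\<^bsub>A\<^esub> b) \<odot>\<^bsub>M\<^esub> x = a \<odot>\<^bsub>M\<^esub> x \<oplus>\<^bsub>M\<^esub> b \<odot>\<^bsub>M\<^esub> x"
    and smult_r_distr:
      "\<lbrakk>a \<in> carrier A; x \<in> carrier M; y \<in> carrier M\<rbrakk> \<Longrightarrow>
       a \<odot>\<^bsub>M\<^esub> (x \<oplus>\<^bsub>M\<^esub> y) = a \<odot>\<^bsub>M\<^esub> x \<oplus>\<^bsub>M\<^esub> a \<odot>\<^bsub>M\<^esub> y"
    and smult_assoc:
      "\<lbrakk>a \<in> carrier A; b \<in> carrier A; x \<in> carrier M\<rbrakk> \<Longrightarrow>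
       (a \<otimes>\<^bsub>A\<^esub> b) \<odot>\<^bsub>M\<^esub> x = a \<odot>\<^bsub>M\<^esub> (b \<odot>\<^bsub>M\<^esub> x)"
    and smult_one: "x \<in> carrier M \<Longrightarrow> \<one>\<^bsub>A\<^esub> \<odot>\<^bsub>M\<^esub> x = x"

definition op_ring :: "('a, 'e) ring_scheme \<Rightarrow> ('a, 'e) ring_scheme" where
  "op_ring A = A\<lparr>mult := \<lambda>x y. y \<otimes>\<^bsub>A\<^esub> x\<rparr>"

definition lmodule_hom ::
    "('a, 'e) ring_scheme \<Rightarrow> ('a, 'm, 'f) module_scheme \<Rightarrow> ('a, 'n, 'g) module_scheme \<Rightarrow> ('m \<Rightarrow> 'n) set"
  where "lmodule_hom A M N = {h \<in> carrier M \<rightarrow> carrier N.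
     (\<forall>x\<in>carrier M. \<forall>y\<in>carrier M. h (x \<oplus>\<^bsub>M\<^esub> y) = h x \<oplus>\<^bsub>N\<^esub> h y) \<and>
     (\<forall>a\<in>carrier A. \<forall>x\<in>carrier M. h (a \<odot>\<^bsub>M\<^esub> x) = a \<odot>\<^bsub>N\<^esub> h x)}"

definition lmodule_isomorphic ::
    "('a, 'e) ring_scheme \<Rightarrow> ('a, 'm, 'f) module_scheme \<Rightarrow> ('a, 'n, 'g) module_scheme \<Rightarrow> bool"
  where "lmodule_isomorphic A M N \<longleftrightarrow>
     (\<exists>h\<in>lmodule_hom A M N. bij_betw h (carrier M) (carrier N))"

definition supp :: "('a, 'e) ring_scheme \<Rightarrow> 'x set \<Rightarrow> ('x \<Rightarrow> 'a) \<Rightarrow> 'x set" where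
  "supp A X f = {x \<in> X. f x \<noteq> \<zero>\<^bsub>A\<^esub>}"

text \<open>Free left module with basis \<open>X\<close>, as finitely supported functions. The fields
  \<^const>\<open>mult\<close> and \<^const>\<open>one\<close>, which every \<^const>\<open>smult\<close>-record carries, play no role for
  modules.\<close>

definition free_lmodule :: "('a, 'e) ring_scheme \<Rightarrow> 'x set \<Rightarrow> ('a, 'x \<Rightarrow> 'a) module" where
  "free_lmodule A X =
     \<lparr>carrier = {f \<in> X \<rightarrow>\<^sub>E carrier A. finite (supp A X f)},
      mult = undefined, one = undefined,
      zero = (\<lambda>x\<in>X. \<zero>\<^bsub>A\<^esub>),
      add = (\<lambda>f g. \<lambda>x\<in>X. f x \<oplus>\<^bsub>A\<^esub> g x),
      smult = (\<lambda>a f. \<lambda>x\<in>X. a \<otimes>\<^bsub>A\<^esub> f x)\<rparr>"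

definition basis_elt :: "('a, 'e) ring_scheme \<Rightarrow> 'x set \<Rightarrow> 'x \<Rightarrow> 'x \<Rightarrow> 'a" where
  "basis_elt A X p = (\<lambda>q\<in>X. if q = p then \<one>\<^bsub>A\<^esub> else \<zero>\<^bsub>A\<^esub>)"

text \<open>Projective modules are the direct summands of free modules. Bases inside the type of the
  elements of \<open>M\<close> suffice: a projective \<open>M\<close> is a summand of the free module on
  \<open>carrier M\<close>.\<close>

definition projective :: "('a, 'e) ring_scheme \<Rightarrow> ('a, 'm, 'f) module_scheme \<Rightarrow> bool" where
  "projective A M \<longleftrightarrow> lmodule A M \<and>
     (\<exists>(X :: 'm set). \<exists>s \<in> lmodule_hom A M (free_lmodule A X).
        \<exists>p \<in> lmodule_hom A (free_lmodule A X) M. \<forall>x\<in>carrier M. p (s x) = x)"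

definition quot_lmodule :: "('a, 'm, 'f) module_scheme \<Rightarrow> 'm set \<Rightarrow> ('a, 'm set) module" where
  "quot_lmodule M S =
     \<lparr>carrier = a_rcosets\<^bsub>M\<^esub> S,
      mult = undefined, one = undefined,
      zero = S,
      add = set_add M,
      smult = (\<lambda>a C. \<Union>x\<in>C. S +>\<^bsub>M\<^esub> (a \<odot>\<^bsub>M\<^esub> x))\<rparr>"

definition lmodule_span :: "('a, 'e) ring_scheme \<Rightarrow> ('a, 'm, 'f) module_scheme \<Rightarrow> 'm set \<Rightarrow> 'm set" where
  "lmodule_span A M G = \<Inter>{S. submodule S A M \<and> G \<subseteq> S}"


section \<open>Tor\<close>

text \<open>Augmented resolution
  \<open>\<cdots> \<rightarrow> P 2 \<rightarrow> P 1 \<rightarrow> P 0 \<rightarrow> M \<rightarrow> 0\<close> with \<open>d k : P (k + 1) \<rightarrow> P k\<close> and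
  augmentation \<open>\<epsilon> : P 0 \<rightarrow> M\<close>.\<close>

definition projective_resolution ::
    "('a, 'e) ring_scheme \<Rightarrow> ('a, 'm, 'f) module_scheme \<Rightarrow>
     (nat \<Rightarrow> ('a, 'p) module) \<Rightarrow> (nat \<Rightarrow> 'p \<Rightarrow> 'p) \<Rightarrow> ('p \<Rightarrow> 'm) \<Rightarrow> bool" where
  "projective_resolution A M P d \<epsilon> \<longleftrightarrow>
     lmodule A M \<and>
     (\<forall>k. projective A (P k)) \<and>
     (\<forall>k. d k \<in> lmodule_hom A (P (Suc k)) (P k)) \<and>
     \<epsilon> \<in> lmodule_hom A (P 0) M \<and>
     \<epsilon> ` carrier (P 0) = carrier M \<and>
     d 0 ` carrier (P (Suc 0)) = a_kernel (P 0) M \<epsilon> \<and>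
     (\<forall>k. d (Suc k) ` carrier (P (Suc (Suc k))) = a_kernel (P (Suc k)) (P k) (d k))"

text \<open>Tensor product \<open>M \<otimes>\<^sub>A N\<close> of a right \<open>A\<close>-module \<open>M\<close> and a left \<open>A\<close>-module
  \<open>N\<close> over an associative algebra \<open>A\<close> over the commutative ring \<open>R\<close>, as an
  \<open>R\<close>-module: the free \<open>R\<close>-module on pairs modulo the \<open>R\<close>-bilinear and
  \<open>A\<close>-balanced relations. The \<open>R\<close>-action on \<open>M\<close> and \<open>N\<close> is the one through
  \<open>r \<mapsto> r \<cdot> 1\<^sub>A\<close>. The algebra is a \<^const>\<open>smult\<close>-record, whose scalar product is the one
  of \<open>R\<close> on \<open>A\<close>.\<close>

definition tensor_gens ::
    "('r, 'e) ring_scheme \<Rightarrow> ('r, 'a, 'f) module_scheme \<Rightarrow> ('a, 'm, 'g) module_scheme \<Rightarrow>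
     ('a, 'n, 'h) module_scheme \<Rightarrow> ('m \<times> 'n \<Rightarrow> 'r) set" where
  "tensor_gens R A M N =
    (let X = carrier M \<times> carrier N; F = free_lmodule R X; e = (\<lambda>m n. basis_elt R X (m, n)) in
     {e (m \<oplus>\<^bsub>M\<^esub> m') n \<ominus>\<^bsub>F\<^esub> (e m n \<oplus>\<^bsub>F\<^esub> e m' n) | m m' n.
        m \<in> carrier M \<and> m' \<in> carrier M \<and> n \<in> carrier N} \<union>
     {e m (n \<oplus>\<^bsub>N\<^esub> n') \<ominus>\<^bsub>F\<^esub> (e m n \<oplus>\<^bsub>F\<^esub> e m n') | m n n'.
        m \<in> carrier M \<and> n \<in> carrier N \<and> n' \<in> carrier N} \<union>
     {e ((r \<odot>\<^bsub>A\<^esub> \<one>\<^bsub>A\<^esub>) \<odot>\<^bsub>M\<^esub> m) n \<ominus>\<^bsub>F\<^esub> r \<odot>\<^bsub>F\<^esub> e m n | r m n.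
        r \<in> carrier R \<and> m \<in> carrier M \<and> n \<in> carrier N} \<union>
     {e m ((r \<odot>\<^bsub>A\<^esub> \<one>\<^bsub>A\<^esub>) \<odot>\<^bsub>N\<^esub> n) \<ominus>\<^bsub>F\<^esub> r \<odot>\<^bsub>F\<^esub> e m n | r m n.
        r \<in> carrier R \<and> m \<in> carrier M \<and> n \<in> carrier N} \<union>
     {e (a \<odot>\<^bsub>M\<^esub> m) n \<ominus>\<^bsub>F\<^esub> e m (a \<odot>\<^bsub>N\<^esub> n) | a m n.
        a \<in> carrier A \<and> m \<in> carrier M \<and> n \<in> carrier N})"

definition tensor_rel ::
    "('r, 'e) ring_scheme \<Rightarrow> ('r, 'a, 'f) module_scheme \<Rightarrow> ('a, 'm, 'g) module_scheme \<Rightarrow>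
     ('a, 'n, 'h) module_scheme \<Rightarrow> ('m \<times> 'n \<Rightarrow> 'r) set" where
  "tensor_rel R A M N =
     lmodule_span R (free_lmodule R (carrier M \<times> carrier N)) (tensor_gens R A M N)"

definition tensor ::
    "('r, 'e) ring_scheme \<Rightarrow> ('r, 'a, 'f) module_scheme \<Rightarrow> ('a, 'm, 'g) module_scheme \<Rightarrow>
     ('a, 'n, 'h) module_scheme \<Rightarrow> ('r, ('m \<times> 'n \<Rightarrow> 'r) set) module" where
  "tensor R A M N =
     quot_lmodule (free_lmodule R (carrier M \<times> carrier N)) (tensor_rel R A M N)"

text \<open>The map \<open>\<phi> \<otimes> id : M \<otimes>\<^sub>A N \<rightarrow> M' \<otimes>\<^sub>A N\<close>.\<close>

definition tensor_map ::
    "('r, 'e) ring_scheme \<Rightarrow> ('r, 'a, 'f) module_scheme \<Rightarrow> ('a, 'm, 'g) module_scheme \<Rightarrow>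
     ('a, 'm2, 'g2) module_scheme \<Rightarrow> ('a, 'n, 'h) module_scheme \<Rightarrow> ('m \<Rightarrow> 'm2) \<Rightarrow>
     ('m \<times> 'n \<Rightarrow> 'r) set \<Rightarrow> ('m2 \<times> 'n \<Rightarrow> 'r) set" where
  "tensor_map R A M M' N \<phi> C =
    (let X = carrier M \<times> carrier N; X' = carrier M' \<times> carrier N; F' = free_lmodule R X' in
     the_elem ((\<lambda>f. tensor_rel R A M' N +>\<^bsub>F'\<^esub>
        (\<Oplus>\<^bsub>F'\<^esub>p\<in>supp R X f. f p \<odot>\<^bsub>F'\<^esub> basis_elt R X' (\<phi> (fst p), snd p))) ` C))"

text \<open>Homology of a chain complex with \<open>b k : C (k + 1) \<rightarrow> C k\<close> in nonnegative degrees.\<close>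

fun cycles :: "(nat \<Rightarrow> ('r, 'c) module) \<Rightarrow> (nat \<Rightarrow> 'c \<Rightarrow> 'c) \<Rightarrow> nat \<Rightarrow> 'c set" where
  "cycles C b 0 = carrier (C 0)"
| "cycles C b (Suc k) = a_kernel (C (Suc k)) (C k) (b k)"

definition homology :: "(nat \<Rightarrow> ('r, 'c) module) \<Rightarrow> (nat \<Rightarrow> 'c \<Rightarrow> 'c) \<Rightarrow> nat \<Rightarrow> ('r, 'c set) module" where
  "homology C b k =
     quot_lmodule ((C k)\<lparr>carrier := cycles C b k\<rparr>) (b k ` carrier (C (Suc k)))"

text \<open>\<open>Tor\<^sup>A\<^sub>k(M, N) = H\<^sub>k(P \<otimes>\<^sub>A N)\<close>, computed from a projective resolution \<open>(P, d)\<close> of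
  the right \<open>A\<close>-module \<open>M\<close>. It depends on the choice of \<open>(P, d)\<close> only up to isomorphism;
  a statement about \<open>Tor\<close> is to be made for all choices.\<close>

definition Tor ::
    "('r, 'e) ring_scheme \<Rightarrow> ('r, 'a, 'f) module_scheme \<Rightarrow> (nat \<Rightarrow> ('a, 'p) module) \<Rightarrow>
     (nat \<Rightarrow> 'p \<Rightarrow> 'p) \<Rightarrow> ('a, 'n, 'h) module_scheme \<Rightarrow> nat \<Rightarrow>
     ('r, ('p \<times> 'n \<Rightarrow> 'r) set set) module" where
  "Tor R A P d N k =
     homology (\<lambda>i. tensor R A (P i) N) (\<lambda>i. tensor_map R A (P (Suc i)) (P i) N (d i)) k"


section \<open>Algebras with a basis closed under multiplication up to scalars\<close>

text \<open>Bilinear extension of \<open>x \<cdot> y = c x y \<cdot> (m x y)\<close> for basis elements \<open>x, y \<in> X\<close>.\<close>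

definition basis_algebra ::
    "('r, 'e) ring_scheme \<Rightarrow> 'x set \<Rightarrow> ('x \<Rightarrow> 'x \<Rightarrow> 'r) \<Rightarrow> ('x \<Rightarrow> 'x \<Rightarrow> 'x) \<Rightarrow> 'x \<Rightarrow> ('r, 'x \<Rightarrow> 'r) module"
  where
  "basis_algebra R X c m u = (free_lmodule R X)
     \<lparr>mult := \<lambda>f g. \<lambda>z\<in>X. \<Oplus>\<^bsub>R\<^esub>p\<in>{p \<in> supp R X f \<times> supp R X g. m (fst p) (snd p) = z}.
         c (fst p) (snd p) \<otimes>\<^bsub>R\<^esub> (f (fst p) \<otimes>\<^bsub>R\<^esub> g (snd p)),
      one := basis_elt R X u\<rparr>"

text \<open>A copy of \<open>R\<close> on which the basis element \<open>x \<in> X\<close> acts as multiplication by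
  \<open>\<chi> x\<close>.\<close>

definition scalar_module ::
    "('r, 'e) ring_scheme \<Rightarrow> 'x set \<Rightarrow> ('x \<Rightarrow> 'r) \<Rightarrow> ('x \<Rightarrow> 'r, 'r) module" where
  "scalar_module R X \<chi> =
     \<lparr>carrier = carrier R, mult = undefined, one = undefined, zero = \<zero>\<^bsub>R\<^esub>, add = add R,
      smult = (\<lambda>f r. (\<Oplus>\<^bsub>R\<^esub>x\<in>supp R X f. f x \<otimes>\<^bsub>R\<^esub> \<chi> x) \<otimes>\<^bsub>R\<^esub> r)\<rparr>"

definition group_algebra :: "('r, 'e) ring_scheme \<Rightarrow> ('g, 'h) monoid_scheme \<Rightarrow> ('r, 'g \<Rightarrow> 'r) module" where
  "group_algebra R G = basis_algebra R (carrier G) (\<lambda>_ _. \<one>\<^bsub>R\<^esub>) (mult G) \<one>\<^bsub>G\<^esub>"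

definition group_trivial_module ::
    "('r, 'e) ring_scheme \<Rightarrow> ('g, 'h) monoid_scheme \<Rightarrow> ('g \<Rightarrow> 'r, 'r) module" where
  "group_trivial_module R G = scalar_module R (carrier G) (\<lambda>_. \<one>\<^bsub>R\<^esub>)"


section \<open>Brauer algebras\<close>

text \<open>\<open>Mid\<close> only occurs in concatenations of two diagrams. An edge is the set of its end points.\<close>

datatype column = Lft | Mid | Rgt

type_synonym node = "column \<times> nat"
type_synonym diagram = "node set set"

definition outer_nodes :: "nat \<Rightarrow> node set" where
  "outer_nodes n = {Lft, Rgt} \<times> {1..n}"

definition brauer_diagrams :: "nat \<Rightarrow> diagram set" where
  "brauer_diagrams n =
     {D. (\<forall>e\<in>D. e \<subseteq> outer_nodes n \<and> card e = 2) \<and> (\<forall>v\<in>outer_nodes n. \<exists>!e. e \<in> D \<and> v \<in> e)}"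

fun place_left :: "node \<Rightarrow> node" where
  "place_left (c, i) = (if c = Rgt then Mid else c, i)"

fun place_right :: "node \<Rightarrow> node" where
  "place_right (c, i) = (if c = Lft then Mid else c, i)"

text \<open>Connectedness in the concatenated graph. An edge \<open>{Mid i, Mid j}\<close> contributed by both
  diagrams is not recorded twice, which does not affect connectedness.\<close>

definition concat_edges :: "diagram \<Rightarrow> diagram \<Rightarrow> node set set" where
  "concat_edges x y = (\<lambda>e. place_left ` e) ` x \<union> (\<lambda>e. place_right ` e) ` y"

definition connected_nodes :: "diagram \<Rightarrow> diagram \<Rightarrow> (node \<times> node) set" where
  "connected_nodes x y = {(u, v). {u, v} \<in> concat_edges x y}\<^sup>*"

definition brauer_comp :: "nat \<Rightarrow> diagram \<Rightarrow> diagram \<Rightarrow> diagram" where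
  "brauer_comp n x y =
     {{u, v} | u v. u \<in> outer_nodes n \<and> v \<in> outer_nodes n \<and> u \<noteq> v \<and> (u, v) \<in> connected_nodes x y}"

text \<open>Every middle node lies on exactly one edge of each diagram, so the closed loops are the
  connected components consisting of middle nodes.\<close>

definition brauer_loops :: "nat \<Rightarrow> diagram \<Rightarrow> diagram \<Rightarrow> nat" where
  "brauer_loops n x y =
     card {C. C \<subseteq> {Mid} \<times> {1..n} \<and> (\<exists>i\<in>{1..n}. C = connected_nodes x y `` {(Mid, i)})}"

definition brauer_id :: "nat \<Rightarrow> diagram" where
  "brauer_id n = {{(Lft, i), (Rgt, i)} | i. i \<in> {1..n}}"

definition brauer_algebra :: "('r, 'e) ring_scheme \<Rightarrow> nat \<Rightarrow> 'r \<Rightarrow> ('r, diagram \<Rightarrow> 'r) module" where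
  "brauer_algebra R n \<delta> = basis_algebra R (brauer_diagrams n)
     (\<lambda>x y. \<delta> [^]\<^bsub>R\<^esub> brauer_loops n x y) (brauer_comp n) (brauer_id n)"

definition has_turnback :: "diagram \<Rightarrow> bool" where
  "has_turnback D \<longleftrightarrow> (\<exists>e\<in>D. \<exists>c. fst ` e = {c})"

definition brauer_trivial_module ::
    "('r, 'e) ring_scheme \<Rightarrow> nat \<Rightarrow> (diagram \<Rightarrow> 'r, 'r) module" where
  "brauer_trivial_module R n = scalar_module R (brauer_diagrams n)
     (\<lambda>D. if has_turnback D then \<zero>\<^bsub>R\<^esub> else \<one>\<^bsub>R\<^esub>)"

end

theory Submission
  imports Defs
begin

text \<open>Let \<open>I\<close> be the ideal of \<open>Br\<^sub>n(\<delta>)\<close> spanned by the diagrams with turnbacks, so that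
  \<open>Br\<^sub>n(\<delta>) / I = R\<Sigma>\<^sub>n\<close>. For a nonempty set \<open>S\<close> of right-to-right edges let \<open>J\<^sub>S\<close> be the left ideal
  spanned by the diagrams containing \<open>S\<close>. As \<open>n\<close> is odd, \<open>S\<close> leaves some node unmatched, and
  this allows one to construct \<open>e \<in> J\<^sub>S\<close> with \<open>a e = a\<close> for all \<open>a \<in> J\<^sub>S\<close>, for every
  \<open>\<delta>\<close>. Hence \<open>P J\<^sub>S\<close> is acyclic for every projective resolution \<open>P\<close> of the right module \<open>1\<close>:
  multiply a preimage of a cycle by \<open>e\<close>. Now \<open>I\<close> is the sum of finitely many \<open>J\<^sub>S\<close>,
  intersections satisfy \<open>J\<^sub>S \<inter> J\<^sub>T = J\<^bsub>S \<union> T\<^esub>\<close>, and \<open>P J \<inter> P J' = P (J \<inter> J')\<close> because \<open>P\<close> is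
  projective, so \<open>P I\<close> is acyclic by Mayer--Vietoris. Thus \<open>P / P I\<close> is exact over \<open>1\<close>, and
  comparing it with a resolution \<open>Q\<close> over \<open>R\<Sigma>\<^sub>n\<close> gives mutually inverse homotopy equivalences.
  They induce the isomorphism since \<open>P \<otimes> 1 = P / P K\<close> for the augmentation ideal \<open>K \<supseteq> I\<close>.\<close>

section \<open>Modules and homomorphisms\<close>

text \<open>The obstacle is that \<delta> need not be invertible, so diagrams cannot be rescaled to
  idempotents. The free node replaces the division: a path that would close up to a loop is led out
  through that node, and no power of \<delta> arises. A perfect matching S of the right nodes would
  leave no such exit. Right modules are modules over \<open>op_ring\<close>, so a left ideal of the
  algebra is a \<open>right_ideal\<close> of the opposite ring, and a right unit e is a left unit
  there. For one-sided J, the product of P and J is only a subgroup of P; the acyclicity part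
  therefore chases elements and uses additive maps. The quotient of P by I is never formed. The
  comparison theorem is proved modulo submodules, for maps that are linear only up to them, since
  the composite of the two comparison maps on P is linear only modulo I. Associativity of the Brauer
  algebra is not derived from the combinatorics: it is contained in the hypothesis that a resolution
  is given, because resolutions live over rings.\<close>

lemma op_ring_simps [simp]:
  "carrier (op_ring A) = carrier A" "zero (op_ring A) = zero A" "add (op_ring A) = add A"
  "one (op_ring A) = one A" "mult (op_ring A) x y = mult A y x"
  by (simp_all add: op_ring_def)

lemma lmodule_abelian_group: "lmodule A M \<Longrightarrow> abelian_group M"
  by (simp add: lmodule_def)

lemma lmodule_ring: "lmodule A M \<Longrightarrow> ring A"
  by (simp add: lmodule_def)

context abelian_group
begin

lemma minus_eq_zero_iff:
  assumes "x \<in> carrier G" "y \<in> carrier G"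
  shows "x \<ominus> y = \<zero> \<longleftrightarrow> x = y"
  using assms by (metis a_minus_def add.inv_closed add.inv_inv add.inv_equality r_neg)

lemma minus_zero_right: "x \<in> carrier G \<Longrightarrow> x \<ominus> \<zero> = x"
  by (simp add: a_minus_def)

lemma self_minus: "x \<in> carrier G \<Longrightarrow> x \<ominus> x = \<zero>"
  by (simp add: a_minus_def r_neg)

lemma add_minus_cancel: "\<lbrakk>x \<in> carrier G; y \<in> carrier G\<rbrakk> \<Longrightarrow> y \<oplus> (x \<ominus> y) = x"
  by (metis a_comm a_minus_def a_assoc add.inv_closed l_neg add.r_one)

lemma minus_add_cancel: "\<lbrakk>x \<in> carrier G; y \<in> carrier G\<rbrakk> \<Longrightarrow> (x \<ominus> y) \<oplus> y = x"
  by (metis a_minus_def a_assoc add.inv_closed l_neg add.r_one)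

lemma add_minus_swap: "\<lbrakk>x \<in> carrier G; y \<in> carrier G; x' \<in> carrier G; y' \<in> carrier G\<rbrakk> \<Longrightarrow>
  (x \<oplus> y) \<ominus> (x' \<oplus> y') = (x \<ominus> x') \<oplus> (y \<ominus> y')"
  by (simp add: a_minus_def minus_add a_ac)

lemma minus_minus_swap: "\<lbrakk>x \<in> carrier G; y \<in> carrier G; x' \<in> carrier G; y' \<in> carrier G\<rbrakk> \<Longrightarrow>
  (x \<ominus> y) \<ominus> (x' \<ominus> y') = (x \<ominus> x') \<ominus> (y \<ominus> y')"
  by (simp add: a_minus_def minus_add a_ac)

lemma minus_trans: "\<lbrakk>x \<in> carrier G; y \<in> carrier G; z \<in> carrier G\<rbrakk> \<Longrightarrow>
  x \<ominus> z = (x \<ominus> y) \<oplus> (y \<ominus> z)"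
  by (simp add: a_minus_def a_assoc l_neg flip: a_assoc[of "\<ominus> y" y])

lemma inv_minus: "\<lbrakk>x \<in> carrier G; y \<in> carrier G\<rbrakk> \<Longrightarrow> \<ominus> (x \<ominus> y) = y \<ominus> x"
  by (simp add: a_minus_def minus_add a_comm)

end

section \<open>Calculation in modules over a ring that need not commute\<close>

context lmodule
begin

lemma smult_r_null: assumes "a \<in> carrier A" shows "a \<odot>\<^bsub>M\<^esub> \<zero>\<^bsub>M\<^esub> = \<zero>\<^bsub>M\<^esub>"
proof -
  have "a \<odot>\<^bsub>M\<^esub> \<zero>\<^bsub>M\<^esub> \<oplus>\<^bsub>M\<^esub> a \<odot>\<^bsub>M\<^esub> \<zero>\<^bsub>M\<^esub> = a \<odot>\<^bsub>M\<^esub> \<zero>\<^bsub>M\<^esub>"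
    using smult_r_distr[OF assms, of "\<zero>\<^bsub>M\<^esub>" "\<zero>\<^bsub>M\<^esub>"] by simp
  then show ?thesis using smult_closed[OF assms, of "\<zero>\<^bsub>M\<^esub>"] M.add.r_cancel_one by blast
qed

lemma smult_l_null: assumes "x \<in> carrier M" shows "\<zero>\<^bsub>A\<^esub> \<odot>\<^bsub>M\<^esub> x = \<zero>\<^bsub>M\<^esub>"
proof -
  have "\<zero>\<^bsub>A\<^esub> \<odot>\<^bsub>M\<^esub> x \<oplus>\<^bsub>M\<^esub> \<zero>\<^bsub>A\<^esub> \<odot>\<^bsub>M\<^esub> x = \<zero>\<^bsub>A\<^esub> \<odot>\<^bsub>M\<^esub> x"
    using smult_l_distr[of "\<zero>\<^bsub>A\<^esub>" "\<zero>\<^bsub>A\<^esub>", OF _ _ assms] by simp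
  then show ?thesis using smult_closed[of "\<zero>\<^bsub>A\<^esub>", OF _ assms] M.add.r_cancel_one by blast
qed

lemma smult_r_minus:
  assumes "a \<in> carrier A" "x \<in> carrier M" shows "a \<odot>\<^bsub>M\<^esub> (\<ominus>\<^bsub>M\<^esub> x) = \<ominus>\<^bsub>M\<^esub> (a \<odot>\<^bsub>M\<^esub> x)"
proof -
  have "a \<odot>\<^bsub>M\<^esub> (\<ominus>\<^bsub>M\<^esub> x) \<oplus>\<^bsub>M\<^esub> a \<odot>\<^bsub>M\<^esub> x = \<zero>\<^bsub>M\<^esub>"
    using assms by (simp add: smult_r_null M.l_neg flip: smult_r_distr)
  then show ?thesis using assms by (metis M.a_inv_closed M.minus_equality smult_closed)
qed

lemma smult_l_minus:
  assumes "a \<in> carrier A" "x \<in> carrier M" shows "(\<ominus>\<^bsub>A\<^esub> a) \<odot>\<^bsub>M\<^esub> x = \<ominus>\<^bsub>M\<^esub> (a \<odot>\<^bsub>M\<^esub> x)"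
proof -
  have "(\<ominus>\<^bsub>A\<^esub> a) \<odot>\<^bsub>M\<^esub> x \<oplus>\<^bsub>M\<^esub> a \<odot>\<^bsub>M\<^esub> x = \<zero>\<^bsub>M\<^esub>"
    using assms by (simp add: smult_l_null A.l_neg flip: smult_l_distr)
  then show ?thesis using assms by (metis A.a_inv_closed M.minus_equality smult_closed)
qed

lemma smult_r_diff:
  assumes "a \<in> carrier A" "x \<in> carrier M" "y \<in> carrier M"
  shows "a \<odot>\<^bsub>M\<^esub> (x \<ominus>\<^bsub>M\<^esub> y) = a \<odot>\<^bsub>M\<^esub> x \<ominus>\<^bsub>M\<^esub> a \<odot>\<^bsub>M\<^esub> y"
  using assms by (simp add: a_minus_def smult_r_distr smult_r_minus)

lemma smult_l_diff:
  assumes "a \<in> carrier A" "b \<in> carrier A" "x \<in> carrier M"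
  shows "(a \<ominus>\<^bsub>A\<^esub> b) \<odot>\<^bsub>M\<^esub> x = a \<odot>\<^bsub>M\<^esub> x \<ominus>\<^bsub>M\<^esub> b \<odot>\<^bsub>M\<^esub> x"
  using assms by (simp add: a_minus_def smult_l_distr smult_l_minus)

end

lemma lmodule_homD:
  assumes "h \<in> lmodule_hom A M N"
  shows "x \<in> carrier M \<Longrightarrow> h x \<in> carrier N"
    and "\<lbrakk>x \<in> carrier M; y \<in> carrier M\<rbrakk> \<Longrightarrow> h (x \<oplus>\<^bsub>M\<^esub> y) = h x \<oplus>\<^bsub>N\<^esub> h y"
    and "\<lbrakk>a \<in> carrier A; x \<in> carrier M\<rbrakk> \<Longrightarrow> h (a \<odot>\<^bsub>M\<^esub> x) = a \<odot>\<^bsub>N\<^esub> h x"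
  using assms by (auto simp: lmodule_hom_def)

lemma lmodule_homI:
  assumes "\<And>x. x \<in> carrier M \<Longrightarrow> h x \<in> carrier N"
    and "\<And>x y. \<lbrakk>x \<in> carrier M; y \<in> carrier M\<rbrakk> \<Longrightarrow> h (x \<oplus>\<^bsub>M\<^esub> y) = h x \<oplus>\<^bsub>N\<^esub> h y"
    and "\<And>a x. \<lbrakk>a \<in> carrier A; x \<in> carrier M\<rbrakk> \<Longrightarrow> h (a \<odot>\<^bsub>M\<^esub> x) = a \<odot>\<^bsub>N\<^esub> h x"
  shows "h \<in> lmodule_hom A M N"
  using assms by (auto simp: lmodule_hom_def)

lemma lmodule_hom_comp:
  "\<lbrakk>h \<in> lmodule_hom A L M; k \<in> lmodule_hom A M N\<rbrakk> \<Longrightarrow> (\<lambda>x. k (h x)) \<in> lmodule_hom A L N"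
  by (auto simp: lmodule_hom_def Pi_iff)

text \<open>Several maps below are not linear over a single ring: the comparison maps between
  \<open>P\<close> and \<open>Q\<close> change the ring, and the maps to be shown null-homotopic are
  linear only modulo a submodule. Source and target are ring records, so characters of algebras are
  covered too.\<close>

definition additive :: "('a, 'e) ring_scheme \<Rightarrow> ('b, 'f) ring_scheme \<Rightarrow> ('a \<Rightarrow> 'b) \<Rightarrow> bool" where
  "additive M N h \<longleftrightarrow> abelian_group M \<and> abelian_group N \<and> h \<in> carrier M \<rightarrow> carrier N \<and>
     (\<forall>x\<in>carrier M. \<forall>y\<in>carrier M. h (x \<oplus>\<^bsub>M\<^esub> y) = h x \<oplus>\<^bsub>N\<^esub> h y)"

lemma additive_lmodule_hom:
  "\<lbrakk>lmodule A M; lmodule A N; h \<in> lmodule_hom A M N\<rbrakk> \<Longrightarrow> additive M N h"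
  by (auto simp: additive_def lmodule_hom_def lmodule_abelian_group)

lemma additive_closed: "\<lbrakk>additive M N h; x \<in> carrier M\<rbrakk> \<Longrightarrow> h x \<in> carrier N"
  by (auto simp: additive_def)

lemma additive_add:
  "\<lbrakk>additive M N h; x \<in> carrier M; y \<in> carrier M\<rbrakk> \<Longrightarrow> h (x \<oplus>\<^bsub>M\<^esub> y) = h x \<oplus>\<^bsub>N\<^esub> h y"
  by (auto simp: additive_def)

lemma additive_zero: assumes "additive M N h" shows "h \<zero>\<^bsub>M\<^esub> = \<zero>\<^bsub>N\<^esub>"
proof -
  interpret M: abelian_group M using assms by (simp add: additive_def)
  interpret N: abelian_group N using assms by (simp add: additive_def)
  have "h \<zero>\<^bsub>M\<^esub> \<oplus>\<^bsub>N\<^esub> h \<zero>\<^bsub>M\<^esub> = h \<zero>\<^bsub>M\<^esub>"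
    using additive_add[OF assms M.zero_closed M.zero_closed] by simp
  then show ?thesis using additive_closed[OF assms M.zero_closed] N.add.r_cancel_one by blast
qed

lemma additive_inv:
  assumes "additive M N h" "x \<in> carrier M" shows "h (\<ominus>\<^bsub>M\<^esub> x) = \<ominus>\<^bsub>N\<^esub> h x"
proof -
  interpret M: abelian_group M using assms by (simp add: additive_def)
  interpret N: abelian_group N using assms by (simp add: additive_def)
  have "h (\<ominus>\<^bsub>M\<^esub> x) \<oplus>\<^bsub>N\<^esub> h x = \<zero>\<^bsub>N\<^esub>"
    using assms by (simp add: M.l_neg additive_zero[OF assms(1)] flip: additive_add[OF assms(1)])
  then show ?thesis using assms by (metis M.a_inv_closed N.minus_equality additive_closed)
qed

lemma additive_diff:
  assumes "additive M N h" "x \<in> carrier M" "y \<in> carrier M"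
  shows "h (x \<ominus>\<^bsub>M\<^esub> y) = h x \<ominus>\<^bsub>N\<^esub> h y"
proof -
  interpret M: abelian_group M using assms by (simp add: additive_def)
  show ?thesis using assms by (simp add: a_minus_def additive_add[OF assms(1)] additive_inv)
qed

lemma additive_comp:
  "\<lbrakk>additive L M h; additive M N k\<rbrakk> \<Longrightarrow> additive L N (\<lambda>x. k (h x))"
  by (auto simp: additive_def Pi_iff)

lemma additive_minus:
  assumes "additive M N h" "additive M N k" shows "additive M N (\<lambda>x. h x \<ominus>\<^bsub>N\<^esub> k x)"
proof -
  interpret N: abelian_group N using assms by (simp add: additive_def)
  show ?thesis using assms by (auto simp: additive_def Pi_iff N.add_minus_swap)
qed

lemma additive_id: "abelian_group M \<Longrightarrow> additive M M (\<lambda>x. x)"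
  by (simp add: additive_def)

section \<open>Restriction of scalars\<close>

definition restrict_scalars ::
    "('a \<Rightarrow> 'b) \<Rightarrow> ('b, 'm, 'f) module_scheme \<Rightarrow> ('a, 'm) module" where
  "restrict_scalars \<phi> M =
     \<lparr>carrier = carrier M, mult = undefined, one = undefined, zero = zero M, add = add M,
      smult = (\<lambda>a x. \<phi> a \<odot>\<^bsub>M\<^esub> x)\<rparr>"

lemma restrict_scalars_simps [simp]:
  "carrier (restrict_scalars \<phi> M) = carrier M" "zero (restrict_scalars \<phi> M) = zero M"
  "add (restrict_scalars \<phi> M) = add M" "smult (restrict_scalars \<phi> M) a x = \<phi> a \<odot>\<^bsub>M\<^esub> x"
  by (simp_all add: restrict_scalars_def)

lemma a_inv_cong:
  assumes "carrier M = carrier N" "zero M = zero N" "add M = add N"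
  shows "a_inv M x = a_inv N x"
  using assms by (simp add: a_inv_def m_inv_def)

lemma a_minus_cong:
  assumes "carrier M = carrier N" "zero M = zero N" "add M = add N"
  shows "a_minus M x y = a_minus N x y"
  using assms by (simp add: a_minus_def a_inv_cong[OF assms])

lemma restrict_scalars_minus [simp]:
  "a_inv (restrict_scalars \<phi> M) = a_inv M" "a_minus (restrict_scalars \<phi> M) = a_minus M"
  by (intro ext a_inv_cong a_minus_cong; simp)+

lemma abelian_group_cong:
  assumes "carrier M = carrier N" "zero M = zero N" "add M = add N" "abelian_group M"
  shows "abelian_group N"
  using abelian_groupE[OF assms(4)] assms(1-3) by (intro abelian_groupI) auto

lemma lmodule_restrict_scalars:
  assumes "lmodule B M" "ring A" "\<phi> \<in> ring_hom A B"
  shows "lmodule A (restrict_scalars \<phi> M)"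
proof -
  interpret M: lmodule B M by fact
  have "abelian_group (restrict_scalars \<phi> M)"
    by (rule abelian_group_cong[OF _ _ _ M.M.abelian_group_axioms]) simp_all
  with assms(2,3) show ?thesis
    by (auto simp: lmodule_def lmodule_axioms_def ring_hom_closed ring_hom_add ring_hom_mult
        ring_hom_one M.smult_closed M.smult_l_distr M.smult_r_distr M.smult_assoc M.smult_one)
qed

section \<open>Free modules\<close>

lemma free_lmodule_simps [simp]:
  "carrier (free_lmodule A X) = {f \<in> X \<rightarrow>\<^sub>E carrier A. finite (supp A X f)}"
  "zero (free_lmodule A X) = (\<lambda>x\<in>X. \<zero>\<^bsub>A\<^esub>)"
  "add (free_lmodule A X) f g = (\<lambda>x\<in>X. f x \<oplus>\<^bsub>A\<^esub> g x)"
  "smult (free_lmodule A X) a f = (\<lambda>x\<in>X. a \<otimes>\<^bsub>A\<^esub> f x)"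
  by (simp_all add: free_lmodule_def)

lemma supp_subset: "supp A X f \<subseteq> X"
  by (auto simp: supp_def)

context ring
begin

lemma finite_supp_add:
  "\<lbrakk>finite (supp R X f); finite (supp R X g)\<rbrakk> \<Longrightarrow> finite (supp R X (\<lambda>x\<in>X. f x \<oplus> g x))"
  by (rule finite_subset[of _ "supp R X f \<union> supp R X g"]) (auto simp: supp_def)

lemma finite_supp_smult:
  "\<lbrakk>finite (supp R X f); a \<in> carrier R\<rbrakk> \<Longrightarrow> finite (supp R X (\<lambda>x\<in>X. a \<otimes> f x))"
  by (rule finite_subset[of _ "supp R X f"]) (auto simp: supp_def)

lemma lmodule_free: "lmodule R (free_lmodule R X)"
proof -
  have neg: "finite (supp R X (\<lambda>x\<in>X. \<ominus> f x))" if "finite (supp R X f)" for f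
    using that by (rule finite_subset[rotated]) (auto simp: supp_def)
  have "abelian_group (free_lmodule R X)"
  proof (rule abelian_groupI)
    fix f assume f: "f \<in> carrier (free_lmodule R X)"
    then show "\<exists>g\<in>carrier (free_lmodule R X). g \<oplus>\<^bsub>free_lmodule R X\<^esub> f = \<zero>\<^bsub>free_lmodule R X\<^esub>"
      by (intro bexI[of _ "\<lambda>x\<in>X. \<ominus> f x"]) (auto simp: neg PiE_iff l_neg intro!: restrict_ext)
  next
    show "\<zero>\<^bsub>free_lmodule R X\<^esub> \<in> carrier (free_lmodule R X)" by (auto simp: supp_def)
  qed (auto simp: finite_supp_add PiE_iff a_ac extensional_def fun_eq_iff intro!: restrict_ext)
  then show ?thesis
    by (simp add: lmodule_def lmodule_axioms_def ring_axioms)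
      (auto simp: finite_supp_smult PiE_iff l_distr r_distr m_assoc extensional_def fun_eq_iff
        intro!: restrict_ext)
qed

lemma basis_elt_closed: "x \<in> X \<Longrightarrow> basis_elt R X x \<in> carrier (free_lmodule R X)"
  by (auto simp: basis_elt_def supp_def intro: finite_subset[of _ "{x}"])

text \<open>Each step adds a term at a basis element outside the support so far. The coefficient
  \<open>a\<close> is then a coordinate of the sum itself, which \<open>ideal_smult_free_iff\<close>
  exploits.\<close>

lemma free_lmodule_induct [consumes 1, case_names zero step]:
  assumes f: "f \<in> carrier (free_lmodule R X)"
    and zero: "Q \<zero>\<^bsub>free_lmodule R X\<^esub>"
    and step: "\<And>f a x. \<lbrakk>f \<in> carrier (free_lmodule R X); Q f; a \<in> carrier R; x \<in> X;
      x \<notin> supp R X f\<rbrakk> \<Longrightarrow>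
      Q (f \<oplus>\<^bsub>free_lmodule R X\<^esub> a \<odot>\<^bsub>free_lmodule R X\<^esub> basis_elt R X x)"
  shows "Q f"
proof -
  have "\<forall>f \<in> carrier (free_lmodule R X). supp R X f \<subseteq> T \<longrightarrow> Q f" if "finite T" for T
    using that
  proof (induction T)
    case empty
    have "f = \<zero>\<^bsub>free_lmodule R X\<^esub>" if "f \<in> carrier (free_lmodule R X)" "supp R X f \<subseteq> {}" for f
      using that by (auto simp: supp_def PiE_iff extensional_def fun_eq_iff)
    with zero show ?case by metis
  next
    case (insert y T)
    show ?case
    proof (intro ballI impI)
      fix f assume f: "f \<in> carrier (free_lmodule R X)" "supp R X f \<subseteq> insert y T"
      show "Q f"
      proof (cases "y \<in> X")
        case True
        let ?g = "f(y := \<zero>)"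
        have g: "?g \<in> carrier (free_lmodule R X)"
          using f True by (auto simp: supp_def PiE_iff extensional_def intro: finite_subset[of _ "supp R X f"])
        have "supp R X ?g \<subseteq> T" using f by (auto simp: supp_def)
        with g insert have "Q ?g" by blast
        moreover have "y \<notin> supp R X ?g" by (simp add: supp_def)
        moreover have "f y \<in> carrier R" using f True by auto
        ultimately have "Q (?g \<oplus>\<^bsub>free_lmodule R X\<^esub> f y \<odot>\<^bsub>free_lmodule R X\<^esub> basis_elt R X y)"
          using step g True by blast
        moreover have "?g \<oplus>\<^bsub>free_lmodule R X\<^esub> f y \<odot>\<^bsub>free_lmodule R X\<^esub> basis_elt R X y = f"
          using f True by (auto simp: basis_elt_def PiE_iff extensional_def fun_eq_iff)
        ultimately show ?thesis by simp
      next
        case False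
        then have "supp R X f \<subseteq> T" using f supp_subset[of R X f] by auto
        with insert f show ?thesis by blast
      qed
    qed
  qed
  with f show ?thesis by auto
qed

end

text \<open>The sum inside \<open>tensor_map\<close> has literally this form, so the map pushed
  forward along \<phi> there is a linear extension.\<close>

definition lin_ext ::
    "('a, 'e) ring_scheme \<Rightarrow> 'x set \<Rightarrow> ('a, 'm, 'f) module_scheme \<Rightarrow> ('x \<Rightarrow> 'm) \<Rightarrow> ('x \<Rightarrow> 'a) \<Rightarrow> 'm" where
  "lin_ext A X M v f = (\<Oplus>\<^bsub>M\<^esub>x\<in>supp A X f. f x \<odot>\<^bsub>M\<^esub> v x)"

context lmodule
begin

text \<open>The supports of \<open>f\<close>, \<open>g\<close> and their sum differ. Over a common
  finite index set linearity becomes an identity between terms.\<close>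

lemma lin_ext_superset:
  assumes "f \<in> carrier (free_lmodule A X)" "v \<in> X \<rightarrow> carrier M" "finite T" "supp A X f \<subseteq> T" "T \<subseteq> X"
  shows "lin_ext A X M v f = (\<Oplus>\<^bsub>M\<^esub>x\<in>T. f x \<odot>\<^bsub>M\<^esub> v x)"
  unfolding lin_ext_def
proof (rule M.add.finprod_mono_neutral_cong_left)
  show "\<And>i. i \<in> T - supp A X f \<Longrightarrow> f i \<odot>\<^bsub>M\<^esub> v i = \<zero>\<^bsub>M\<^esub>"
    using assms by (auto simp: supp_def subset_iff smult_l_null Pi_iff)
  show "(\<lambda>x. f x \<odot>\<^bsub>M\<^esub> v x) \<in> T \<rightarrow> carrier M"
    using assms by (auto simp: PiE_iff Pi_iff intro!: smult_closed)
qed (use assms in auto)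

lemma lin_ext_hom:
  assumes v: "v \<in> X \<rightarrow> carrier M"
  shows "lin_ext A X M v \<in> lmodule_hom A (free_lmodule A X) M"
proof (rule lmodule_homI)
  fix f assume f: "f \<in> carrier (free_lmodule A X)"
  have cl: "(\<lambda>x. f x \<odot>\<^bsub>M\<^esub> v x) \<in> T \<rightarrow> carrier M" if "T \<subseteq> X" for T
    using f v that by (auto simp: PiE_iff Pi_iff intro!: smult_closed)
  show "lin_ext A X M v f \<in> carrier M"
    unfolding lin_ext_def by (intro M.finsum_closed cl supp_subset)
  fix g assume g: "g \<in> carrier (free_lmodule A X)"
  have clg: "(\<lambda>x. g x \<odot>\<^bsub>M\<^esub> v x) \<in> T \<rightarrow> carrier M" if "T \<subseteq> X" for T
    using g v that by (auto simp: PiE_iff Pi_iff intro!: smult_closed)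
  let ?T = "supp A X f \<union> supp A X g"
  have T: "finite ?T" "?T \<subseteq> X" using f g by (auto simp: supp_def)
  have fg: "f \<oplus>\<^bsub>free_lmodule A X\<^esub> g \<in> carrier (free_lmodule A X)"
    using f g abelian_groupE(1)[OF lmodule_abelian_group[OF lmodule_free]] by blast
  have "lin_ext A X M v (f \<oplus>\<^bsub>free_lmodule A X\<^esub> g) =
      (\<Oplus>\<^bsub>M\<^esub>x\<in>?T. (f \<oplus>\<^bsub>free_lmodule A X\<^esub> g) x \<odot>\<^bsub>M\<^esub> v x)"
    by (rule lin_ext_superset[OF fg v T(1) _ T(2)]) (auto simp: supp_def)
  also have "\<dots> = (\<Oplus>\<^bsub>M\<^esub>x\<in>?T. f x \<odot>\<^bsub>M\<^esub> v x \<oplus>\<^bsub>M\<^esub> g x \<odot>\<^bsub>M\<^esub> v x)"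
  proof (rule M.finsum_cong'[OF refl])
    show "(\<lambda>x. f x \<odot>\<^bsub>M\<^esub> v x \<oplus>\<^bsub>M\<^esub> g x \<odot>\<^bsub>M\<^esub> v x) \<in> ?T \<rightarrow> carrier M"
      using cl[OF T(2)] clg[OF T(2)] by (auto simp: Pi_iff)
    show "(f \<oplus>\<^bsub>free_lmodule A X\<^esub> g) i \<odot>\<^bsub>M\<^esub> v i = f i \<odot>\<^bsub>M\<^esub> v i \<oplus>\<^bsub>M\<^esub> g i \<odot>\<^bsub>M\<^esub> v i"
      if "i \<in> ?T" for i
    proof -
      have "i \<in> X" using that T by blast
      then show ?thesis using f g v by (simp add: smult_l_distr PiE_iff Pi_iff)
    qed
  qed
  also have "\<dots> = (\<Oplus>\<^bsub>M\<^esub>x\<in>?T. f x \<odot>\<^bsub>M\<^esub> v x) \<oplus>\<^bsub>M\<^esub> (\<Oplus>\<^bsub>M\<^esub>x\<in>?T. g x \<odot>\<^bsub>M\<^esub> v x)"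
    by (rule M.finsum_addf) (rule cl[OF T(2)], rule clg[OF T(2)])
  also have "\<dots> = lin_ext A X M v f \<oplus>\<^bsub>M\<^esub> lin_ext A X M v g"
    using lin_ext_superset[OF f v T(1) _ T(2)] lin_ext_superset[OF g v T(1) _ T(2)] by simp
  finally show "lin_ext A X M v (f \<oplus>\<^bsub>free_lmodule A X\<^esub> g) = lin_ext A X M v f \<oplus>\<^bsub>M\<^esub> lin_ext A X M v g" .
next
  fix a f assume a: "a \<in> carrier A" and f: "f \<in> carrier (free_lmodule A X)"
  have cl: "(\<lambda>x. f x \<odot>\<^bsub>M\<^esub> v x) \<in> T \<rightarrow> carrier M" if "T \<subseteq> X" for T
    using f v that by (auto simp: PiE_iff Pi_iff intro!: smult_closed)
  have af: "a \<odot>\<^bsub>free_lmodule A X\<^esub> f \<in> carrier (free_lmodule A X)"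
    using a f lmodule.smult_closed[OF lmodule_free] by blast
  have T: "finite (supp A X f)" "supp A X f \<subseteq> X" using f by (auto simp: supp_def)
  have "lin_ext A X M v (a \<odot>\<^bsub>free_lmodule A X\<^esub> f) =
     (\<Oplus>\<^bsub>M\<^esub>x\<in>supp A X f. (a \<odot>\<^bsub>free_lmodule A X\<^esub> f) x \<odot>\<^bsub>M\<^esub> v x)"
    by (rule lin_ext_superset[OF af v T(1) _ T(2)]) (use a in \<open>auto simp: supp_def\<close>)
  also have "\<dots> = (\<Oplus>\<^bsub>M\<^esub>x\<in>supp A X f. a \<odot>\<^bsub>M\<^esub> (f x \<odot>\<^bsub>M\<^esub> v x))"
  proof (rule M.finsum_cong'[OF refl])
    show "(\<lambda>x. a \<odot>\<^bsub>M\<^esub> (f x \<odot>\<^bsub>M\<^esub> v x)) \<in> supp A X f \<rightarrow> carrier M"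
      by (rule funcsetI, rule smult_closed[OF a], erule funcset_mem[OF cl[OF T(2)]])
    show "(a \<odot>\<^bsub>free_lmodule A X\<^esub> f) i \<odot>\<^bsub>M\<^esub> v i = a \<odot>\<^bsub>M\<^esub> (f i \<odot>\<^bsub>M\<^esub> v i)" if "i \<in> supp A X f" for i
    proof -
      have "i \<in> X" using that T by blast
      then show ?thesis using a f v by (simp add: smult_assoc PiE_iff Pi_iff)
    qed
  qed
  also have "\<dots> = a \<odot>\<^bsub>M\<^esub> (\<Oplus>\<^bsub>M\<^esub>x\<in>supp A X f. f x \<odot>\<^bsub>M\<^esub> v x)"
    using T(1) cl[OF T(2)]
  proof (induction rule: finite_induct)
    case empty then show ?case using a by (simp add: smult_r_null)
  next
    case (insert y F)
    then show ?case using a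
      by (subst (1 2) M.finsum_insert) (auto simp: Pi_iff smult_closed smult_r_distr)
  qed
  finally show "lin_ext A X M v (a \<odot>\<^bsub>free_lmodule A X\<^esub> f) = a \<odot>\<^bsub>M\<^esub> lin_ext A X M v f"
    by (simp add: lin_ext_def)
qed

lemma lin_ext_basis:
  assumes v: "v \<in> X \<rightarrow> carrier M" and x: "x \<in> X"
  shows "lin_ext A X M v (basis_elt A X x) = v x"
proof -
  have "lin_ext A X M v (basis_elt A X x) = (\<Oplus>\<^bsub>M\<^esub>y\<in>{x}. basis_elt A X x y \<odot>\<^bsub>M\<^esub> v y)"
    by (rule lin_ext_superset[OF basis_elt_closed[OF x] v])
      (use x in \<open>auto simp: supp_def basis_elt_def\<close>)
  also have "\<dots> = v x"
    using v x by (subst M.finsum_insert) (auto simp: basis_elt_def smult_one Pi_iff)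
  finally show ?thesis .
qed

end

section \<open>Submodules\<close>

context lmodule
begin

lemma submodule_iff:
  "submodule N A M \<longleftrightarrow> N \<subseteq> carrier M \<and> \<zero>\<^bsub>M\<^esub> \<in> N \<and> (\<forall>x\<in>N. \<forall>y\<in>N. x \<oplus>\<^bsub>M\<^esub> y \<in> N) \<and>
     (\<forall>a\<in>carrier A. \<forall>x\<in>N. a \<odot>\<^bsub>M\<^esub> x \<in> N)" (is "_ \<longleftrightarrow> ?N")
proof
  assume "submodule N A M"
  then interpret submodule N A M .
  show ?N using subset one_closed m_closed by auto
next
  assume N: ?N
  have "\<ominus>\<^bsub>M\<^esub> x \<in> N" if "x \<in> N" for x
  proof -
    have "x \<in> carrier M" using N that by blast
    then have "\<ominus>\<^bsub>M\<^esub> x = (\<ominus>\<^bsub>A\<^esub> \<one>\<^bsub>A\<^esub>) \<odot>\<^bsub>M\<^esub> x" by (simp add: smult_l_minus smult_one)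
    with N that show ?thesis by simp
  qed
  with N show "submodule N A M"
    by (simp add: submodule_def subgroup_def submodule_axioms_def flip: a_inv_def)
qed

lemma submoduleD:
  assumes "submodule N A M"
  shows "x \<in> N \<Longrightarrow> x \<in> carrier M" and "\<zero>\<^bsub>M\<^esub> \<in> N"
    and "\<lbrakk>x \<in> N; y \<in> N\<rbrakk> \<Longrightarrow> x \<oplus>\<^bsub>M\<^esub> y \<in> N"
    and "\<lbrakk>a \<in> carrier A; x \<in> N\<rbrakk> \<Longrightarrow> a \<odot>\<^bsub>M\<^esub> x \<in> N"
    and "x \<in> N \<Longrightarrow> \<ominus>\<^bsub>M\<^esub> x \<in> N"
    and "\<lbrakk>x \<in> N; y \<in> N\<rbrakk> \<Longrightarrow> x \<ominus>\<^bsub>M\<^esub> y \<in> N"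
proof -
  have inv: "\<ominus>\<^bsub>M\<^esub> x \<in> N" if "x \<in> N" for x
    using assms that by (simp add: submodule_def subgroup_def a_inv_def)
  show "x \<in> N \<Longrightarrow> x \<in> carrier M" "\<zero>\<^bsub>M\<^esub> \<in> N" "\<lbrakk>x \<in> N; y \<in> N\<rbrakk> \<Longrightarrow> x \<oplus>\<^bsub>M\<^esub> y \<in> N"
     "\<lbrakk>a \<in> carrier A; x \<in> N\<rbrakk> \<Longrightarrow> a \<odot>\<^bsub>M\<^esub> x \<in> N"
    using assms by (auto simp: submodule_iff)
  then show "x \<in> N \<Longrightarrow> \<ominus>\<^bsub>M\<^esub> x \<in> N" "\<lbrakk>x \<in> N; y \<in> N\<rbrakk> \<Longrightarrow> x \<ominus>\<^bsub>M\<^esub> y \<in> N"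
    using inv assms by (auto simp: a_minus_def submodule_iff)
qed

lemma submodule_zero: "submodule {\<zero>\<^bsub>M\<^esub>} A M"
  by (simp add: submodule_iff smult_r_null)

lemma submodule_diff_sym:
  assumes "submodule N A M" "x \<in> carrier M" "y \<in> carrier M" "x \<ominus>\<^bsub>M\<^esub> y \<in> N"
  shows "y \<ominus>\<^bsub>M\<^esub> x \<in> N"
  using submoduleD(5)[OF assms(1,4)] assms by (simp add: M.inv_minus)

lemma submodule_diff_trans:
  assumes "submodule N A M" "x \<in> carrier M" "y \<in> carrier M" "z \<in> carrier M"
    "x \<ominus>\<^bsub>M\<^esub> y \<in> N" "y \<ominus>\<^bsub>M\<^esub> z \<in> N"
  shows "x \<ominus>\<^bsub>M\<^esub> z \<in> N"
  using submoduleD(3)[OF assms(1,5,6)] assms by (simp flip: M.minus_trans)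

lemma submodule_diff_mem:
  assumes "submodule N A M" "x \<in> carrier M" "x \<ominus>\<^bsub>M\<^esub> y \<in> N" "y \<in> N"
  shows "x \<in> N"
  using submoduleD(3)[OF assms(1,3,4)] assms(2) submoduleD(1)[OF assms(1,4)]
  by (simp add: M.minus_add_cancel)

end

section \<open>Products of one-sided ideals and modules\<close>

text \<open>For a right module \<open>P\<close>, that is, a module over \<open>op_ring\<close> of
  the algebra, this is the product of \<open>P\<close> with \<open>J\<close>. When \<open>J\<close>
  is only a left ideal of the algebra it is a subgroup and in general not a submodule;
  \<open>submodule_ideal_smult\<close> assumes absorption on the other side.\<close>

inductive_set ideal_smult :: "('a, 'm, 'f) module_scheme \<Rightarrow> 'a set \<Rightarrow> 'm set"
  for M :: "('a, 'm, 'f) module_scheme" and J :: "'a set" where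
  zero: "\<zero>\<^bsub>M\<^esub> \<in> ideal_smult M J"
| step: "\<lbrakk>y \<in> ideal_smult M J; a \<in> J; x \<in> carrier M\<rbrakk> \<Longrightarrow> y \<oplus>\<^bsub>M\<^esub> a \<odot>\<^bsub>M\<^esub> x \<in> ideal_smult M J"

text \<open>Applied to \<open>op_ring\<close> of an algebra, this describes the left ideals of the
  algebra. Closure under negation is multiplication by -1.\<close>

definition right_ideal :: "('a, 'e) ring_scheme \<Rightarrow> 'a set \<Rightarrow> bool" where
  "right_ideal A J \<longleftrightarrow> J \<subseteq> carrier A \<and> \<zero>\<^bsub>A\<^esub> \<in> J \<and> (\<forall>a\<in>J. \<forall>b\<in>J. a \<oplus>\<^bsub>A\<^esub> b \<in> J) \<and>
     (\<forall>a\<in>J. \<forall>c\<in>carrier A. a \<otimes>\<^bsub>A\<^esub> c \<in> J)"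

lemma ideal_smult_mono: "\<lbrakk>y \<in> ideal_smult M J; J \<subseteq> J'\<rbrakk> \<Longrightarrow> y \<in> ideal_smult M J'"
  by (induction rule: ideal_smult.induct) (auto intro: ideal_smult.intros)

context lmodule
begin

context
  fixes J assumes J: "J \<subseteq> carrier A"
begin

lemma ideal_smult_closed: "y \<in> ideal_smult M J \<Longrightarrow> y \<in> carrier M"
  by (induction rule: ideal_smult.induct) (use J in \<open>auto intro: smult_closed\<close>)

lemma ideal_smult_smult: "\<lbrakk>a \<in> J; x \<in> carrier M\<rbrakk> \<Longrightarrow> a \<odot>\<^bsub>M\<^esub> x \<in> ideal_smult M J"
  using ideal_smult.step[OF ideal_smult.zero, of a J x M] J smult_closed by auto

lemma ideal_smult_add:
  assumes "y \<in> ideal_smult M J" "z \<in> ideal_smult M J" shows "y \<oplus>\<^bsub>M\<^esub> z \<in> ideal_smult M J"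
  using assms(2)
proof (induction rule: ideal_smult.induct)
  case zero then show ?case using assms(1) ideal_smult_closed by simp
next
  case (step z a x)
  then have "(y \<oplus>\<^bsub>M\<^esub> z) \<oplus>\<^bsub>M\<^esub> a \<odot>\<^bsub>M\<^esub> x \<in> ideal_smult M J" by (intro ideal_smult.step)
  moreover have "a \<in> carrier A" using step J by blast
  ultimately show ?case
    using step assms(1) by (simp add: M.a_assoc ideal_smult_closed smult_closed)
qed

lemma ideal_smult_inv: "y \<in> ideal_smult M J \<Longrightarrow> \<ominus>\<^bsub>M\<^esub> y \<in> ideal_smult M J"
proof (induction rule: ideal_smult.induct)
  case zero
  have "\<ominus>\<^bsub>M\<^esub> \<zero>\<^bsub>M\<^esub> = \<zero>\<^bsub>M\<^esub>" by (rule M.minus_equality) simp_all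
  note eq = this
  show ?case by (subst eq) (rule ideal_smult.zero)
next
  case (step z a x)
  then have "\<ominus>\<^bsub>M\<^esub> z \<oplus>\<^bsub>M\<^esub> a \<odot>\<^bsub>M\<^esub> (\<ominus>\<^bsub>M\<^esub> x) \<in> ideal_smult M J" by (intro ideal_smult.step) auto
  moreover have "a \<in> carrier A" using step J by blast
  ultimately show ?case
    using step by (simp add: M.minus_add ideal_smult_closed smult_closed smult_r_minus)
qed

lemma ideal_smult_minus:
  "\<lbrakk>y \<in> ideal_smult M J; z \<in> ideal_smult M J\<rbrakk> \<Longrightarrow> y \<ominus>\<^bsub>M\<^esub> z \<in> ideal_smult M J"
  by (simp add: a_minus_def ideal_smult_add ideal_smult_inv)

lemma submodule_ideal_smult:
  assumes "\<And>a c. \<lbrakk>a \<in> J; c \<in> carrier A\<rbrakk> \<Longrightarrow> c \<otimes>\<^bsub>A\<^esub> a \<in> J"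
  shows "submodule (ideal_smult M J) A M"
proof -
  have "c \<odot>\<^bsub>M\<^esub> y \<in> ideal_smult M J" if "c \<in> carrier A" "y \<in> ideal_smult M J" for c y
    using that(2)
  proof (induction rule: ideal_smult.induct)
    case zero then show ?case using that by (simp add: smult_r_null ideal_smult.zero)
  next
    case (step z a x)
    then have "c \<odot>\<^bsub>M\<^esub> z \<oplus>\<^bsub>M\<^esub> (c \<otimes>\<^bsub>A\<^esub> a) \<odot>\<^bsub>M\<^esub> x \<in> ideal_smult M J"
      using that assms by (intro ideal_smult.step) auto
    moreover have "a \<in> carrier A" using step J by blast
    ultimately show ?case
      using step that by (simp add: smult_r_distr smult_assoc smult_closed ideal_smult_closed)
  qed
  then show ?thesis
    by (auto simp: submodule_iff ideal_smult_closed ideal_smult_add ideal_smult.zero)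
qed

text \<open>On generators \<open>e (a x) = (e a) x = a x\<close>.\<close>

lemma ideal_smult_left_unit:
  assumes "e \<in> carrier A" "\<And>a. a \<in> J \<Longrightarrow> e \<otimes>\<^bsub>A\<^esub> a = a" "y \<in> ideal_smult M J"
  shows "e \<odot>\<^bsub>M\<^esub> y = y"
  using assms(3)
proof (induction rule: ideal_smult.induct)
  case zero then show ?case using assms(1) by (simp add: smult_r_null)
next
  case (step z a x)
  then have "a \<in> carrier A" using J by blast
  moreover from this have "e \<odot>\<^bsub>M\<^esub> (a \<odot>\<^bsub>M\<^esub> x) = a \<odot>\<^bsub>M\<^esub> x"
    using step assms(1,2) by (simp flip: smult_assoc)
  ultimately show ?case
    using step assms(1) by (simp add: smult_r_distr smult_closed ideal_smult_closed)
qed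

text \<open>\<open>f\<close> is only additive and the two rings may differ: this is the form needed
  for comparison maps between resolutions over different algebras.\<close>

lemma ideal_smult_image:
  assumes "additive M N f" "lmodule B N" "J' \<subseteq> carrier B"
    and "\<And>a x. \<lbrakk>a \<in> J; x \<in> carrier M\<rbrakk> \<Longrightarrow> f (a \<odot>\<^bsub>M\<^esub> x) \<in> ideal_smult N J'"
    and "y \<in> ideal_smult M J"
  shows "f y \<in> ideal_smult N J'"
  using assms(5)
proof (induction rule: ideal_smult.induct)
  case zero then show ?case using additive_zero[OF assms(1)] by (simp add: ideal_smult.zero)
next
  case (step z a x)
  then have "f (z \<oplus>\<^bsub>M\<^esub> a \<odot>\<^bsub>M\<^esub> x) = f z \<oplus>\<^bsub>N\<^esub> f (a \<odot>\<^bsub>M\<^esub> x)"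
    using J by (intro additive_add[OF assms(1)]) (auto simp: ideal_smult_closed intro: smult_closed)
  then show ?case
    using step assms by (simp add: lmodule.ideal_smult_add[OF assms(2,3)])
qed

lemma ideal_smult_annihilate:
  assumes "additive M N f" and "\<And>a x. \<lbrakk>a \<in> J; x \<in> carrier M\<rbrakk> \<Longrightarrow> f (a \<odot>\<^bsub>M\<^esub> x) = \<zero>\<^bsub>N\<^esub>"
    and "y \<in> ideal_smult M J"
  shows "f y = \<zero>\<^bsub>N\<^esub>"
  using assms(3)
proof (induction rule: ideal_smult.induct)
  case zero then show ?case using additive_zero[OF assms(1)] by simp
next
  case (step z a x)
  interpret N: abelian_group N using assms(1) by (simp add: additive_def)
  have "f (z \<oplus>\<^bsub>M\<^esub> a \<odot>\<^bsub>M\<^esub> x) = f z \<oplus>\<^bsub>N\<^esub> f (a \<odot>\<^bsub>M\<^esub> x)"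
    using J step
    by (intro additive_add[OF assms(1)]) (auto simp: ideal_smult_closed intro: smult_closed)
  then show ?case using step assms by simp
qed

end

lemma ideal_smult_hom:
  assumes "J \<subseteq> carrier A" "lmodule A N" "h \<in> lmodule_hom A M N" "y \<in> ideal_smult M J"
  shows "h y \<in> ideal_smult N J"
proof (rule ideal_smult_image[OF assms(1) additive_lmodule_hom[OF lmodule_axioms assms(2,3)] assms(2,1) _ assms(4)])
  fix a x assume "a \<in> J" "x \<in> carrier M"
  then show "h (a \<odot>\<^bsub>M\<^esub> x) \<in> ideal_smult N J"
    using assms(1) lmodule_homD(1,3)[OF assms(3)] lmodule.ideal_smult_smult[OF assms(2,1)]
    by (metis subsetD)
qed

lemma ideal_smult_sum:
  assumes "J \<subseteq> carrier A" "J' \<subseteq> carrier A"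
    and "\<And>a. a \<in> S \<Longrightarrow> \<exists>b\<in>J. \<exists>c\<in>J'. a = b \<oplus>\<^bsub>A\<^esub> c"
    and "y \<in> ideal_smult M S"
  shows "\<exists>u\<in>ideal_smult M J. \<exists>v\<in>ideal_smult M J'. y = u \<oplus>\<^bsub>M\<^esub> v"
  using assms(4)
proof (induction rule: ideal_smult.induct)
  case zero
  have "\<zero>\<^bsub>M\<^esub> = \<zero>\<^bsub>M\<^esub> \<oplus>\<^bsub>M\<^esub> \<zero>\<^bsub>M\<^esub>" by simp
  then show ?case using ideal_smult.zero by metis
next
  case (step z a x)
  then obtain u v where uv: "u \<in> ideal_smult M J" "v \<in> ideal_smult M J'" "z = u \<oplus>\<^bsub>M\<^esub> v" by blast
  obtain b c where bc: "b \<in> J" "c \<in> J'" "a = b \<oplus>\<^bsub>A\<^esub> c" using assms(3) step by blast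
  have car: "u \<in> carrier M" "v \<in> carrier M" "b \<in> carrier A" "c \<in> carrier A"
    using uv bc assms ideal_smult_closed by blast+
  have "z \<oplus>\<^bsub>M\<^esub> a \<odot>\<^bsub>M\<^esub> x = (u \<oplus>\<^bsub>M\<^esub> b \<odot>\<^bsub>M\<^esub> x) \<oplus>\<^bsub>M\<^esub> (v \<oplus>\<^bsub>M\<^esub> c \<odot>\<^bsub>M\<^esub> x)"
    using car step uv bc by (simp add: smult_l_distr smult_closed M.a_ac)
  then show ?case using uv bc step by (blast intro: ideal_smult.step)
qed

end

text \<open>Membership is a condition on each coordinate separately, which is why these products
  commute with intersections of ideals. Absorption from the right is what is needed, since the
  coordinates of \<open>a\<close> times \<open>f\<close> are \<open>a\<close> times those of
  \<open>f\<close>.\<close>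

lemma (in ring) ideal_smult_free_iff:
  assumes J: "right_ideal R J" and f: "f \<in> carrier (free_lmodule R X)"
  shows "f \<in> ideal_smult (free_lmodule R X) J \<longleftrightarrow> (\<forall>x\<in>X. f x \<in> J)"
proof
  assume "f \<in> ideal_smult (free_lmodule R X) J"
  then show "\<forall>x\<in>X. f x \<in> J"
    by (induction rule: ideal_smult.induct) (use J in \<open>auto simp: right_ideal_def PiE_iff\<close>)
next
  assume "\<forall>x\<in>X. f x \<in> J"
  with f show "f \<in> ideal_smult (free_lmodule R X) J"
  proof (induction rule: free_lmodule_induct)
    case zero
    show ?case by (rule ideal_smult.zero)
  next
    case (step f a x)
    have "f y \<in> J" if "y \<in> X" for y
    proof (cases "y = x")
      case True
      then show ?thesis using step(4) that J by (simp add: supp_def right_ideal_def)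
    next
      case False
      have "(f \<oplus>\<^bsub>free_lmodule R X\<^esub> a \<odot>\<^bsub>free_lmodule R X\<^esub> basis_elt R X x) y = f y"
        using step(1,2) that False by (simp add: basis_elt_def PiE_iff)
      then show ?thesis using step(6) that by metis
    qed
    moreover have "(f \<oplus>\<^bsub>free_lmodule R X\<^esub> a \<odot>\<^bsub>free_lmodule R X\<^esub> basis_elt R X x) x = a"
      using step(1,2,3,4) by (simp add: basis_elt_def PiE_iff supp_def)
    then have "a \<in> J" using step(3,6) by metis
    ultimately show ?case
      using step by (intro ideal_smult.step basis_elt_closed) auto
  qed
qed

lemma right_ideal_inter: "\<lbrakk>right_ideal A J; right_ideal A J'\<rbrakk> \<Longrightarrow> right_ideal A (J \<inter> J')"
  by (auto simp: right_ideal_def)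

text \<open>Flatness of projective modules, in the form needed for a Mayer--Vietoris argument.\<close>

lemma projective_ideal_smult_inter:
  fixes Q :: "('a, 'm, 'f) module_scheme"
  assumes Q: "projective A Q" and J: "right_ideal A J" "right_ideal A J'"
    and y: "y \<in> ideal_smult Q J" "y \<in> ideal_smult Q J'"
  shows "y \<in> ideal_smult Q (J \<inter> J')"
proof -
  from Q obtain X :: "'m set" and s p where s: "s \<in> lmodule_hom A Q (free_lmodule A X)"
    and p: "p \<in> lmodule_hom A (free_lmodule A X) Q"
    and ps: "\<And>x. x \<in> carrier Q \<Longrightarrow> p (s x) = x" and mod: "lmodule A Q"
    unfolding projective_def by blast
  interpret Q: lmodule A Q by fact
  interpret F: lmodule A "free_lmodule A X" by (rule Q.A.lmodule_free)
  have sub: "J \<subseteq> carrier A" "J' \<subseteq> carrier A" using J by (auto simp: right_ideal_def)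
  have yc: "y \<in> carrier Q" using y Q.ideal_smult_closed sub by blast
  have sy: "s y \<in> carrier (free_lmodule A X)" using lmodule_homD(1)[OF s yc] .
  \<comment> \<open>The section \<open>s\<close> carries both memberships into a free module, where
    the intersection can be taken coordinatewise; the retraction \<open>p\<close> brings the result
    back.\<close>
  have "s y \<in> ideal_smult (free_lmodule A X) J" "s y \<in> ideal_smult (free_lmodule A X) J'"
    using Q.ideal_smult_hom[OF _ F.lmodule_axioms s] y sub by blast+
  then have "s y \<in> ideal_smult (free_lmodule A X) (J \<inter> J')"
    using J right_ideal_inter[OF J] sy Q.A.ideal_smult_free_iff by blast
  then have "p (s y) \<in> ideal_smult Q (J \<inter> J')"
    using F.ideal_smult_hom[OF _ mod p] sub by blast
  then show ?thesis using ps yc by simp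
qed

section \<open>Lifting along projective modules\<close>

text \<open>\<open>h\<close> stands for a linear map into \<open>E / N\<close>, so its linearity is
  demanded only modulo \<open>N\<close>. The lift is chosen on the basis of a free module that has
  \<open>Q\<close> as a summand and is extended linearly; the defect stays in \<open>N\<close> along
  sums because \<open>N\<close> is a submodule.\<close>

lemma projective_lift:
  fixes Q :: "('a, 'm, 'f) module_scheme"
  assumes Q: "projective A Q" and E: "lmodule A E" "lmodule A E'"
    and \<delta>: "\<delta> \<in> lmodule_hom A E' E" and N: "submodule N A E"
    and h: "additive Q E h"
    and hl: "\<And>a x. \<lbrakk>a \<in> carrier A; x \<in> carrier Q\<rbrakk> \<Longrightarrow> h (a \<odot>\<^bsub>Q\<^esub> x) \<ominus>\<^bsub>E\<^esub> a \<odot>\<^bsub>E\<^esub> h x \<in> N"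
    and ex: "\<And>x. x \<in> carrier Q \<Longrightarrow> \<exists>y\<in>carrier E'. h x \<ominus>\<^bsub>E\<^esub> \<delta> y \<in> N"
  shows "\<exists>g\<in>lmodule_hom A Q E'. \<forall>x\<in>carrier Q. h x \<ominus>\<^bsub>E\<^esub> \<delta> (g x) \<in> N"
proof -
  from Q obtain X :: "'m set" and s p where s: "s \<in> lmodule_hom A Q (free_lmodule A X)"
    and p: "p \<in> lmodule_hom A (free_lmodule A X) Q"
    and ps: "\<And>x. x \<in> carrier Q \<Longrightarrow> p (s x) = x" and mod: "lmodule A Q"
    unfolding projective_def by blast
  interpret Q: lmodule A Q by fact
  interpret F: lmodule A "free_lmodule A X" by (rule Q.A.lmodule_free)
  interpret E: lmodule A E by fact
  interpret E': lmodule A E' by fact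
  let ?F = "free_lmodule A X" and ?e = "basis_elt A X"
  have "\<forall>x\<in>X. \<exists>y. y \<in> carrier E' \<and> h (p (?e x)) \<ominus>\<^bsub>E\<^esub> \<delta> y \<in> N"
    using ex lmodule_homD(1)[OF p Q.A.basis_elt_closed] by blast
  then obtain v where v: "\<And>x. x \<in> X \<Longrightarrow> v x \<in> carrier E'"
    and hv: "\<And>x. x \<in> X \<Longrightarrow> h (p (?e x)) \<ominus>\<^bsub>E\<^esub> \<delta> (v x) \<in> N" by metis
  have vX: "v \<in> X \<rightarrow> carrier E'" using v by blast
  let ?G = "lin_ext A X E' v"
  note G = E'.lin_ext_hom[OF vX]
  note addp = additive_lmodule_hom[OF F.lmodule_axioms mod p]
    and addG = additive_lmodule_hom[OF F.lmodule_axioms E(2) G]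
    and addd = additive_lmodule_hom[OF E(2) E(1) \<delta>]
  have key: "h (p f) \<ominus>\<^bsub>E\<^esub> \<delta> (?G f) \<in> N" if "f \<in> carrier ?F" for f
    using that
  proof (induction rule: Q.A.free_lmodule_induct)
    case zero
    have "h (p \<zero>\<^bsub>?F\<^esub>) = \<zero>\<^bsub>E\<^esub>" "\<delta> (?G \<zero>\<^bsub>?F\<^esub>) = \<zero>\<^bsub>E\<^esub>"
      using additive_zero[OF addp] additive_zero[OF addG] additive_zero[OF addd] additive_zero[OF h] by metis+
    then show ?case using E.submoduleD(2)[OF N] E.M.self_minus[OF E.M.zero_closed] by metis
  next
    case (step f a x)
    note ex = Q.A.basis_elt_closed[OF step(3)]
    note aex = F.smult_closed[OF step(2) ex]
    note pe = lmodule_homD(1)[OF p ex] and pf = lmodule_homD(1)[OF p step(1)]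
    note hpe = additive_closed[OF h pe] and hpf = additive_closed[OF h pf]
    note ape = Q.smult_closed[OF step(2) pe]
    note hape = additive_closed[OF h ape]
    have Gf: "?G f \<in> carrier E'" using lmodule_homD(1)[OF G step(1)] .
    note dv = lmodule_homD(1)[OF \<delta> v[OF step(3)]] and dG = lmodule_homD(1)[OF \<delta> Gf]
    have 1: "h (p (f \<oplus>\<^bsub>?F\<^esub> a \<odot>\<^bsub>?F\<^esub> ?e x)) = h (p f) \<oplus>\<^bsub>E\<^esub> h (a \<odot>\<^bsub>Q\<^esub> p (?e x))"
      unfolding lmodule_homD(2)[OF p step(1) aex] lmodule_homD(3)[OF p step(2) ex]
      by (rule additive_add[OF h pf ape])
    have 2: "\<delta> (?G (f \<oplus>\<^bsub>?F\<^esub> a \<odot>\<^bsub>?F\<^esub> ?e x)) = \<delta> (?G f) \<oplus>\<^bsub>E\<^esub> a \<odot>\<^bsub>E\<^esub> \<delta> (v x)"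
      unfolding lmodule_homD(2)[OF G step(1) aex] lmodule_homD(3)[OF G step(2) ex]
        E'.lin_ext_basis[OF vX step(3)]
        lmodule_homD(2)[OF \<delta> Gf E'.smult_closed[OF step(2) v[OF step(3)]]]
        lmodule_homD(3)[OF \<delta> step(2) v[OF step(3)]] ..
    have "a \<odot>\<^bsub>E\<^esub> h (p (?e x)) \<ominus>\<^bsub>E\<^esub> a \<odot>\<^bsub>E\<^esub> \<delta> (v x) \<in> N"
      using E.submoduleD(4)[OF N step(2) hv[OF step(3)]] by (simp add: E.smult_r_diff step hpe dv)
    then have "h (a \<odot>\<^bsub>Q\<^esub> p (?e x)) \<ominus>\<^bsub>E\<^esub> a \<odot>\<^bsub>E\<^esub> \<delta> (v x) \<in> N"
      using E.submodule_diff_trans[OF N hape _ _ hl[OF step(2) pe]] step(2) hpe dv E.smult_closed by blast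
    then show ?case
      unfolding 1 2 E.M.add_minus_swap[OF hpf hape dG E.smult_closed[OF step(2) dv]]
      using step E.submoduleD(3)[OF N] by blast
  qed
  show ?thesis
  proof (intro bexI ballI)
    show "(\<lambda>x. ?G (s x)) \<in> lmodule_hom A Q E'" by (rule lmodule_hom_comp[OF s G])
    show "h x \<ominus>\<^bsub>E\<^esub> \<delta> (?G (s x)) \<in> N" if "x \<in> carrier Q" for x
      using key[OF lmodule_homD(1)[OF s that]] ps[OF that] by simp
  qed
qed

section \<open>Projective resolutions\<close>

locale resolution =
  fixes A :: "('a, 'e) ring_scheme" and M :: "('a, 'm, 'f) module_scheme"
    and P :: "nat \<Rightarrow> ('a, 'p) module" and d :: "nat \<Rightarrow> 'p \<Rightarrow> 'p" and \<epsilon> :: "'p \<Rightarrow> 'm"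
  assumes resolution: "projective_resolution A M P d \<epsilon>"
begin

lemma lmodule_M: "lmodule A M" and projective_P: "projective A (P k)"
  and d_hom: "d k \<in> lmodule_hom A (P (Suc k)) (P k)" and \<epsilon>_hom: "\<epsilon> \<in> lmodule_hom A (P 0) M"
  using resolution by (simp_all add: projective_resolution_def)

lemma lmodule_P: "lmodule A (P k)"
  using projective_P by (simp add: projective_def)

text \<open>Puts degree 0, where the outgoing map is the augmentation, on the same footing as the
  other degrees, so that exactness becomes the single statement \<open>boundaries\<close>.\<close>

definition is_cycle :: "nat \<Rightarrow> 'p \<Rightarrow> bool" where
  "is_cycle k x \<longleftrightarrow> (case k of 0 \<Rightarrow> \<epsilon> x = \<zero>\<^bsub>M\<^esub> | Suc j \<Rightarrow> d j x = \<zero>\<^bsub>P j\<^esub>)"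

lemma is_cycle_0 [simp]: "is_cycle 0 x \<longleftrightarrow> \<epsilon> x = \<zero>\<^bsub>M\<^esub>"
  and is_cycle_Suc [simp]: "is_cycle (Suc k) x \<longleftrightarrow> d k x = \<zero>\<^bsub>P k\<^esub>"
  by (simp_all add: is_cycle_def)

lemma boundaries: "d k ` carrier (P (Suc k)) = {x \<in> carrier (P k). is_cycle k x}"
  using resolution
  by (cases k) (simp_all add: projective_resolution_def a_kernel_def kernel_def)

lemma exact: "\<lbrakk>x \<in> carrier (P k); is_cycle k x\<rbrakk> \<Longrightarrow> \<exists>w\<in>carrier (P (Suc k)). d k w = x"
  using boundaries[of k] by (metis (mono_tags, lifting) imageE mem_Collect_eq)

lemma is_cycle_d: "w \<in> carrier (P (Suc k)) \<Longrightarrow> is_cycle k (d k w)"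
  using boundaries[of k] by (auto simp: image_iff set_eq_iff)

lemma \<epsilon>_surj: "m \<in> carrier M \<Longrightarrow> \<exists>x\<in>carrier (P 0). \<epsilon> x = m"
  using resolution unfolding projective_resolution_def by (metis imageE)

lemma additive_d: "additive (P (Suc k)) (P k) (d k)"
  by (rule additive_lmodule_hom[OF lmodule_P lmodule_P d_hom])

lemma additive_\<epsilon>: "additive (P 0) M \<epsilon>"
  by (rule additive_lmodule_hom[OF lmodule_P lmodule_M \<epsilon>_hom])

text \<open>Exactness of the subcomplex \<open>J P\<close>. In degree 0 the cycles are the elements
  killed by \<epsilon>; if \<open>J\<close> annihilates \<open>M\<close>, these are all elements of
  \<open>J P\<close> in degree 0, and the condition includes the vanishing of the homology
  there.\<close>

definition acyclic_ideal :: "'a set \<Rightarrow> bool" where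
  "acyclic_ideal J \<longleftrightarrow> (\<forall>k. \<forall>x\<in>ideal_smult (P k) J. is_cycle k x \<longrightarrow>
     (\<exists>w\<in>ideal_smult (P (Suc k)) J. d k w = x))"

lemma acyclic_ideal_zero: "acyclic_ideal {\<zero>\<^bsub>A\<^esub>}"
proof -
  have "x = \<zero>\<^bsub>P k\<^esub>" if "x \<in> ideal_smult (P k) {\<zero>\<^bsub>A\<^esub>}" for k x
  proof -
    interpret P: lmodule A "P k" by (rule lmodule_P)
    show ?thesis
      using P.ideal_smult_annihilate[OF _ additive_id[OF P.M.abelian_group_axioms] _ that]
      by (simp add: P.smult_l_null)
  qed
  moreover have "d k \<zero>\<^bsub>P (Suc k)\<^esub> = \<zero>\<^bsub>P k\<^esub>" for k by (rule additive_zero[OF additive_d])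
  ultimately show ?thesis unfolding acyclic_ideal_def by (metis ideal_smult.zero)
qed

lemma acyclic_ideal_left_unit:
  assumes "J \<subseteq> carrier A" "e \<in> J" "\<And>a. a \<in> J \<Longrightarrow> e \<otimes>\<^bsub>A\<^esub> a = a"
  shows "acyclic_ideal J"
  unfolding acyclic_ideal_def
proof (intro allI ballI impI)
  fix k x assume x: "x \<in> ideal_smult (P k) J" "is_cycle k x"
  interpret P: lmodule A "P k" by (rule lmodule_P)
  interpret P': lmodule A "P (Suc k)" by (rule lmodule_P)
  obtain w where w: "w \<in> carrier (P (Suc k))" "d k w = x"
    using exact P.ideal_smult_closed[OF assms(1)] x by blast
  have "e \<odot>\<^bsub>P k\<^esub> x = x" using P.ideal_smult_left_unit[OF assms(1)] assms x by blast
  then have "d k (e \<odot>\<^bsub>P (Suc k)\<^esub> w) = x"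
    using lmodule_homD(3)[OF d_hom, of e w k] subsetD[OF assms(1,2)] w by simp
  then show "\<exists>w\<in>ideal_smult (P (Suc k)) J. d k w = x"
    using P'.ideal_smult_smult[OF assms(1,2) w(1)] by blast
qed

text \<open>Write a cycle as \<open>x = a + b\<close> with \<open>a\<close> in \<open>J P\<close>
  and \<open>b\<close> in \<open>J' P\<close>. Then \<open>d a = - d b\<close> lies in both
  products, hence by flatness in the product with \<open>J \<inter> J'\<close>, and equals
  \<open>d c\<close> for some \<open>c\<close> there. Now \<open>a - c\<close> and
  \<open>b + c\<close> are cycles in \<open>J P\<close> and \<open>J' P\<close> and are filled
  separately.\<close>

lemma acyclic_ideal_sum:
  assumes J: "right_ideal A J" "right_ideal A J'" and S: "J \<subseteq> S" "J' \<subseteq> S" "S \<subseteq> carrier A"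
    and sum: "\<And>a. a \<in> S \<Longrightarrow> \<exists>b\<in>J. \<exists>c\<in>J'. a = b \<oplus>\<^bsub>A\<^esub> c"
    and ann: "\<And>a m. \<lbrakk>a \<in> S; m \<in> carrier M\<rbrakk> \<Longrightarrow> a \<odot>\<^bsub>M\<^esub> m = \<zero>\<^bsub>M\<^esub>"
    and acyclic: "acyclic_ideal J" "acyclic_ideal J'" "acyclic_ideal (J \<inter> J')"
  shows "acyclic_ideal S"
  unfolding acyclic_ideal_def
proof (intro allI ballI impI)
  fix k x assume x: "x \<in> ideal_smult (P k) S" and cx: "is_cycle k x"
  interpret P: lmodule A "P k" by (rule lmodule_P)
  interpret P': lmodule A "P (Suc k)" by (rule lmodule_P)
  have JA: "J \<subseteq> carrier A" "J' \<subseteq> carrier A" "J \<inter> J' \<subseteq> carrier A"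
    using J by (auto simp: right_ideal_def)
  obtain a b where a: "a \<in> ideal_smult (P k) J" and b: "b \<in> ideal_smult (P k) J'"
    and xab: "x = a \<oplus>\<^bsub>P k\<^esub> b"
    using P.ideal_smult_sum[OF JA(1,2) sum x] by blast
  have car: "a \<in> carrier (P k)" "b \<in> carrier (P k)"
    using a b P.ideal_smult_closed JA by blast+
  have "\<exists>c\<in>ideal_smult (P k) (J \<inter> J'). is_cycle k (a \<ominus>\<^bsub>P k\<^esub> c) \<and> is_cycle k (b \<oplus>\<^bsub>P k\<^esub> c)"
  proof (cases k)
    case 0
    \<comment> \<open>In degree 0 the correction \<open>c\<close> is 0: as \<open>S\<close>
      annihilates \<open>M\<close>, both \<open>a\<close> and \<open>b\<close> are already killed by
      the augmentation.\<close>
    have "\<epsilon> y = \<zero>\<^bsub>M\<^esub>" if "y \<in> ideal_smult (P 0) S" for y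
    proof (rule lmodule.ideal_smult_annihilate[OF lmodule_P S(3) additive_\<epsilon> _ that])
      fix a x assume "a \<in> S" "x \<in> carrier (P 0)"
      then show "\<epsilon> (a \<odot>\<^bsub>P 0\<^esub> x) = \<zero>\<^bsub>M\<^esub>"
        using lmodule_homD(1,3)[OF \<epsilon>_hom] S(3) ann by (metis subsetD)
    qed
    then have "\<epsilon> a = \<zero>\<^bsub>M\<^esub>" "\<epsilon> b = \<zero>\<^bsub>M\<^esub>"
      using ideal_smult_mono[OF a S(1)] ideal_smult_mono[OF b S(2)] unfolding 0 by blast+
    moreover have "a \<ominus>\<^bsub>P k\<^esub> \<zero>\<^bsub>P k\<^esub> = a" "b \<oplus>\<^bsub>P k\<^esub> \<zero>\<^bsub>P k\<^esub> = b"
      using car by (simp_all add: P.M.minus_zero_right)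
    ultimately show ?thesis
      using 0 ideal_smult.zero[of "P k" "J \<inter> J'"] by (intro bexI[of _ "\<zero>\<^bsub>P k\<^esub>"]) simp_all
  next
    case (Suc j)
    interpret Pj: lmodule A "P j" by (rule lmodule_P)
    note add = additive_d[of j, folded Suc]
    note dcar = additive_closed[OF add car(1)] additive_closed[OF add car(2)]
    have "d j a \<oplus>\<^bsub>P j\<^esub> d j b = \<zero>\<^bsub>P j\<^esub>"
      using cx additive_add[OF add car] by (simp add: xab Suc)
    then have eq: "d j a = \<ominus>\<^bsub>P j\<^esub> d j b" using dcar by (metis Pj.M.minus_equality)
    have "d j a \<in> ideal_smult (P j) J" "d j b \<in> ideal_smult (P j) J'"
      using P.ideal_smult_hom[OF _ Pj.lmodule_axioms d_hom[of j, folded Suc]] a b JA by blast+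
    then have "d j a \<in> ideal_smult (P j) (J \<inter> J')"
      using projective_ideal_smult_inter[OF projective_P J] Pj.ideal_smult_inv[OF JA(2)] eq by metis
    moreover have "is_cycle j (d j a)" using is_cycle_d car Suc by blast
    ultimately obtain c where c: "c \<in> ideal_smult (P (Suc j)) (J \<inter> J')" "d j c = d j a"
      using acyclic(3) unfolding acyclic_ideal_def by metis
    have cc: "c \<in> carrier (P k)" using c Suc P.ideal_smult_closed[OF JA(3)] by blast
    have "d j (a \<ominus>\<^bsub>P k\<^esub> c) = \<zero>\<^bsub>P j\<^esub>"
      using additive_diff[OF add car(1) cc] c dcar by (simp add: Pj.M.self_minus)
    moreover have "d j (b \<oplus>\<^bsub>P k\<^esub> c) = \<zero>\<^bsub>P j\<^esub>"
      using additive_add[OF add car(2) cc] dcar c eq by (simp add: Pj.M.r_neg)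
    ultimately show ?thesis using c Suc by auto
  qed
  then obtain c where c: "c \<in> ideal_smult (P k) (J \<inter> J')"
    and cyc: "is_cycle k (a \<ominus>\<^bsub>P k\<^esub> c)" "is_cycle k (b \<oplus>\<^bsub>P k\<^esub> c)" by blast
  have cJ: "c \<in> ideal_smult (P k) J" "c \<in> ideal_smult (P k) J'"
    by (rule ideal_smult_mono[OF c Int_lower1], rule ideal_smult_mono[OF c Int_lower2])
  obtain w w' where w: "w \<in> ideal_smult (P (Suc k)) J" "d k w = a \<ominus>\<^bsub>P k\<^esub> c"
    and w': "w' \<in> ideal_smult (P (Suc k)) J'" "d k w' = b \<oplus>\<^bsub>P k\<^esub> c"
    using acyclic cyc P.ideal_smult_minus[OF JA(1) a cJ(1)] P.ideal_smult_add[OF JA(2) b cJ(2)]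
    unfolding acyclic_ideal_def by blast
  have wc: "w \<in> carrier (P (Suc k))" "w' \<in> carrier (P (Suc k))"
    using w w' P'.ideal_smult_closed JA by blast+
  have cc: "c \<in> carrier (P k)" using c P.ideal_smult_closed[OF JA(3)] by blast
  have "d k (w \<oplus>\<^bsub>P (Suc k)\<^esub> w') = (a \<ominus>\<^bsub>P k\<^esub> c) \<oplus>\<^bsub>P k\<^esub> (b \<oplus>\<^bsub>P k\<^esub> c)"
    using additive_add[OF additive_d wc] w w' by simp
  also have "\<dots> = ((a \<ominus>\<^bsub>P k\<^esub> c) \<oplus>\<^bsub>P k\<^esub> c) \<oplus>\<^bsub>P k\<^esub> b"
    using car cc by (simp add: P.M.a_ac)
  also have "\<dots> = x" using car cc xab by (simp add: P.M.minus_add_cancel)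
  finally show "\<exists>w\<in>ideal_smult (P (Suc k)) S. d k w = x"
    using P'.ideal_smult_add[OF S(3) ideal_smult_mono[OF w(1) S(1)] ideal_smult_mono[OF w'(1) S(2)]]
    by blast
qed

end

text \<open>Complexes of modules \<open>E k\<close> with submodules \<open>N k\<close> such that the quotients form an exact
  augmented complex. Working modulo \<open>N\<close> avoids the quotient modules themselves.\<close>

locale exact_mod =
  fixes A :: "('a, 'e) ring_scheme" and M :: "('a, 'm, 'f) module_scheme"
    and E :: "nat \<Rightarrow> ('a, 'q) module" and N :: "nat \<Rightarrow> 'q set"
    and \<delta> :: "nat \<Rightarrow> 'q \<Rightarrow> 'q" and \<eta> :: "'q \<Rightarrow> 'm"
  assumes lmodule_codomain: "lmodule A M" and lmodule_E: "\<And>k. lmodule A (E k)" and submodule_N: "\<And>k. submodule (N k) A (E k)"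
    and \<delta>_hom: "\<And>k. \<delta> k \<in> lmodule_hom A (E (Suc k)) (E k)" and \<eta>_hom: "\<eta> \<in> lmodule_hom A (E 0) M"
    and \<eta>_surj: "\<And>m. m \<in> carrier M \<Longrightarrow> \<exists>x\<in>carrier (E 0). \<eta> x = m"
    and mod_exact_0: "\<And>x. \<lbrakk>x \<in> carrier (E 0); \<eta> x = \<zero>\<^bsub>M\<^esub>\<rbrakk> \<Longrightarrow>
      \<exists>y\<in>carrier (E 1). x \<ominus>\<^bsub>E 0\<^esub> \<delta> 0 y \<in> N 0"
    and mod_exact_Suc: "\<And>k x. \<lbrakk>x \<in> carrier (E (Suc k)); \<delta> k x \<in> N k\<rbrakk> \<Longrightarrow>
      \<exists>y\<in>carrier (E (Suc (Suc k))). x \<ominus>\<^bsub>E (Suc k)\<^esub> \<delta> (Suc k) y \<in> N (Suc k)"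
begin

definition mod_cycle :: "nat \<Rightarrow> 'q \<Rightarrow> bool" where
  "mod_cycle k x \<longleftrightarrow> (case k of 0 \<Rightarrow> \<eta> x = \<zero>\<^bsub>M\<^esub> | Suc j \<Rightarrow> \<delta> j x \<in> N j)"

lemma mod_cycle_0 [simp]: "mod_cycle 0 x \<longleftrightarrow> \<eta> x = \<zero>\<^bsub>M\<^esub>"
  and mod_cycle_Suc [simp]: "mod_cycle (Suc k) x \<longleftrightarrow> \<delta> k x \<in> N k"
  by (simp_all add: mod_cycle_def)

lemma mod_exact: "\<lbrakk>x \<in> carrier (E k); mod_cycle k x\<rbrakk> \<Longrightarrow>
    \<exists>y\<in>carrier (E (Suc k)). x \<ominus>\<^bsub>E k\<^esub> \<delta> k y \<in> N k"
  using mod_exact_0 mod_exact_Suc by (cases k) auto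

lemma additive_\<delta>: "additive (E (Suc k)) (E k) (\<delta> k)"
  by (rule additive_lmodule_hom[OF lmodule_E lmodule_E \<delta>_hom])

end

text \<open>With \<open>N = 0\<close> a resolution is exact without correction, so the same
  comparison lemmas serve for \<open>Q\<close> and for \<open>P\<close> modulo
  \<open>I P\<close>.\<close>

sublocale resolution \<subseteq> exact_mod A M P "\<lambda>k. {\<zero>\<^bsub>P k\<^esub>}" d \<epsilon>
proof (rule exact_mod.intro)
  fix k x assume x: "x \<in> carrier (P (Suc k))" "d k x \<in> {\<zero>\<^bsub>P k\<^esub>}"
  interpret P: lmodule A "P (Suc k)" by (rule lmodule_P)
  show "\<exists>y\<in>carrier (P (Suc (Suc k))). x \<ominus>\<^bsub>P (Suc k)\<^esub> d (Suc k) y \<in> {\<zero>\<^bsub>P (Suc k)\<^esub>}"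
    using exact[of x "Suc k"] x P.M.self_minus by (metis is_cycle_Suc singleton_iff)
next
  fix x assume x: "x \<in> carrier (P 0)" "\<epsilon> x = \<zero>\<^bsub>M\<^esub>"
  interpret P: lmodule A "P 0" by (rule lmodule_P)
  show "\<exists>y\<in>carrier (P 1). x \<ominus>\<^bsub>P 0\<^esub> d 0 y \<in> {\<zero>\<^bsub>P 0\<^esub>}"
    using exact[of x 0] x P.M.self_minus by (metis One_nat_def is_cycle_0 singleton_iff)
qed (rule lmodule_M lmodule_P d_hom \<epsilon>_hom lmodule.submodule_zero[OF lmodule_P] | erule \<epsilon>_surj)+

text \<open>The long exact sequence of \<open>I P\<close>, \<open>P\<close> and their quotient, made
  explicit: if \<open>d x\<close> lies in \<open>I P\<close>, acyclicity gives \<open>w\<close> in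
  \<open>I P\<close> with \<open>d w = d x\<close>; then \<open>x - w\<close> is a boundary
  \<open>d y\<close>, and \<open>x - d y = w\<close>.\<close>

lemma (in resolution) exact_mod_ideal_smult:
  assumes I: "right_ideal A I" "\<And>a c. \<lbrakk>a \<in> I; c \<in> carrier A\<rbrakk> \<Longrightarrow> c \<otimes>\<^bsub>A\<^esub> a \<in> I"
    and ann: "\<And>a m. \<lbrakk>a \<in> I; m \<in> carrier M\<rbrakk> \<Longrightarrow> a \<odot>\<^bsub>M\<^esub> m = \<zero>\<^bsub>M\<^esub>"
    and acyclic: "acyclic_ideal I"
  shows "exact_mod A M P (\<lambda>k. ideal_smult (P k) I) d \<epsilon>"
proof (rule exact_mod.intro)
  have IA: "I \<subseteq> carrier A" using I by (simp add: right_ideal_def)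
  show "submodule (ideal_smult (P k) I) A (P k)" for k
    by (rule lmodule.submodule_ideal_smult[OF lmodule_P IA I(2)])
  fix x assume x: "x \<in> carrier (P 0)" "\<epsilon> x = \<zero>\<^bsub>M\<^esub>"
  interpret P: lmodule A "P 0" by (rule lmodule_P)
  show "\<exists>y\<in>carrier (P 1). x \<ominus>\<^bsub>P 0\<^esub> d 0 y \<in> ideal_smult (P 0) I"
    using exact[of x 0] x P.M.self_minus ideal_smult.zero by (metis One_nat_def is_cycle_0)
next
  have IA: "I \<subseteq> carrier A" using I by (simp add: right_ideal_def)
  fix k x assume x: "x \<in> carrier (P (Suc k))" "d k x \<in> ideal_smult (P k) I"
  interpret P: lmodule A "P (Suc k)" by (rule lmodule_P)
  interpret Pk: lmodule A "P k" by (rule lmodule_P)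
  obtain w where w: "w \<in> ideal_smult (P (Suc k)) I" "d k w = d k x"
    using acyclic is_cycle_d[OF x(1)] x(2) unfolding acyclic_ideal_def by metis
  have wc: "w \<in> carrier (P (Suc k))" using P.ideal_smult_closed[OF IA w(1)] .
  have "is_cycle (Suc k) (x \<ominus>\<^bsub>P (Suc k)\<^esub> w)"
    using additive_diff[OF additive_d x(1) wc] w additive_closed[OF additive_d x(1)]
    by (simp add: Pk.M.self_minus)
  then obtain y where y: "y \<in> carrier (P (Suc (Suc k)))" "d (Suc k) y = x \<ominus>\<^bsub>P (Suc k)\<^esub> w"
    using exact[of _ "Suc k"] x wc P.M.minus_closed by blast
  have "x \<ominus>\<^bsub>P (Suc k)\<^esub> (x \<ominus>\<^bsub>P (Suc k)\<^esub> w) = w"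
    using x wc P.M.minus_minus_swap[of x "\<zero>\<^bsub>P (Suc k)\<^esub>" x w]
    by (simp add: P.M.minus_zero_right P.M.self_minus P.M.inv_minus)
      (simp add: a_minus_def P.M.minus_minus)
  then show "\<exists>y\<in>carrier (P (Suc (Suc k))). x \<ominus>\<^bsub>P (Suc k)\<^esub> d (Suc k) y \<in> ideal_smult (P (Suc k)) I"
    using y w by metis
qed (rule lmodule_M lmodule_P d_hom \<epsilon>_hom | erule \<epsilon>_surj)+

section \<open>Comparison of resolutions\<close>

locale comparison = P: resolution A M P d \<epsilon> + E: exact_mod A M E N \<delta> \<eta>
  for A :: "('a, 'e) ring_scheme" and M :: "('a, 'm, 'f) module_scheme"
    and P :: "nat \<Rightarrow> ('a, 'p) module" and d \<epsilon>
    and E :: "nat \<Rightarrow> ('a, 'q) module" and N \<delta> \<eta>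
begin

text \<open>Dependent choice needs an invariant that makes the next lift possible:
  \<open>Good\<close> records, besides linearity, that \<open>f k\<close> sends boundaries to cycles
  modulo \<open>N\<close>.\<close>

lemma chain_map_exists:
  "\<exists>f. (\<forall>k. f k \<in> lmodule_hom A (P k) (E k)) \<and>
       (\<forall>x\<in>carrier (P 0). \<eta> (f 0 x) = \<epsilon> x) \<and>
       (\<forall>k. \<forall>x\<in>carrier (P (Suc k)). f k (d k x) \<ominus>\<^bsub>E k\<^esub> \<delta> k (f (Suc k) x) \<in> N k)"
proof -
  define Good where "Good k f \<longleftrightarrow> f \<in> lmodule_hom A (P k) (E k) \<and>
     (\<forall>x\<in>carrier (P (Suc k)). E.mod_cycle k (f (d k x))) \<and>
     (k = 0 \<longrightarrow> (\<forall>x\<in>carrier (P 0). \<eta> (f x) = \<epsilon> x))" for k f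
  have "\<exists>f. \<forall>k. Good k (f k) \<and>
      (\<forall>x\<in>carrier (P (Suc k)). f k (d k x) \<ominus>\<^bsub>E k\<^esub> \<delta> k (f (Suc k) x) \<in> N k)"
  proof (rule dependent_nat_choice)
    interpret M: lmodule A M by (rule E.lmodule_codomain)
    have "\<exists>g\<in>lmodule_hom A (P 0) (E 0). \<forall>x\<in>carrier (P 0). \<epsilon> x \<ominus>\<^bsub>M\<^esub> \<eta> (g x) \<in> {\<zero>\<^bsub>M\<^esub>}"
    proof (rule projective_lift[OF P.projective_P M.lmodule_axioms E.lmodule_E E.\<eta>_hom M.submodule_zero P.additive_\<epsilon>])
      fix a x assume "a \<in> carrier A" "x \<in> carrier (P 0)"
      then show "\<epsilon> (a \<odot>\<^bsub>P 0\<^esub> x) \<ominus>\<^bsub>M\<^esub> a \<odot>\<^bsub>M\<^esub> \<epsilon> x \<in> {\<zero>\<^bsub>M\<^esub>}"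
        using lmodule_homD(1,3)[OF P.\<epsilon>_hom] by (simp add: M.M.self_minus M.smult_closed)
    next
      fix x assume "x \<in> carrier (P 0)"
      then show "\<exists>y\<in>carrier (E 0). \<epsilon> x \<ominus>\<^bsub>M\<^esub> \<eta> y \<in> {\<zero>\<^bsub>M\<^esub>}"
        using lmodule_homD(1)[OF P.\<epsilon>_hom] E.\<eta>_surj M.M.self_minus by (metis singletonI)
    qed
    then obtain g where g: "g \<in> lmodule_hom A (P 0) (E 0)"
      "\<And>x. x \<in> carrier (P 0) \<Longrightarrow> \<epsilon> x \<ominus>\<^bsub>M\<^esub> \<eta> (g x) = \<zero>\<^bsub>M\<^esub>" by blast
    have "\<eta> (g x) = \<epsilon> x" if "x \<in> carrier (P 0)" for x
      using g(2)[OF that] lmodule_homD(1)[OF P.\<epsilon>_hom that]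
        lmodule_homD(1)[OF E.\<eta>_hom lmodule_homD(1)[OF g(1) that]] by (simp add: M.M.minus_eq_zero_iff)
    moreover have "\<epsilon> (d 0 x) = \<zero>\<^bsub>M\<^esub>" if "x \<in> carrier (P (Suc 0))" for x
      using P.is_cycle_d[OF that] by simp
    ultimately show "\<exists>f. Good 0 f"
      using g(1) lmodule_homD(1)[OF P.d_hom] by (intro exI[of _ g]) (simp add: Good_def)
  next
    fix f k assume f: "Good k f"
    then have fh: "f \<in> lmodule_hom A (P k) (E k)" by (simp add: Good_def)
    interpret E: lmodule A "E k" by (rule E.lmodule_E)
    note fd = lmodule_hom_comp[OF P.d_hom fh]
    note fda = additive_lmodule_hom[OF P.lmodule_P E.lmodule_E fd]
    have "\<exists>g\<in>lmodule_hom A (P (Suc k)) (E (Suc k)).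
      \<forall>x\<in>carrier (P (Suc k)). f (d k x) \<ominus>\<^bsub>E k\<^esub> \<delta> k (g x) \<in> N k"
    proof (rule projective_lift[OF P.projective_P E.lmodule_E E.lmodule_E E.\<delta>_hom E.submodule_N fda])
      fix a x assume "a \<in> carrier A" "x \<in> carrier (P (Suc k))"
      then show "f (d k (a \<odot>\<^bsub>P (Suc k)\<^esub> x)) \<ominus>\<^bsub>E k\<^esub> a \<odot>\<^bsub>E k\<^esub> f (d k x) \<in> N k"
        using lmodule_homD(1,3)[OF fd] E.submoduleD(2)[OF E.submodule_N]
        by (simp add: E.M.self_minus E.smult_closed)
    next
      fix x assume "x \<in> carrier (P (Suc k))"
      then show "\<exists>y\<in>carrier (E (Suc k)). f (d k x) \<ominus>\<^bsub>E k\<^esub> \<delta> k y \<in> N k"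
        using E.mod_exact[OF lmodule_homD(1)[OF fd]] f by (simp add: Good_def)
    qed
    then obtain g where g: "g \<in> lmodule_hom A (P (Suc k)) (E (Suc k))"
      "\<And>x. x \<in> carrier (P (Suc k)) \<Longrightarrow> f (d k x) \<ominus>\<^bsub>E k\<^esub> \<delta> k (g x) \<in> N k" by blast
    \<comment> \<open>The invariant in the next degree: in the relation for \<open>g\<close> at the
      point \<open>d x\<close>, the first term vanishes because \<open>d d = 0\<close>.\<close>
    have "\<delta> k (g (d (Suc k) x)) \<in> N k" if x: "x \<in> carrier (P (Suc (Suc k)))" for x
    proof -
      note dx = lmodule_homD(1)[OF P.d_hom x]
      note gd = lmodule_homD(1)[OF E.\<delta>_hom lmodule_homD(1)[OF g(1) dx]]
      have "f (d k (d (Suc k) x)) = \<zero>\<^bsub>E k\<^esub>"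
        using P.is_cycle_d[OF x] additive_zero[OF additive_lmodule_hom[OF P.lmodule_P E.lmodule_E fh]] by simp
      then have "\<zero>\<^bsub>E k\<^esub> \<ominus>\<^bsub>E k\<^esub> \<delta> k (g (d (Suc k) x)) \<in> N k" using g(2)[OF dx] by simp
      then have "\<delta> k (g (d (Suc k) x)) \<ominus>\<^bsub>E k\<^esub> \<zero>\<^bsub>E k\<^esub> \<in> N k"
        using E.submodule_diff_sym[OF E.submodule_N] gd E.M.zero_closed by blast
      then show ?thesis using gd by (simp add: E.M.minus_zero_right)
    qed
    then show "\<exists>g. Good (Suc k) g \<and>
        (\<forall>x\<in>carrier (P (Suc k)). f (d k x) \<ominus>\<^bsub>E k\<^esub> \<delta> k (g x) \<in> N k)"
      using g by (intro exI[of _ g]) (simp add: Good_def)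
  qed
  then obtain f where f: "\<And>k. Good k (f k)"
    "\<And>k x. x \<in> carrier (P (Suc k)) \<Longrightarrow> f k (d k x) \<ominus>\<^bsub>E k\<^esub> \<delta> k (f (Suc k) x) \<in> N k" by blast
  show ?thesis
    using f(2) f(1)[unfolded Good_def] by (intro exI[of _ f]) blast
qed

text \<open>Stated for one map \<open>h\<close> instead of a pair of chain maps, because
  \<open>h\<close> will be the identity minus a composite of comparison maps, which is linear only
  modulo \<open>N\<close>.\<close>

lemma homotopy_exists:
  assumes add: "\<And>k. additive (P k) (E k) (h k)"
    and lin: "\<And>k a x. \<lbrakk>a \<in> carrier A; x \<in> carrier (P k)\<rbrakk> \<Longrightarrow>
      h k (a \<odot>\<^bsub>P k\<^esub> x) \<ominus>\<^bsub>E k\<^esub> a \<odot>\<^bsub>E k\<^esub> h k x \<in> N k"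
    and aug: "\<And>x. x \<in> carrier (P 0) \<Longrightarrow> \<eta> (h 0 x) = \<zero>\<^bsub>M\<^esub>"
    and chain: "\<And>k x. x \<in> carrier (P (Suc k)) \<Longrightarrow> h k (d k x) \<ominus>\<^bsub>E k\<^esub> \<delta> k (h (Suc k) x) \<in> N k"
  shows "\<exists>s. (\<forall>k. s k \<in> lmodule_hom A (P k) (E (Suc k))) \<and>
    (\<forall>x\<in>carrier (P 0). h 0 x \<ominus>\<^bsub>E 0\<^esub> \<delta> 0 (s 0 x) \<in> N 0) \<and>
    (\<forall>k. \<forall>x\<in>carrier (P (Suc k)).
       (h (Suc k) x \<ominus>\<^bsub>E (Suc k)\<^esub> s k (d k x)) \<ominus>\<^bsub>E (Suc k)\<^esub> \<delta> (Suc k) (s (Suc k) x) \<in> N (Suc k))"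
proof -
  define Good where "Good k s \<longleftrightarrow> s \<in> lmodule_hom A (P k) (E (Suc k)) \<and>
     (\<forall>x\<in>carrier (P (Suc k)). \<delta> k (h (Suc k) x \<ominus>\<^bsub>E (Suc k)\<^esub> s (d k x)) \<in> N k) \<and>
     (k = 0 \<longrightarrow> (\<forall>x\<in>carrier (P 0). h 0 x \<ominus>\<^bsub>E 0\<^esub> \<delta> 0 (s x) \<in> N 0))" for k s
  let ?rel = "\<lambda>k s s'. \<forall>x\<in>carrier (P (Suc k)).
     (h (Suc k) x \<ominus>\<^bsub>E (Suc k)\<^esub> s (d k x)) \<ominus>\<^bsub>E (Suc k)\<^esub> \<delta> (Suc k) (s' x) \<in> N (Suc k)"
  \<comment> \<open>The map to be lifted next is \<open>h - s d\<close>. It takes values in cycles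
    modulo \<open>N\<close>, because \<delta> applied to it agrees modulo \<open>N\<close> with
    \<open>h - \<delta> s\<close> applied to \<open>d x\<close>, and the latter lies in
    \<open>N\<close> by \<open>r\<close>.\<close>
  have obstruction: "\<delta> k (h (Suc k) x \<ominus>\<^bsub>E (Suc k)\<^esub> s (d k x)) \<in> N k"
    if s: "s \<in> lmodule_hom A (P k) (E (Suc k))" and x: "x \<in> carrier (P (Suc k))"
      and r: "h k (d k x) \<ominus>\<^bsub>E k\<^esub> \<delta> k (s (d k x)) \<in> N k" for k s x
  proof -
    interpret E: lmodule A "E k" by (rule E.lmodule_E)
    note dx = lmodule_homD(1)[OF P.d_hom x]
    note hx = additive_closed[OF add x] and sdx = lmodule_homD(1)[OF s dx]
    note dhx = lmodule_homD(1)[OF E.\<delta>_hom hx] and dsdx = lmodule_homD(1)[OF E.\<delta>_hom sdx]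
    have "\<delta> k (h (Suc k) x) \<ominus>\<^bsub>E k\<^esub> h k (d k x) \<in> N k"
      using E.submodule_diff_sym[OF E.submodule_N _ _ chain[OF x]] additive_closed[OF add dx] dhx by blast
    then have "\<delta> k (h (Suc k) x) \<ominus>\<^bsub>E k\<^esub> \<delta> k (s (d k x)) \<in> N k"
      using E.submodule_diff_trans[OF E.submodule_N dhx additive_closed[OF add dx] dsdx] r by blast
    then show ?thesis using additive_diff[OF E.additive_\<delta> hx sdx] by simp
  qed
  have "\<exists>s. \<forall>k. Good k (s k) \<and> ?rel k (s k) (s (Suc k))"
  proof (rule dependent_nat_choice)
    have "\<exists>s\<in>lmodule_hom A (P 0) (E (Suc 0)). \<forall>x\<in>carrier (P 0). h 0 x \<ominus>\<^bsub>E 0\<^esub> \<delta> 0 (s x) \<in> N 0"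
    proof (rule projective_lift[OF P.projective_P E.lmodule_E E.lmodule_E E.\<delta>_hom E.submodule_N add lin])
      fix x assume "x \<in> carrier (P 0)"
      then show "\<exists>y\<in>carrier (E (Suc 0)). h 0 x \<ominus>\<^bsub>E 0\<^esub> \<delta> 0 y \<in> N 0"
        using E.mod_exact[of "h 0 x" 0] aug additive_closed[OF add] by simp
    qed
    then show "\<exists>s. Good 0 s"
      using obstruction[of _ 0] lmodule_homD(1)[OF P.d_hom] unfolding Good_def by meson
  next
    fix s k assume "Good k s"
    then have s: "s \<in> lmodule_hom A (P k) (E (Suc k))"
      and ob: "\<And>x. x \<in> carrier (P (Suc k)) \<Longrightarrow> \<delta> k (h (Suc k) x \<ominus>\<^bsub>E (Suc k)\<^esub> s (d k x)) \<in> N k"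
      by (simp_all add: Good_def)
    interpret E: lmodule A "E (Suc k)" by (rule E.lmodule_E)
    note sd = lmodule_hom_comp[OF P.d_hom s]
    note sda = additive_lmodule_hom[OF P.lmodule_P E.lmodule_E sd]
    have "\<exists>g\<in>lmodule_hom A (P (Suc k)) (E (Suc (Suc k))). ?rel k s g"
    proof (rule projective_lift[OF P.projective_P E.lmodule_E E.lmodule_E E.\<delta>_hom E.submodule_N additive_minus[OF add sda]])
      fix a x assume a: "a \<in> carrier A" and x: "x \<in> carrier (P (Suc k))"
      interpret P: lmodule A "P (Suc k)" by (rule P.lmodule_P)
      note hx = additive_closed[OF add x] and sdx = additive_closed[OF sda x]
      note hax = additive_closed[OF add P.smult_closed[OF a x]]
      have "(h (Suc k) (a \<odot>\<^bsub>P (Suc k)\<^esub> x) \<ominus>\<^bsub>E (Suc k)\<^esub> s (d k (a \<odot>\<^bsub>P (Suc k)\<^esub> x)))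
         \<ominus>\<^bsub>E (Suc k)\<^esub> a \<odot>\<^bsub>E (Suc k)\<^esub> (h (Suc k) x \<ominus>\<^bsub>E (Suc k)\<^esub> s (d k x)) =
        (h (Suc k) (a \<odot>\<^bsub>P (Suc k)\<^esub> x) \<ominus>\<^bsub>E (Suc k)\<^esub> a \<odot>\<^bsub>E (Suc k)\<^esub> h (Suc k) x) \<ominus>\<^bsub>E (Suc k)\<^esub> \<zero>\<^bsub>E (Suc k)\<^esub>"
        using a x hx sdx hax lmodule_homD(3)[OF sd a x]
        by (simp add: E.smult_r_diff E.M.minus_minus_swap E.smult_closed E.M.self_minus)
      then show "(h (Suc k) (a \<odot>\<^bsub>P (Suc k)\<^esub> x) \<ominus>\<^bsub>E (Suc k)\<^esub> s (d k (a \<odot>\<^bsub>P (Suc k)\<^esub> x)))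
         \<ominus>\<^bsub>E (Suc k)\<^esub> a \<odot>\<^bsub>E (Suc k)\<^esub> (h (Suc k) x \<ominus>\<^bsub>E (Suc k)\<^esub> s (d k x)) \<in> N (Suc k)"
        using lin[OF a x] hx hax a by (simp add: E.M.minus_zero_right E.smult_closed)
    next
      fix x assume x: "x \<in> carrier (P (Suc k))"
      then show "\<exists>y\<in>carrier (E (Suc (Suc k))).
          (h (Suc k) x \<ominus>\<^bsub>E (Suc k)\<^esub> s (d k x)) \<ominus>\<^bsub>E (Suc k)\<^esub> \<delta> (Suc k) y \<in> N (Suc k)"
        using E.mod_exact_Suc[of _ k] ob additive_closed[OF add x] additive_closed[OF sda x] by blast
    qed
    then obtain g where g: "g \<in> lmodule_hom A (P (Suc k)) (E (Suc (Suc k)))" and r: "?rel k s g" by blast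
    have "\<delta> (Suc k) (h (Suc (Suc k)) x \<ominus>\<^bsub>E (Suc (Suc k))\<^esub> g (d (Suc k) x)) \<in> N (Suc k)"
      if x: "x \<in> carrier (P (Suc (Suc k)))" for x
    proof (rule obstruction[OF g x])
      note dx = lmodule_homD(1)[OF P.d_hom x]
      \<comment> \<open>At a boundary the term \<open>s d\<close> drops out of \<open>r\<close>, and
        what remains is the hypothesis of \<open>obstruction\<close>.\<close>
      have "s (d k (d (Suc k) x)) = \<zero>\<^bsub>E (Suc k)\<^esub>"
        using P.is_cycle_d[OF x] additive_zero[OF additive_lmodule_hom[OF P.lmodule_P E.lmodule_E s]] by simp
      then show "h (Suc k) (d (Suc k) x) \<ominus>\<^bsub>E (Suc k)\<^esub> \<delta> (Suc k) (g (d (Suc k) x)) \<in> N (Suc k)"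
        using bspec[OF r dx] additive_closed[OF add dx] by (simp add: E.M.minus_zero_right)
    qed
    with g r show "\<exists>g. Good (Suc k) g \<and> ?rel k s g" by (intro exI[of _ g]) (simp add: Good_def)
  qed
  then obtain s where s: "\<And>k. Good k (s k)" and r: "\<And>k. ?rel k (s k) (s (Suc k))" by blast
  show ?thesis
    using s[unfolded Good_def] r by (intro exI[of _ s]) blast
qed

end

section \<open>Quotient modules\<close>

context lmodule
begin

context
  fixes S assumes S: "submodule S A M"
begin

lemma coset_eq_iff:
  assumes x: "x \<in> carrier M" and y: "y \<in> carrier M"
  shows "S +>\<^bsub>M\<^esub> x = S +>\<^bsub>M\<^esub> y \<longleftrightarrow> (\<exists>h\<in>S. x = h \<oplus>\<^bsub>M\<^esub> y)"
proof
  assume eq: "S +>\<^bsub>M\<^esub> x = S +>\<^bsub>M\<^esub> y"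
  have "\<zero>\<^bsub>M\<^esub> \<oplus>\<^bsub>M\<^esub> x \<in> S +>\<^bsub>M\<^esub> x" using submoduleD(2)[OF S] by (auto simp: a_r_coset_def')
  then show "\<exists>h\<in>S. x = h \<oplus>\<^bsub>M\<^esub> y" using x by (auto simp: eq) (auto simp: a_r_coset_def')
next
  assume "\<exists>h\<in>S. x = h \<oplus>\<^bsub>M\<^esub> y"
  then obtain h where h: "h \<in> S" "x = h \<oplus>\<^bsub>M\<^esub> y" by blast
  note hc = submoduleD(1)[OF S h(1)]
  have "g \<oplus>\<^bsub>M\<^esub> x = (g \<oplus>\<^bsub>M\<^esub> h) \<oplus>\<^bsub>M\<^esub> y" if "g \<in> S" for g
    using submoduleD(1)[OF S that] hc y h by (simp add: M.a_assoc)
  then have "S +>\<^bsub>M\<^esub> x \<subseteq> S +>\<^bsub>M\<^esub> y"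
    using submoduleD(3)[OF S _ h(1)] by (auto simp: a_r_coset_def')
  moreover have "g \<oplus>\<^bsub>M\<^esub> y = (g \<ominus>\<^bsub>M\<^esub> h) \<oplus>\<^bsub>M\<^esub> x" if "g \<in> S" for g
    using submoduleD(1)[OF S that] hc y h
    by (simp add: M.minus_add_cancel flip: M.a_assoc)
  then have "S +>\<^bsub>M\<^esub> y \<subseteq> S +>\<^bsub>M\<^esub> x"
    using submoduleD(6)[OF S _ h(1)] by (auto simp: a_r_coset_def')
  ultimately show "S +>\<^bsub>M\<^esub> x = S +>\<^bsub>M\<^esub> y" by blast
qed

lemma coset_eq_iff_diff:
  assumes "x \<in> carrier M" "y \<in> carrier M"
  shows "S +>\<^bsub>M\<^esub> x = S +>\<^bsub>M\<^esub> y \<longleftrightarrow> x \<ominus>\<^bsub>M\<^esub> y \<in> S"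
proof -
  have "(\<exists>h\<in>S. x = h \<oplus>\<^bsub>M\<^esub> y) \<longleftrightarrow> x \<ominus>\<^bsub>M\<^esub> y \<in> S"
  proof
    assume "\<exists>h\<in>S. x = h \<oplus>\<^bsub>M\<^esub> y"
    then obtain h where h: "h \<in> S" "x = h \<oplus>\<^bsub>M\<^esub> y" by blast
    then show "x \<ominus>\<^bsub>M\<^esub> y \<in> S"
      using submoduleD(1)[OF S h(1)] assms by (simp add: a_minus_def M.a_assoc M.r_neg)
  next
    assume "x \<ominus>\<^bsub>M\<^esub> y \<in> S"
    then show "\<exists>h\<in>S. x = h \<oplus>\<^bsub>M\<^esub> y" using M.minus_add_cancel[OF assms] by metis
  qed
  then show ?thesis using coset_eq_iff assms by blast
qed

lemma carrier_quot_lmodule: "carrier (quot_lmodule M S) = (\<lambda>x. S +>\<^bsub>M\<^esub> x) ` carrier M"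
  by (auto simp: quot_lmodule_def A_RCOSETS_def RCOSETS_def a_r_coset_def)

lemma zero_quot_lmodule: "\<zero>\<^bsub>quot_lmodule M S\<^esub> = S +>\<^bsub>M\<^esub> \<zero>\<^bsub>M\<^esub>"
  using submoduleD(1)[OF S] by (auto simp: quot_lmodule_def a_r_coset_def')

lemma add_quot_lmodule:
  assumes x: "x \<in> carrier M" and y: "y \<in> carrier M"
  shows "(S +>\<^bsub>M\<^esub> x) \<oplus>\<^bsub>quot_lmodule M S\<^esub> (S +>\<^bsub>M\<^esub> y) = S +>\<^bsub>M\<^esub> (x \<oplus>\<^bsub>M\<^esub> y)"
proof -
  have eq: "(g \<oplus>\<^bsub>M\<^esub> x) \<oplus>\<^bsub>M\<^esub> (h \<oplus>\<^bsub>M\<^esub> y) = (g \<oplus>\<^bsub>M\<^esub> h) \<oplus>\<^bsub>M\<^esub> (x \<oplus>\<^bsub>M\<^esub> y)" if "g \<in> S" "h \<in> S" for g h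
    using submoduleD(1)[OF S that(1)] submoduleD(1)[OF S that(2)] x y by (simp add: M.a_ac)
  have 1: "(S +>\<^bsub>M\<^esub> x) <+>\<^bsub>M\<^esub> (S +>\<^bsub>M\<^esub> y) \<subseteq> S +>\<^bsub>M\<^esub> (x \<oplus>\<^bsub>M\<^esub> y)"
    using eq submoduleD(3)[OF S] unfolding set_add_def set_mult_def a_r_coset_def'
    by (simp add: subset_iff) blast
  have "h \<oplus>\<^bsub>M\<^esub> (x \<oplus>\<^bsub>M\<^esub> y) = (h \<oplus>\<^bsub>M\<^esub> x) \<oplus>\<^bsub>M\<^esub> (\<zero>\<^bsub>M\<^esub> \<oplus>\<^bsub>M\<^esub> y)" if "h \<in> S" for h
    using submoduleD(1)[OF S that] x y by (simp add: M.a_ac)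
  then have "S +>\<^bsub>M\<^esub> (x \<oplus>\<^bsub>M\<^esub> y) \<subseteq> (S +>\<^bsub>M\<^esub> x) <+>\<^bsub>M\<^esub> (S +>\<^bsub>M\<^esub> y)"
    using submoduleD(2)[OF S] by (fastforce simp: set_add_def set_mult_def a_r_coset_def')
  with 1 show ?thesis by (simp add: quot_lmodule_def)
qed

lemma smult_quot_lmodule:
  assumes a: "a \<in> carrier A" and x: "x \<in> carrier M"
  shows "a \<odot>\<^bsub>quot_lmodule M S\<^esub> (S +>\<^bsub>M\<^esub> x) = S +>\<^bsub>M\<^esub> (a \<odot>\<^bsub>M\<^esub> x)"
proof -
  have "S +>\<^bsub>M\<^esub> (a \<odot>\<^bsub>M\<^esub> y) = S +>\<^bsub>M\<^esub> (a \<odot>\<^bsub>M\<^esub> x)" if y: "y \<in> S +>\<^bsub>M\<^esub> x" for y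
  proof -
    obtain h where h: "h \<in> S" "y = h \<oplus>\<^bsub>M\<^esub> x" using y unfolding a_r_coset_def' by blast
    note hc = submoduleD(1)[OF S h(1)]
    have "a \<odot>\<^bsub>M\<^esub> y = a \<odot>\<^bsub>M\<^esub> h \<oplus>\<^bsub>M\<^esub> a \<odot>\<^bsub>M\<^esub> x" using hc h a x by (simp add: smult_r_distr)
    then show ?thesis
      using coset_eq_iff[of "a \<odot>\<^bsub>M\<^esub> y" "a \<odot>\<^bsub>M\<^esub> x"] submoduleD(4)[OF S a h(1)] hc h a x
      by (metis M.a_closed smult_closed)
  qed
  moreover have "\<zero>\<^bsub>M\<^esub> \<oplus>\<^bsub>M\<^esub> x \<in> S +>\<^bsub>M\<^esub> x" using submoduleD(2)[OF S] by (auto simp: a_r_coset_def')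
  ultimately show ?thesis unfolding quot_lmodule_def by auto
qed

lemma lmodule_quot_lmodule: "lmodule A (quot_lmodule M S)"
proof -
  let ?Q = "quot_lmodule M S"
  have "abelian_group ?Q"
  proof (rule abelian_groupI)
    fix C assume "C \<in> carrier ?Q"
    then obtain x where x: "x \<in> carrier M" "C = S +>\<^bsub>M\<^esub> x" by (auto simp: carrier_quot_lmodule)
    then show "\<exists>D\<in>carrier ?Q. D \<oplus>\<^bsub>?Q\<^esub> C = \<zero>\<^bsub>?Q\<^esub>"
      by (intro bexI[of _ "S +>\<^bsub>M\<^esub> (\<ominus>\<^bsub>M\<^esub> x)"])
        (auto simp: carrier_quot_lmodule add_quot_lmodule zero_quot_lmodule M.l_neg)
  qed (auto simp: carrier_quot_lmodule add_quot_lmodule zero_quot_lmodule M.a_ac)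
  then show ?thesis
    by (simp add: lmodule_def lmodule_axioms_def A.ring_axioms)
      (auto simp: carrier_quot_lmodule add_quot_lmodule smult_quot_lmodule smult_closed
        smult_l_distr smult_r_distr smult_assoc smult_one)
qed

text \<open>\<open>homology\<close> divides the cycles, given as the chain module with its carrier
  replaced, so this record update must be known to yield a module.\<close>

lemma lmodule_submodule: "lmodule A (M\<lparr>carrier := S\<rparr>)"
proof -
  have "abelian_group (M\<lparr>carrier := S\<rparr>)"
  proof (rule abelian_groupI)
    fix x assume "x \<in> carrier (M\<lparr>carrier := S\<rparr>)"
    then show "\<exists>y\<in>carrier (M\<lparr>carrier := S\<rparr>). y \<oplus>\<^bsub>M\<lparr>carrier := S\<rparr>\<^esub> x = \<zero>\<^bsub>M\<lparr>carrier := S\<rparr>\<^esub>"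
      using submoduleD[OF S] by (intro bexI[of _ "\<ominus>\<^bsub>M\<^esub> x"]) (simp_all add: M.l_neg)
  qed (use submoduleD[OF S] in \<open>auto simp: M.a_assoc intro: M.a_comm\<close>)
  then show ?thesis
    using submoduleD[OF S]
    by (simp add: lmodule_def lmodule_axioms_def A.ring_axioms
        smult_l_distr smult_r_distr smult_assoc smult_one)
qed

end

lemma submodule_restrict_carrier:
  assumes "submodule S A M" "submodule Z A M" "S \<subseteq> Z"
  shows "submodule S A (M\<lparr>carrier := Z\<rparr>)"
  using assms submoduleD[OF assms(1)]
  by (simp add: lmodule.submodule_iff[OF lmodule_submodule[OF assms(2)]])

end

lemma submodule_image:
  assumes "lmodule A M" "lmodule A N" "h \<in> lmodule_hom A M N" "submodule S A M"
  shows "submodule (h ` S) A N"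
proof -
  interpret M: lmodule A M by fact
  interpret N: lmodule A N by fact
  note D = M.submoduleD[OF assms(4)] and H = lmodule_homD[OF assms(3)]
  have "h \<zero>\<^bsub>M\<^esub> = \<zero>\<^bsub>N\<^esub>" by (rule additive_zero[OF additive_lmodule_hom[OF assms(1-3)]])
  then have "\<zero>\<^bsub>N\<^esub> \<in> h ` S" using D(2) by (metis imageI)
  moreover have "h x \<oplus>\<^bsub>N\<^esub> h y \<in> h ` S" if "x \<in> S" "y \<in> S" for x y
    using D(3)[OF that] H(2)[OF D(1)[OF that(1)] D(1)[OF that(2)]] by (metis imageI)
  moreover have "a \<odot>\<^bsub>N\<^esub> h x \<in> h ` S" if "a \<in> carrier A" "x \<in> S" for a x
    using D(4)[OF that] H(3)[OF that(1) D(1)[OF that(2)]] by (metis imageI)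
  ultimately show ?thesis using D(1) H(1) by (auto simp: N.submodule_iff)
qed

lemma submodule_vimage:
  assumes "lmodule A M" "lmodule A N" "h \<in> lmodule_hom A M N" "submodule S A N"
  shows "submodule {x \<in> carrier M. h x \<in> S} A M"
proof -
  interpret M: lmodule A M by fact
  interpret N: lmodule A N by fact
  have "h \<zero>\<^bsub>M\<^esub> = \<zero>\<^bsub>N\<^esub>" by (rule additive_zero[OF additive_lmodule_hom[OF assms(1-3)]])
  then show ?thesis
    using N.submoduleD[OF assms(4)] lmodule_homD[OF assms(3)]
    by (auto simp: M.submodule_iff M.smult_closed)
qed

section \<open>Tensor products with a scalar module\<close>

text \<open>\<open>N\<close> is a copy of \<open>R\<close> on which the algebra acts through the
  character \<chi>, and the scalars split \<chi>. Both maps refer to \<open>op_ring A\<close>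
  because the \<open>P\<close> below are right modules; since \<open>R\<close> is commutative, they
  are homomorphisms for either order of multiplication.\<close>

locale augmented_algebra =
  fixes R :: "('r, 'e) ring_scheme" and A :: "('r, 'a, 'f) module_scheme"
    and N :: "('a, 'r, 'h) module_scheme" and \<chi> :: "'a \<Rightarrow> 'r"
  assumes cring: "cring R"
    and unit_hom: "(\<lambda>r. r \<odot>\<^bsub>A\<^esub> \<one>\<^bsub>A\<^esub>) \<in> ring_hom R (op_ring A)"
    and \<chi>_hom: "\<chi> \<in> ring_hom (op_ring A) R"
    and \<chi>_unit: "\<And>r. r \<in> carrier R \<Longrightarrow> \<chi> (r \<odot>\<^bsub>A\<^esub> \<one>\<^bsub>A\<^esub>) = r"
    and carrier_N: "carrier N = carrier R" and add_N: "add N = add R"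
    and smult_N: "\<And>a r. \<lbrakk>a \<in> carrier A; r \<in> carrier R\<rbrakk> \<Longrightarrow> a \<odot>\<^bsub>N\<^esub> r = \<chi> a \<otimes>\<^bsub>R\<^esub> r"
begin

definition augmentation_ideal :: "'a set" where
  "augmentation_ideal = {a \<in> carrier A. \<chi> a = \<zero>\<^bsub>R\<^esub>}"

definition unit :: "'r \<Rightarrow> 'a" where "unit r = r \<odot>\<^bsub>A\<^esub> \<one>\<^bsub>A\<^esub>"

lemma ring_hom_unit: "unit \<in> ring_hom R (op_ring A)"
  using unit_hom by (simp add: unit_def[abs_def])

lemma \<chi>_unit': "r \<in> carrier R \<Longrightarrow> \<chi> (unit r) = r"
  by (simp add: unit_def \<chi>_unit)

sublocale R: cring R by (rule cring)

end

locale tensor_scalar = augmented_algebra R A N \<chi>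
  for R :: "('r, 'e) ring_scheme" and A :: "('r, 'a, 'f) module_scheme"
    and N :: "('a, 'r, 'h) module_scheme" and \<chi> :: "'a \<Rightarrow> 'r" +
  fixes P :: "('a, 'p, 'g) module_scheme"
  assumes lmodule_P: "lmodule (op_ring A) P"
begin

sublocale P: lmodule "op_ring A" P by (rule lmodule_P)

abbreviation "K \<equiv> augmentation_ideal"
abbreviation "KP \<equiv> ideal_smult P K"
abbreviation "X \<equiv> carrier P \<times> carrier N"
abbreviation "F \<equiv> free_lmodule R X"
abbreviation "rel \<equiv> tensor_rel R A P N"
abbreviation "T \<equiv> tensor R A P N"
abbreviation "RP \<equiv> restrict_scalars unit P"

sublocale F: lmodule R F by (rule R.lmodule_free)
sublocale RP: lmodule R RP
  by (rule lmodule_restrict_scalars[OF lmodule_P R.ring_axioms ring_hom_unit])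

lemma K_closed: "K \<subseteq> carrier (op_ring A)"
  by (auto simp: augmentation_ideal_def)

lemma unit_closed: "r \<in> carrier R \<Longrightarrow> unit r \<in> carrier (op_ring A)"
  using ring_hom_closed[OF ring_hom_unit] by simp

lemma submodule_KP: "submodule KP (op_ring A) P"
proof (rule P.submodule_ideal_smult[OF K_closed])
  fix a c assume "a \<in> K" "c \<in> carrier (op_ring A)"
  then show "c \<otimes>\<^bsub>op_ring A\<^esub> a \<in> K"
    using ring_hom_mult[OF \<chi>_hom, of c a] ring_hom_closed[OF \<chi>_hom, of c] P.A.m_closed[of c a]
    by (auto simp: augmentation_ideal_def)
qed

lemma submodule_KP_R: "submodule KP R RP"
  using P.submoduleD[OF submodule_KP] unit_closed
  by (auto simp: RP.submodule_iff)

section \<open>The relations of a tensor product with a scalar module\<close>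

lemma gens_closed: "tensor_gens R A P N \<subseteq> carrier F"
proof -
  have e: "basis_elt R X (m, n) \<in> carrier F" if "m \<in> carrier P" "n \<in> carrier R" for m n
    using that carrier_N by (intro R.basis_elt_closed) auto
  have "a \<odot>\<^bsub>N\<^esub> n \<in> carrier R" if "a \<in> carrier A" "n \<in> carrier R" for a n
    using that smult_N ring_hom_closed[OF \<chi>_hom] by simp
  then show ?thesis
    unfolding tensor_gens_def Let_def carrier_N add_N unit_def[symmetric]
    using e[unfolded carrier_N] unit_closed P.smult_closed
    by (intro Un_least subsetI; clarify; intro F.M.minus_closed[unfolded carrier_N]
        F.M.a_closed[unfolded carrier_N] F.smult_closed[unfolded carrier_N]) (simp_all del: free_lmodule_simps)
qed

lemma submodule_rel: "submodule rel R F"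
proof -
  have car: "submodule (carrier F) R F" by (simp add: F.submodule_iff del: free_lmodule_simps)
      (simp add: F.smult_closed del: free_lmodule_simps)
  then have "rel \<subseteq> carrier F" using gens_closed by (auto simp: tensor_rel_def lmodule_span_def)
  then show ?thesis
    by (subst F.submodule_iff) (auto simp: tensor_rel_def lmodule_span_def F.submoduleD
        simp del: free_lmodule_simps)
qed

lemma gens_rel: "g \<in> tensor_gens R A P N \<Longrightarrow> g \<in> rel"
  by (auto simp: tensor_rel_def lmodule_span_def)

lemma rel_least: "\<lbrakk>submodule S R F; tensor_gens R A P N \<subseteq> S\<rbrakk> \<Longrightarrow> rel \<subseteq> S"
  by (auto simp: tensor_rel_def lmodule_span_def)

text \<open>The pair \<open>(m, n)\<close> goes to \<open>m\<close> times the scalar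
  \<open>n\<close>. Modulo \<open>K P\<close> this will invert the map
  \<open>m \<mapsto> m \<otimes> 1\<close>.\<close>

definition contract :: "('p \<times> 'r \<Rightarrow> 'r) \<Rightarrow> 'p" where
  "contract = lin_ext R X RP (\<lambda>p. unit (snd p) \<odot>\<^bsub>P\<^esub> fst p)"

lemma contract_hom: "contract \<in> lmodule_hom R F RP"
  unfolding contract_def
  by (rule RP.lin_ext_hom) (auto simp: carrier_N intro!: P.smult_closed unit_closed)

lemma contract_basis:
  "\<lbrakk>m \<in> carrier P; n \<in> carrier R\<rbrakk> \<Longrightarrow> contract (basis_elt R X (m, n)) = unit n \<odot>\<^bsub>P\<^esub> m"
  unfolding contract_def
  by (subst RP.lin_ext_basis) (auto simp: carrier_N intro!: P.smult_closed unit_closed)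

lemmas contract_additive = additive_lmodule_hom[OF F.lmodule_axioms RP.lmodule_axioms contract_hom]

lemma e_closed: "\<lbrakk>m \<in> carrier P; n \<in> carrier R\<rbrakk> \<Longrightarrow> basis_elt R X (m, n) \<in> carrier F"
  by (rule R.basis_elt_closed) (simp add: carrier_N)

text \<open>The relations of additivity and of scalars contract to 0. Only balancing leaves a
  remainder: \<open>m\<close> multiplied by the difference of \<open>a\<close> times the scalar
  \<open>n\<close> and the scalar \<open>\<chi> a\<close> times \<open>n\<close>. This algebra
  element lies in the kernel of \<chi>.\<close>

lemma contract_gens:
  assumes "g \<in> tensor_gens R A P N" shows "contract g \<in> KP"
proof -
  let ?e = "\<lambda>m n. basis_elt R X (m, n)"
  have zero: "\<zero>\<^bsub>P\<^esub> \<in> KP" by (rule ideal_smult.zero)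
  have diff: "contract (f \<ominus>\<^bsub>F\<^esub> g) = contract f \<ominus>\<^bsub>P\<^esub> contract g"
    if "f \<in> carrier F" "g \<in> carrier F" for f g
    using additive_diff[OF contract_additive that] by simp
  have add: "contract (f \<oplus>\<^bsub>F\<^esub> g) = contract f \<oplus>\<^bsub>P\<^esub> contract g"
    if "f \<in> carrier F" "g \<in> carrier F" for f g
    using lmodule_homD(2)[OF contract_hom that] by simp
  have smult: "contract (r \<odot>\<^bsub>F\<^esub> f) = unit r \<odot>\<^bsub>P\<^esub> contract f"
    if "r \<in> carrier R" "f \<in> carrier F" for r f
    using lmodule_homD(3)[OF contract_hom that] by simp
  note uc = unit_closed[simplified]
  note simps = diff add smult contract_basis e_closed F.M.a_closed F.smult_closed P.smult_closed
    uc unit_closed P.M.self_minus zero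
  consider
    (1) m m' n where "m \<in> carrier P" "m' \<in> carrier P" "n \<in> carrier N"
      "g = ?e (m \<oplus>\<^bsub>P\<^esub> m') n \<ominus>\<^bsub>F\<^esub> (?e m n \<oplus>\<^bsub>F\<^esub> ?e m' n)"
  | (2) m n n' where "m \<in> carrier P" "n \<in> carrier N" "n' \<in> carrier N"
      "g = ?e m (n \<oplus>\<^bsub>N\<^esub> n') \<ominus>\<^bsub>F\<^esub> (?e m n \<oplus>\<^bsub>F\<^esub> ?e m n')"
  | (3) r m n where "r \<in> carrier R" "m \<in> carrier P" "n \<in> carrier N"
      "g = ?e ((r \<odot>\<^bsub>A\<^esub> \<one>\<^bsub>A\<^esub>) \<odot>\<^bsub>P\<^esub> m) n \<ominus>\<^bsub>F\<^esub> r \<odot>\<^bsub>F\<^esub> ?e m n"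
  | (4) r m n where "r \<in> carrier R" "m \<in> carrier P" "n \<in> carrier N"
      "g = ?e m ((r \<odot>\<^bsub>A\<^esub> \<one>\<^bsub>A\<^esub>) \<odot>\<^bsub>N\<^esub> n) \<ominus>\<^bsub>F\<^esub> r \<odot>\<^bsub>F\<^esub> ?e m n"
  | (5) a m n where "a \<in> carrier A" "m \<in> carrier P" "n \<in> carrier N"
      "g = ?e (a \<odot>\<^bsub>P\<^esub> m) n \<ominus>\<^bsub>F\<^esub> ?e m (a \<odot>\<^bsub>N\<^esub> n)"
    using assms unfolding tensor_gens_def Let_def
    apply -
    apply (elim UnE CollectE exE conjE)
    subgoal by (rule that(1); assumption)
    subgoal by (rule that(2); assumption)
    subgoal by (rule that(3); assumption)
    subgoal by (rule that(4); assumption)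
    subgoal by (rule that(5); assumption)
    done
  then show ?thesis
  proof cases
    case r: 1
    note 1 = r(1,2) r(3)[unfolded carrier_N] r(4)
    then have "contract g = \<zero>\<^bsub>P\<^esub>"
      by (simp add: simps P.smult_r_distr del: free_lmodule_simps)
    then show ?thesis using zero by simp
  next
    case r: 2
    note 2 = r(1) r(2,3)[unfolded carrier_N] r(4)[unfolded add_N]
    then have "contract g = \<zero>\<^bsub>P\<^esub>"
      by (simp add: simps P.smult_l_distr ring_hom_add[OF ring_hom_unit] del: free_lmodule_simps op_ring_simps(3))
    then show ?thesis using zero by simp
  next
    case r: 3
    note 3 = r(1,2) r(3)[unfolded carrier_N] r(4)[folded unit_def]
    have "unit n \<odot>\<^bsub>P\<^esub> (unit r \<odot>\<^bsub>P\<^esub> m) = unit (n \<otimes>\<^bsub>R\<^esub> r) \<odot>\<^bsub>P\<^esub> m"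
      "unit r \<odot>\<^bsub>P\<^esub> (unit n \<odot>\<^bsub>P\<^esub> m) = unit (r \<otimes>\<^bsub>R\<^esub> n) \<odot>\<^bsub>P\<^esub> m"
      using 3 by (simp_all add: ring_hom_mult[OF ring_hom_unit] P.smult_assoc unit_closed del: op_ring_simps)
    with 3 have "contract g = \<zero>\<^bsub>P\<^esub>"
      by (simp add: simps R.m_comm[of n r] del: free_lmodule_simps)
    then show ?thesis using zero by simp
  next
    case r: 4
    note 4 = r(1,2) r(3)[unfolded carrier_N] r(4)[folded unit_def]
    have "unit r \<odot>\<^bsub>P\<^esub> (unit n \<odot>\<^bsub>P\<^esub> m) = unit (r \<otimes>\<^bsub>R\<^esub> n) \<odot>\<^bsub>P\<^esub> m"
      using 4 by (simp_all add: ring_hom_mult[OF ring_hom_unit] P.smult_assoc unit_closed del: op_ring_simps)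
    moreover have "unit r \<odot>\<^bsub>N\<^esub> n = r \<otimes>\<^bsub>R\<^esub> n"
      using 4 smult_N[of "unit r" n] uc by (simp add: \<chi>_unit')
    ultimately have "contract g = \<zero>\<^bsub>P\<^esub>"
      using 4 by (simp add: simps del: free_lmodule_simps)
    then show ?thesis using zero by simp
  next
    case r: 5
    note 5 = r(1,2) r(3)[unfolded carrier_N] r(4)
    have \<chi>a: "\<chi> a \<in> carrier R" using ring_hom_closed[OF \<chi>_hom] 5 by simp
    let ?c = "unit n \<otimes>\<^bsub>op_ring A\<^esub> a" and ?c' = "unit (\<chi> a \<otimes>\<^bsub>R\<^esub> n)"
    have c: "?c \<in> carrier (op_ring A)" "?c' \<in> carrier (op_ring A)"
      using 5(1) by (simp_all del: op_ring_simps(5)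
        add: P.A.m_closed[OF unit_closed[OF 5(3)], simplified] uc[OF R.m_closed[OF \<chi>a 5(3)]])
    have "\<chi> ?c = \<chi> ?c'"
      using 5 \<chi>a ring_hom_mult[OF \<chi>_hom unit_closed, of n a]
      by (simp add: \<chi>_unit' R.m_comm[of n] del: op_ring_simps(5))
    moreover have "\<chi> (?c \<ominus>\<^bsub>op_ring A\<^esub> ?c') = \<chi> ?c \<ominus>\<^bsub>R\<^esub> \<chi> ?c'"
    proof (rule additive_diff[OF _ c])
      show "additive (op_ring A) R \<chi>"
        using P.A.abelian_group_axioms R.abelian_group_axioms ring_hom_closed[OF \<chi>_hom]
          ring_hom_add[OF \<chi>_hom] by (auto simp: additive_def)
    qed
    ultimately have "?c \<ominus>\<^bsub>op_ring A\<^esub> ?c' \<in> K"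
      using c P.A.minus_closed[OF c] ring_hom_closed[OF \<chi>_hom c(2)]
      by (simp add: augmentation_ideal_def R.self_minus del: op_ring_simps(5))
    then have "(?c \<ominus>\<^bsub>op_ring A\<^esub> ?c') \<odot>\<^bsub>P\<^esub> m \<in> KP" using 5 P.ideal_smult_smult[OF K_closed] by blast
    moreover have "contract g = (?c \<ominus>\<^bsub>op_ring A\<^esub> ?c') \<odot>\<^bsub>P\<^esub> m"
      using 5 c \<chi>a smult_N[OF 5(1,3)]
      by (simp add: simps P.smult_l_diff P.smult_assoc del: free_lmodule_simps op_ring_simps(5))
    ultimately show ?thesis by simp
  qed
qed

lemma contract_rel: "f \<in> rel \<Longrightarrow> contract f \<in> KP"
  using rel_least[OF submodule_vimage[OF F.lmodule_axioms RP.lmodule_axioms contract_hom submodule_KP_R]]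
    gens_closed contract_gens by blast

section \<open>The isomorphism from \<open>P / K P\<close> to the tensor product\<close>

definition tclass :: "'p \<Rightarrow> 'r \<Rightarrow> ('p \<times> 'r \<Rightarrow> 'r) set" where
  "tclass m n = rel +>\<^bsub>F\<^esub> basis_elt R X (m, n)"

definition \<theta> :: "'p \<Rightarrow> ('p \<times> 'r \<Rightarrow> 'r) set" where "\<theta> m = tclass m \<one>\<^bsub>R\<^esub>"

lemma lmodule_T: "lmodule R T"
  unfolding tensor_def by (rule F.lmodule_quot_lmodule[OF submodule_rel])

sublocale T: lmodule R T by (rule lmodule_T)

lemmas tensor_simps =
  F.carrier_quot_lmodule[OF submodule_rel, folded tensor_def]
  F.zero_quot_lmodule[OF submodule_rel, folded tensor_def]
  F.add_quot_lmodule[OF submodule_rel, folded tensor_def]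
  F.smult_quot_lmodule[OF submodule_rel, folded tensor_def]

lemma coset_gens:
  "\<lbrakk>f \<in> carrier F; g \<in> carrier F; f \<ominus>\<^bsub>F\<^esub> g \<in> tensor_gens R A P N\<rbrakk> \<Longrightarrow>
    rel +>\<^bsub>F\<^esub> f = rel +>\<^bsub>F\<^esub> g"
  by (simp add: F.coset_eq_iff_diff[OF submodule_rel] gens_rel del: free_lmodule_simps)

lemma \<theta>_closed: "m \<in> carrier P \<Longrightarrow> \<theta> m \<in> carrier T"
  unfolding \<theta>_def tclass_def tensor_simps by (intro imageI e_closed) auto

lemma \<theta>_add:
  assumes "m \<in> carrier P" "m' \<in> carrier P"
  shows "\<theta> (m \<oplus>\<^bsub>P\<^esub> m') = \<theta> m \<oplus>\<^bsub>T\<^esub> \<theta> m'"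
proof -
  let ?e = "\<lambda>m. basis_elt R X (m, \<one>\<^bsub>R\<^esub>)"
  have "?e (m \<oplus>\<^bsub>P\<^esub> m') \<ominus>\<^bsub>F\<^esub> (?e m \<oplus>\<^bsub>F\<^esub> ?e m') \<in> tensor_gens R A P N"
    using assms R.one_closed unfolding tensor_gens_def Let_def carrier_N by blast
  then show ?thesis
    using assms coset_gens[of "?e (m \<oplus>\<^bsub>P\<^esub> m')" "?e m \<oplus>\<^bsub>F\<^esub> ?e m'"]
    by (simp add: \<theta>_def tclass_def tensor_simps e_closed F.M.a_closed del: free_lmodule_simps)
qed

lemma \<theta>_smult:
  assumes "r \<in> carrier R" "m \<in> carrier P"
  shows "\<theta> (unit r \<odot>\<^bsub>P\<^esub> m) = r \<odot>\<^bsub>T\<^esub> \<theta> m"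
proof -
  let ?e = "\<lambda>m. basis_elt R X (m, \<one>\<^bsub>R\<^esub>)"
  have "?e (unit r \<odot>\<^bsub>P\<^esub> m) \<ominus>\<^bsub>F\<^esub> (r \<odot>\<^bsub>F\<^esub> ?e m) \<in> tensor_gens R A P N"
    using assms R.one_closed unfolding tensor_gens_def Let_def carrier_N unit_def by blast
  then show ?thesis
    using assms coset_gens[of "?e (unit r \<odot>\<^bsub>P\<^esub> m)" "r \<odot>\<^bsub>F\<^esub> ?e m"]
    by (simp add: \<theta>_def tclass_def tensor_simps e_closed F.smult_closed P.smult_closed unit_closed[simplified]
        del: free_lmodule_simps)
qed

lemma \<theta>_hom: "\<theta> \<in> lmodule_hom R RP T"
  by (rule lmodule_homI) (simp_all add: \<theta>_closed \<theta>_add \<theta>_smult)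

lemmas \<theta>_additive = additive_lmodule_hom[OF RP.lmodule_axioms T.lmodule_axioms \<theta>_hom]

text \<open>The scalar \<open>n\<close> moves across the tensor sign: the scalar relation for
  \<open>N\<close> pulls it out, the one for \<open>P\<close> puts it in.\<close>

lemma tclass_eq:
  assumes "m \<in> carrier P" "n \<in> carrier R" shows "tclass m n = \<theta> (unit n \<odot>\<^bsub>P\<^esub> m)"
proof -
  let ?e = "\<lambda>n. basis_elt R X (m, n)"
  have "unit n \<odot>\<^bsub>N\<^esub> \<one>\<^bsub>R\<^esub> = n"
    using smult_N[of "unit n" "\<one>\<^bsub>R\<^esub>"] unit_closed assms by (simp add: \<chi>_unit')
  moreover have "?e (unit n \<odot>\<^bsub>N\<^esub> \<one>\<^bsub>R\<^esub>) \<ominus>\<^bsub>F\<^esub> (n \<odot>\<^bsub>F\<^esub> ?e \<one>\<^bsub>R\<^esub>) \<in> tensor_gens R A P N"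
    using assms R.one_closed unfolding tensor_gens_def Let_def carrier_N unit_def by blast
  ultimately show ?thesis
    using assms coset_gens[of "?e n" "n \<odot>\<^bsub>F\<^esub> ?e \<one>\<^bsub>R\<^esub>"]
    by (simp add: \<theta>_smult del: free_lmodule_simps) (simp add: \<theta>_def tclass_def tensor_simps e_closed F.smult_closed
        del: free_lmodule_simps)
qed

text \<open>Yields surjectivity of \<open>\<theta>\<close> and, in
  \<open>tensor_map_\<theta>\<close>, control over every representative of a coset.\<close>

lemma coset_eq_\<theta>: "f \<in> carrier F \<Longrightarrow> rel +>\<^bsub>F\<^esub> f = \<theta> (contract f)"
proof (induction rule: R.free_lmodule_induct)
  case zero
  have "contract \<zero>\<^bsub>F\<^esub> = \<zero>\<^bsub>P\<^esub>" using additive_zero[OF contract_additive] by simp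
  moreover have "\<theta> \<zero>\<^bsub>P\<^esub> = \<zero>\<^bsub>T\<^esub>" using additive_zero[OF \<theta>_additive] by simp
  ultimately show ?case by (simp add: tensor_simps del: free_lmodule_simps)
next
  case (step f a x)
  obtain m n where x: "x = (m, n)" "m \<in> carrier P" "n \<in> carrier R" using step carrier_N by auto
  have cf: "contract f \<in> carrier P" using lmodule_homD(1)[OF contract_hom step(1)] by simp
  have u: "unit n \<odot>\<^bsub>P\<^esub> m \<in> carrier P" by (intro P.smult_closed unit_closed x)
  note e = e_closed[OF x(2,3)]
  note ae = F.smult_closed[OF step(2) e]
  have "contract (f \<oplus>\<^bsub>F\<^esub> a \<odot>\<^bsub>F\<^esub> basis_elt R X x) = contract f \<oplus>\<^bsub>P\<^esub> unit a \<odot>\<^bsub>P\<^esub> (unit n \<odot>\<^bsub>P\<^esub> m)"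
    using lmodule_homD(2)[OF contract_hom step(1) ae] lmodule_homD(3)[OF contract_hom step(2) e]
    by (simp add: x contract_basis del: free_lmodule_simps)
  then have "\<theta> (contract (f \<oplus>\<^bsub>F\<^esub> a \<odot>\<^bsub>F\<^esub> basis_elt R X x)) = \<theta> (contract f) \<oplus>\<^bsub>T\<^esub> a \<odot>\<^bsub>T\<^esub> tclass m n"
    using cf u step(2) x by (simp add: \<theta>_add \<theta>_smult tclass_eq P.smult_closed unit_closed[simplified])
  moreover have "rel +>\<^bsub>F\<^esub> (f \<oplus>\<^bsub>F\<^esub> a \<odot>\<^bsub>F\<^esub> basis_elt R X x) = (rel +>\<^bsub>F\<^esub> f) \<oplus>\<^bsub>T\<^esub> a \<odot>\<^bsub>T\<^esub> tclass m n"
    unfolding x(1) tclass_def tensor_simps(4)[OF step(2) e] tensor_simps(3)[OF step(1) ae] ..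
  ultimately show ?case using step(5) by metis
qed

lemma \<theta>_image: "carrier T = \<theta> ` carrier P"
  using coset_eq_\<theta> lmodule_homD(1)[OF contract_hom] \<theta>_closed by (auto simp: tensor_simps)

text \<open>Left to right: \<open>contract\<close> respects the relations modulo \<open>K P\<close>
  and sends \<open>m \<otimes> 1\<close> to \<open>m\<close>. Right to left: for \<open>a\<close> in
  the kernel of \<chi>, balancing gives
  \<open>m a \<otimes> 1 = m \<otimes> a 1 = m \<otimes> 0 = 0\<close>.\<close>

lemma \<theta>_eq_iff:
  assumes "x \<in> carrier P" "y \<in> carrier P"
  shows "\<theta> x = \<theta> y \<longleftrightarrow> x \<ominus>\<^bsub>P\<^esub> y \<in> KP"
proof
  let ?e = "\<lambda>m. basis_elt R X (m, \<one>\<^bsub>R\<^esub>)"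
  have u1: "unit \<one>\<^bsub>R\<^esub> \<odot>\<^bsub>P\<^esub> m = m" if "m \<in> carrier P" for m
    using that ring_hom_one[OF ring_hom_unit] by (metis P.smult_one)
  assume "\<theta> x = \<theta> y"
  then have "?e x \<ominus>\<^bsub>F\<^esub> ?e y \<in> rel"
    using assms by (simp add: \<theta>_def tclass_def F.coset_eq_iff_diff[OF submodule_rel] e_closed
        del: free_lmodule_simps)
  then have "contract (?e x \<ominus>\<^bsub>F\<^esub> ?e y) \<in> KP" by (rule contract_rel)
  then show "x \<ominus>\<^bsub>P\<^esub> y \<in> KP"
    using additive_diff[OF contract_additive e_closed e_closed, of x "\<one>\<^bsub>R\<^esub>" y "\<one>\<^bsub>R\<^esub>"] assms
    by (simp add: contract_basis u1 del: free_lmodule_simps)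
next
  assume xy: "x \<ominus>\<^bsub>P\<^esub> y \<in> KP"
  have "additive P T \<theta>"
    using \<theta>_additive P.M.abelian_group_axioms by (simp add: additive_def)
  moreover have "\<theta> (a \<odot>\<^bsub>P\<^esub> m) = \<zero>\<^bsub>T\<^esub>" if a: "a \<in> K" and m: "m \<in> carrier P" for a m
  proof -
    let ?e = "\<lambda>m n. basis_elt R X (m, n)"
    have aA: "a \<in> carrier A" "\<chi> a = \<zero>\<^bsub>R\<^esub>" using a by (auto simp: augmentation_ideal_def)
    have "a \<odot>\<^bsub>N\<^esub> \<one>\<^bsub>R\<^esub> = \<zero>\<^bsub>R\<^esub>" using smult_N[OF aA(1), of "\<one>\<^bsub>R\<^esub>"] aA by simp
    moreover have "?e (a \<odot>\<^bsub>P\<^esub> m) \<one>\<^bsub>R\<^esub> \<ominus>\<^bsub>F\<^esub> ?e m (a \<odot>\<^bsub>N\<^esub> \<one>\<^bsub>R\<^esub>) \<in> tensor_gens R A P N"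
      using aA m R.one_closed unfolding tensor_gens_def Let_def carrier_N by blast
    ultimately have "\<theta> (a \<odot>\<^bsub>P\<^esub> m) = tclass m \<zero>\<^bsub>R\<^esub>"
      using coset_gens[of "?e (a \<odot>\<^bsub>P\<^esub> m) \<one>\<^bsub>R\<^esub>" "?e m \<zero>\<^bsub>R\<^esub>"] aA m
      by (simp add: \<theta>_def tclass_def e_closed P.smult_closed del: free_lmodule_simps)
    also have "\<dots> = \<zero>\<^bsub>R\<^esub> \<odot>\<^bsub>T\<^esub> \<theta> m" using m by (simp add: tclass_eq \<theta>_smult)
    finally show ?thesis using T.smult_l_null[OF \<theta>_closed[OF m]] by simp
  qed
  ultimately have "\<theta> (x \<ominus>\<^bsub>P\<^esub> y) = \<zero>\<^bsub>T\<^esub>"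
    using P.ideal_smult_annihilate[OF K_closed _ _ xy] by blast
  then have "\<theta> x \<ominus>\<^bsub>T\<^esub> \<theta> y = \<zero>\<^bsub>T\<^esub>"
    using additive_diff[OF \<theta>_additive, of x y] assms by simp
  then show "\<theta> x = \<theta> y" using T.M.minus_eq_zero_iff assms \<theta>_closed by blast
qed

lemma \<theta>_eq_zero_iff: "x \<in> carrier P \<Longrightarrow> \<theta> x = \<zero>\<^bsub>T\<^esub> \<longleftrightarrow> x \<in> KP"
  using \<theta>_eq_iff[of x "\<zero>\<^bsub>P\<^esub>"] additive_zero[OF \<theta>_additive] by (simp add: P.M.minus_zero_right)

end

locale tensor_scalar_hom = P: tensor_scalar R A N \<chi> P + P': tensor_scalar R A N \<chi> P'
  for R :: "('r, 'e) ring_scheme" and A :: "('r, 'a, 'f) module_scheme"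
    and N :: "('a, 'r, 'h) module_scheme" and \<chi> :: "'a \<Rightarrow> 'r"
    and P :: "('a, 'p, 'g) module_scheme" and P' :: "('a, 'p2, 'g2) module_scheme" +
  fixes \<phi> :: "'p \<Rightarrow> 'p2"
  assumes \<phi>_hom: "\<phi> \<in> lmodule_hom (op_ring A) P P'"
begin

text \<open>The \<open>the_elem\<close> in \<open>tensor_map\<close> has a meaning only if all
  representatives of a coset are pushed into the same coset. The coset of \<open>f\<close> is
  determined by \<open>contract f\<close> modulo \<open>K P\<close>, and contraction commutes with
  \<phi>, so this comes down to \<phi> mapping \<open>K P\<close> into \<open>K P'\<close>.\<close>

lemma tensor_map_\<theta>:
  assumes x: "x \<in> carrier P"
  shows "tensor_map R A P P' N \<phi> (P.\<theta> x) = P'.\<theta> (\<phi> x)"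
proof -
  let ?v = "\<lambda>p. basis_elt R P'.X (\<phi> (fst p), snd p)"
  let ?push = "lin_ext R P.X P'.F ?v"
  have v: "?v \<in> P.X \<rightarrow> carrier P'.F"
    using lmodule_homD(1)[OF \<phi>_hom] P'.e_closed P.carrier_N by (auto simp del: free_lmodule_simps)
  note push = P'.F.lin_ext_hom[OF v]
  have contract: "P'.contract (?push f) = \<phi> (P.contract f)" if "f \<in> carrier P.F" for f
    using that
  proof (induction rule: P.R.free_lmodule_induct)
    case zero
    have "?push \<zero>\<^bsub>P.F\<^esub> = \<zero>\<^bsub>P'.F\<^esub>"
      by (rule additive_zero[OF additive_lmodule_hom[OF P.F.lmodule_axioms P'.F.lmodule_axioms push]])
    moreover have "P.contract \<zero>\<^bsub>P.F\<^esub> = \<zero>\<^bsub>P\<^esub>" "P'.contract \<zero>\<^bsub>P'.F\<^esub> = \<zero>\<^bsub>P'\<^esub>"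
      using additive_zero[OF P.contract_additive] additive_zero[OF P'.contract_additive] by simp_all
    moreover have "\<phi> \<zero>\<^bsub>P\<^esub> = \<zero>\<^bsub>P'\<^esub>"
      by (rule additive_zero[OF additive_lmodule_hom[OF P.lmodule_P P'.lmodule_P \<phi>_hom]])
    ultimately show ?case by metis
  next
    case (step f a x)
    obtain m n where mn: "x = (m, n)" "m \<in> carrier P" "n \<in> carrier R" using step P.carrier_N by auto
    have \<phi>m: "\<phi> m \<in> carrier P'" by (rule lmodule_homD(1)[OF \<phi>_hom mn(2)])
    have cf: "P.contract f \<in> carrier P" using lmodule_homD(1)[OF P.contract_hom step(1)] by simp
    note ua = P.unit_closed[OF step(2)] and un = P.unit_closed[OF mn(3)]
    note u = P.P.smult_closed[OF un mn(2)]
    note e = P.e_closed[OF mn(2,3)] and e' = P'.e_closed[OF \<phi>m mn(3)]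
    note ae = P.F.smult_closed[OF step(2) e] and ae' = P'.F.smult_closed[OF step(2) e']
    have c: "P.contract (f \<oplus>\<^bsub>P.F\<^esub> a \<odot>\<^bsub>P.F\<^esub> basis_elt R P.X x) =
        P.contract f \<oplus>\<^bsub>P\<^esub> P.unit a \<odot>\<^bsub>P\<^esub> (P.unit n \<odot>\<^bsub>P\<^esub> m)"
      using lmodule_homD(2)[OF P.contract_hom step(1) ae] lmodule_homD(3)[OF P.contract_hom step(2) e] mn
      by (simp add: P.contract_basis del: free_lmodule_simps)
    have ve: "?push (basis_elt R P.X x) = basis_elt R P'.X (\<phi> m, n)"
      using P'.F.lin_ext_basis[OF v step(3)] mn by simp
    have pf: "?push f \<in> carrier P'.F" by (rule lmodule_homD(1)[OF push step(1)])
    have "?push (f \<oplus>\<^bsub>P.F\<^esub> a \<odot>\<^bsub>P.F\<^esub> basis_elt R P.X x) =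
        ?push f \<oplus>\<^bsub>P'.F\<^esub> a \<odot>\<^bsub>P'.F\<^esub> basis_elt R P'.X (\<phi> m, n)"
      using lmodule_homD(2)[OF push step(1) ae] lmodule_homD(3)[OF push step(2) e] ve mn
      by (simp del: free_lmodule_simps)
    then have "P'.contract (?push (f \<oplus>\<^bsub>P.F\<^esub> a \<odot>\<^bsub>P.F\<^esub> basis_elt R P.X x)) =
        P'.contract (?push f) \<oplus>\<^bsub>P'\<^esub> P.unit a \<odot>\<^bsub>P'\<^esub> (P.unit n \<odot>\<^bsub>P'\<^esub> \<phi> m)"
      using lmodule_homD(2)[OF P'.contract_hom pf ae'] lmodule_homD(3)[OF P'.contract_hom step(2) e'] mn \<phi>m
      by (simp add: P'.contract_basis del: free_lmodule_simps)
    also have "\<dots> = \<phi> (P.contract f \<oplus>\<^bsub>P\<^esub> P.unit a \<odot>\<^bsub>P\<^esub> (P.unit n \<odot>\<^bsub>P\<^esub> m))"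
      unfolding lmodule_homD(2)[OF \<phi>_hom cf P.P.smult_closed[OF ua u]]
        lmodule_homD(3)[OF \<phi>_hom ua u] lmodule_homD(3)[OF \<phi>_hom un mn(2)] step(5) ..
    finally show ?case using c by metis
  qed
  have img: "P'.rel +>\<^bsub>P'.F\<^esub> ?push f = P'.\<theta> (\<phi> x)" if f: "f \<in> P.\<theta> x" for f
  proof -
    note ex = P.e_closed[OF x P.R.one_closed]
    obtain h where h: "h \<in> P.rel" "f = h \<oplus>\<^bsub>P.F\<^esub> basis_elt R P.X (x, \<one>\<^bsub>R\<^esub>)"
      using f unfolding P.\<theta>_def P.tclass_def a_r_coset_def' by blast
    have fc: "f \<in> carrier P.F"
      unfolding h(2) by (rule P.F.M.a_closed[OF P.F.submoduleD(1)[OF P.submodule_rel h(1)] ex])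
    have cf: "P.contract f \<in> carrier P" using lmodule_homD(1)[OF P.contract_hom fc] by simp
    have "P.rel +>\<^bsub>P.F\<^esub> f = P.\<theta> x"
      unfolding P.\<theta>_def P.tclass_def using P.F.coset_eq_iff[OF P.submodule_rel fc ex] h by blast
    then have "P.\<theta> (P.contract f) = P.\<theta> x" using P.coset_eq_\<theta>[OF fc] by simp
    then have "P.contract f \<ominus>\<^bsub>P\<^esub> x \<in> P.KP" using P.\<theta>_eq_iff[OF cf x] by blast
    then have "\<phi> (P.contract f \<ominus>\<^bsub>P\<^esub> x) \<in> P'.KP"
      by (rule P.P.ideal_smult_hom[OF P.K_closed P'.lmodule_P \<phi>_hom])
    then have "P'.\<theta> (\<phi> (P.contract f)) = P'.\<theta> (\<phi> x)"
      using additive_diff[OF additive_lmodule_hom[OF P.lmodule_P P'.lmodule_P \<phi>_hom] cf x]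
        P'.\<theta>_eq_iff[OF lmodule_homD(1)[OF \<phi>_hom cf] lmodule_homD(1)[OF \<phi>_hom x]] by simp
    then show ?thesis
      using P'.coset_eq_\<theta>[OF lmodule_homD(1)[OF push fc]] contract[OF fc] by metis
  qed
  have ne: "P.\<theta> x \<noteq> {}"
    using P.F.submoduleD(2)[OF P.submodule_rel] unfolding P.\<theta>_def P.tclass_def a_r_coset_def' by blast
  have "(\<lambda>f. P'.rel +>\<^bsub>P'.F\<^esub> ?push f) ` P.\<theta> x = {P'.\<theta> (\<phi> x)}"
    by (subst image_cong[OF refl img]) (use ne in auto)
  then show ?thesis
    unfolding tensor_map_def Let_def lin_ext_def[symmetric] by simp
qed

end

section \<open>Tor with coefficients in a scalar module\<close>

text \<open>\<open>Tor\<close> is a subquotient of the resolution itself: no tensor products are left.\<close>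

locale tor_scalar = augmented_algebra R A N \<chi> + resolution "op_ring A" M P d \<epsilon>
  for R :: "('r, 'e) ring_scheme" and A :: "('r, 'a, 'f) module_scheme"
    and N :: "('a, 'r, 'h) module_scheme" and \<chi> :: "'a \<Rightarrow> 'r"
    and M :: "('a, 'm, 'l) module_scheme"
    and P :: "nat \<Rightarrow> ('a, 'p) module" and d :: "nat \<Rightarrow> 'p \<Rightarrow> 'p" and \<epsilon> :: "'p \<Rightarrow> 'm"
begin

sublocale T: tensor_scalar R A N \<chi> "P k" for k
  by (intro tensor_scalar.intro tensor_scalar_axioms.intro augmented_algebra_axioms lmodule_P)

text \<open>Representatives in \<open>P\<close> of the cycles of \<open>P / K P\<close>; the
  differential need only send them into \<open>K P\<close>.\<close>

definition rel_cycles :: "nat \<Rightarrow> 'p set" where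
  "rel_cycles k = {x \<in> carrier (P k). case k of 0 \<Rightarrow> True | Suc j \<Rightarrow> d j x \<in> T.KP j}"

abbreviation "b k \<equiv> tensor_map R A (P (Suc k)) (P k) N (d k)"

lemma b_\<theta>: "x \<in> carrier (P (Suc k)) \<Longrightarrow> b k (T.\<theta> (Suc k) x) = T.\<theta> k (d k x)"
proof -
  interpret tensor_scalar_hom R A N \<chi> "P (Suc k)" "P k" "d k"
    by (intro tensor_scalar_hom.intro T.tensor_scalar_axioms tensor_scalar_hom_axioms.intro d_hom)
  show "x \<in> carrier (P (Suc k)) \<Longrightarrow> ?thesis" by (rule tensor_map_\<theta>)
qed

lemma b_hom: "b k \<in> lmodule_hom R (T.T (Suc k)) (T.T k)"
proof (rule lmodule_homI)
  fix x assume "x \<in> carrier (T.T (Suc k))"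
  then obtain u where u: "u \<in> carrier (P (Suc k))" "x = T.\<theta> (Suc k) u"
    unfolding T.\<theta>_image by blast
  note du = lmodule_homD(1)[OF d_hom u(1)]
  show "b k x \<in> carrier (T.T k)" unfolding u(2) b_\<theta>[OF u(1)] by (rule T.\<theta>_closed[OF du])
  show "b k (r \<odot>\<^bsub>T.T (Suc k)\<^esub> x) = r \<odot>\<^bsub>T.T k\<^esub> b k x" if r: "r \<in> carrier R" for r
    unfolding u(2) T.\<theta>_smult[OF r u(1), symmetric] b_\<theta>[OF u(1)]
      b_\<theta>[OF T.P.smult_closed[OF T.unit_closed[OF r] u(1)]]
      lmodule_homD(3)[OF d_hom T.unit_closed[OF r] u(1)] by (rule T.\<theta>_smult[OF r du])
  fix y assume "y \<in> carrier (T.T (Suc k))"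
  then obtain v where v: "v \<in> carrier (P (Suc k))" "y = T.\<theta> (Suc k) v"
    unfolding T.\<theta>_image by blast
  show "b k (x \<oplus>\<^bsub>T.T (Suc k)\<^esub> y) = b k x \<oplus>\<^bsub>T.T k\<^esub> b k y"
    unfolding u(2) v(2) T.\<theta>_add[OF u(1) v(1), symmetric] b_\<theta>[OF u(1)] b_\<theta>[OF v(1)]
      b_\<theta>[OF T.P.M.a_closed[OF u(1) v(1)]] lmodule_homD(2)[OF d_hom u(1) v(1)]
    by (rule T.\<theta>_add[OF du lmodule_homD(1)[OF d_hom v(1)]])
qed

lemma cycles_eq: "cycles T.T b k = T.\<theta> k ` rel_cycles k"
proof (cases k)
  case 0 then show ?thesis by (simp add: rel_cycles_def T.\<theta>_image)
next
  case (Suc j)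
  have "b j (T.\<theta> (Suc j) x) = \<zero>\<^bsub>T.T j\<^esub> \<longleftrightarrow> d j x \<in> T.KP j" if "x \<in> carrier (P (Suc j))" for x
    using that T.\<theta>_eq_zero_iff[OF lmodule_homD(1)[OF d_hom that]] b_\<theta>[OF that] by simp
  then show ?thesis
    by (auto simp: Suc rel_cycles_def a_kernel_def kernel_def T.\<theta>_image)
qed

lemma submodule_cycles: "submodule (cycles T.T b k) R (T.T k)"
proof (cases k)
  case 0 then show ?thesis by (simp add: T.T.submodule_iff T.T.smult_closed)
next
  case (Suc j)
  show ?thesis
    using submodule_vimage[OF T.lmodule_T T.lmodule_T b_hom T.T.submodule_zero, of j]
    by (simp add: Suc a_kernel_def kernel_def)
qed

lemma rel_cycles_add:
  "\<lbrakk>x \<in> rel_cycles k; y \<in> rel_cycles k\<rbrakk> \<Longrightarrow> x \<oplus>\<^bsub>P k\<^esub> y \<in> rel_cycles k"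
  using T.P.ideal_smult_add[OF T.K_closed] lmodule_homD(2)[OF d_hom]
  by (cases k) (simp_all add: rel_cycles_def)

lemma rel_cycles_smult:
  "\<lbrakk>r \<in> carrier R; x \<in> rel_cycles k\<rbrakk> \<Longrightarrow> unit r \<odot>\<^bsub>P k\<^esub> x \<in> rel_cycles k"
  using T.P.submoduleD(4)[OF T.submodule_KP] lmodule_homD(3)[OF d_hom] T.unit_closed T.P.smult_closed
  by (cases k) (simp_all add: rel_cycles_def)

text \<open>This is all that is used about \<open>Tor\<close> afterwards: a surjection from the
  relative cycles whose fibres are described inside \<open>P\<close>, namely congruence modulo
  boundaries and \<open>K P\<close>. It replaces sets of cosets of functions by elements of the
  resolution.\<close>

lemma Tor_presentation:
  "\<exists>\<alpha>. \<alpha> ` rel_cycles k = carrier (Tor R A P d N k) \<and>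
     (\<forall>x\<in>rel_cycles k. \<forall>y\<in>rel_cycles k. \<alpha> (x \<oplus>\<^bsub>P k\<^esub> y) = \<alpha> x \<oplus>\<^bsub>Tor R A P d N k\<^esub> \<alpha> y) \<and>
     (\<forall>r\<in>carrier R. \<forall>x\<in>rel_cycles k. \<alpha> (unit r \<odot>\<^bsub>P k\<^esub> x) = r \<odot>\<^bsub>Tor R A P d N k\<^esub> \<alpha> x) \<and>
     (\<forall>x\<in>rel_cycles k. \<forall>y\<in>rel_cycles k. \<alpha> x = \<alpha> y \<longleftrightarrow>
        (\<exists>w\<in>carrier (P (Suc k)). x \<ominus>\<^bsub>P k\<^esub> (d k w \<oplus>\<^bsub>P k\<^esub> y) \<in> T.KP k))"
proof -
  let ?cyc = "cycles T.T b k" and ?S = "b k ` carrier (T.T (Suc k))"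
  let ?Z = "(T.T k)\<lparr>carrier := ?cyc\<rparr>"
  have S: "submodule ?S R (T.T k)"
    by (rule submodule_image[OF T.lmodule_T T.lmodule_T b_hom])
      (simp add: T.T.submodule_iff T.T.smult_closed)
  have S\<theta>: "?S = (\<lambda>w. T.\<theta> k (d k w)) ` carrier (P (Suc k))"
    unfolding T.\<theta>_image image_image using b_\<theta> by (intro image_cong) auto
  have "d k w \<in> rel_cycles k" if "w \<in> carrier (P (Suc k))" for w
    using lmodule_homD(1)[OF d_hom that] is_cycle_d[OF that]
    by (cases k) (simp_all add: rel_cycles_def ideal_smult.zero)
  then have sub: "?S \<subseteq> ?cyc" unfolding S\<theta> cycles_eq by blast
  interpret Z: lmodule R ?Z by (rule T.T.lmodule_submodule[OF submodule_cycles])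
  have SZ: "submodule ?S R ?Z" by (rule T.T.submodule_restrict_carrier[OF S submodule_cycles sub])
  have H: "Tor R A P d N k = quot_lmodule ?Z ?S" by (simp add: Tor_def homology_def)
  have in_cyc: "T.\<theta> k x \<in> carrier ?Z" if "x \<in> rel_cycles k" for x
    using that by (simp add: cycles_eq)
  have car: "x \<in> carrier (P k)" if "x \<in> rel_cycles k" for x using that by (simp add: rel_cycles_def)
  define \<alpha> where "\<alpha> x = ?S +>\<^bsub>?Z\<^esub> T.\<theta> k x" for x
  have 1: "\<alpha> ` rel_cycles k = carrier (Tor R A P d N k)"
    unfolding H Z.carrier_quot_lmodule[OF SZ] by (simp add: cycles_eq image_image \<alpha>_def)
  have 2: "\<alpha> (x \<oplus>\<^bsub>P k\<^esub> y) = \<alpha> x \<oplus>\<^bsub>Tor R A P d N k\<^esub> \<alpha> y"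
    if "x \<in> rel_cycles k" "y \<in> rel_cycles k" for x y
    unfolding H \<alpha>_def Z.add_quot_lmodule[OF SZ in_cyc[OF that(1)] in_cyc[OF that(2)]]
      T.\<theta>_add[OF car[OF that(1)] car[OF that(2)]] by simp
  have 3: "\<alpha> (unit r \<odot>\<^bsub>P k\<^esub> x) = r \<odot>\<^bsub>Tor R A P d N k\<^esub> \<alpha> x"
    if "r \<in> carrier R" "x \<in> rel_cycles k" for r x
    unfolding H \<alpha>_def Z.smult_quot_lmodule[OF SZ that(1) in_cyc[OF that(2)]]
      T.\<theta>_smult[OF that(1) car[OF that(2)]] by simp
  have 4: "\<alpha> x = \<alpha> y \<longleftrightarrow>
        (\<exists>w\<in>carrier (P (Suc k)). x \<ominus>\<^bsub>P k\<^esub> (d k w \<oplus>\<^bsub>P k\<^esub> y) \<in> T.KP k)"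
    if x: "x \<in> rel_cycles k" and y: "y \<in> rel_cycles k" for x y
  proof -
    have "\<alpha> x = \<alpha> y \<longleftrightarrow> (\<exists>w\<in>carrier (P (Suc k)). T.\<theta> k x = T.\<theta> k (d k w) \<oplus>\<^bsub>T.T k\<^esub> T.\<theta> k y)"
      unfolding \<alpha>_def Z.coset_eq_iff[OF SZ in_cyc[OF x] in_cyc[OF y]] by (simp add: S\<theta>)
    moreover have "T.\<theta> k x = T.\<theta> k (d k w) \<oplus>\<^bsub>T.T k\<^esub> T.\<theta> k y \<longleftrightarrow>
        x \<ominus>\<^bsub>P k\<^esub> (d k w \<oplus>\<^bsub>P k\<^esub> y) \<in> T.KP k" if "w \<in> carrier (P (Suc k))" for w
    proof -
      note dw = lmodule_homD(1)[OF d_hom that]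
      show ?thesis
        unfolding T.\<theta>_add[OF dw car[OF y], symmetric]
        by (rule T.\<theta>_eq_iff[OF car[OF x] T.P.M.a_closed[OF dw car[OF y]]])
    qed
    ultimately show ?thesis by blast
  qed
  show ?thesis
    by (intro exI[of _ \<alpha>] conjI ballI) (rule 1 2 3 4; assumption)+
qed

end

text \<open>Two surjections out of \<open>Z\<close> with the same fibres identify their targets.
  \<open>Z\<close> carries only the operations \<open>p\<close> and \<open>s\<close>, so relative
  cycles need no module record of their own; the choice by \<open>SOME\<close> is harmless because
  \<beta> is constant on the fibres of \<alpha>.\<close>

lemma lmodule_isomorphic_presentationI:
  assumes \<alpha>: "\<alpha> ` Z = carrier H"
    and add: "\<And>x y. \<lbrakk>x \<in> Z; y \<in> Z\<rbrakk> \<Longrightarrow> p x y \<in> Z \<and> \<alpha> (p x y) = \<alpha> x \<oplus>\<^bsub>H\<^esub> \<alpha> y"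
    and smult: "\<And>r x. \<lbrakk>r \<in> carrier R; x \<in> Z\<rbrakk> \<Longrightarrow> s r x \<in> Z \<and> \<alpha> (s r x) = r \<odot>\<^bsub>H\<^esub> \<alpha> x"
    and \<beta>: "\<And>x. x \<in> Z \<Longrightarrow> \<beta> x \<in> carrier H'"
    and \<beta>_add: "\<And>x y. \<lbrakk>x \<in> Z; y \<in> Z\<rbrakk> \<Longrightarrow> \<beta> (p x y) = \<beta> x \<oplus>\<^bsub>H'\<^esub> \<beta> y"
    and \<beta>_smult: "\<And>r x. \<lbrakk>r \<in> carrier R; x \<in> Z\<rbrakk> \<Longrightarrow> \<beta> (s r x) = r \<odot>\<^bsub>H'\<^esub> \<beta> x"
    and iff: "\<And>x y. \<lbrakk>x \<in> Z; y \<in> Z\<rbrakk> \<Longrightarrow> \<alpha> x = \<alpha> y \<longleftrightarrow> \<beta> x = \<beta> y"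
    and surj: "\<And>t. t \<in> carrier H' \<Longrightarrow> \<exists>x\<in>Z. \<beta> x = t"
  shows "lmodule_isomorphic R H H'"
proof -
  define h where "h t = \<beta> (SOME x. x \<in> Z \<and> \<alpha> x = t)" for t
  have h: "h (\<alpha> x) = \<beta> x" if "x \<in> Z" for x
    unfolding h_def using someI[of "\<lambda>y. y \<in> Z \<and> \<alpha> y = \<alpha> x" x] iff that by blast
  have "h \<in> lmodule_hom R H H'"
  proof (rule lmodule_homI; unfold \<alpha>[symmetric])
    fix t assume "t \<in> \<alpha> ` Z"
    then obtain x where x: "x \<in> Z" "t = \<alpha> x" by blast
    show "h t \<in> carrier H'" using h \<beta> x by simp
    show "h (r \<odot>\<^bsub>H\<^esub> t) = r \<odot>\<^bsub>H'\<^esub> h t" if "r \<in> carrier R" for r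
      using smult[OF that x(1)] h \<beta>_smult[OF that x(1)] x by metis
    fix u assume "u \<in> \<alpha> ` Z"
    then obtain y where y: "y \<in> Z" "u = \<alpha> y" by blast
    show "h (t \<oplus>\<^bsub>H\<^esub> u) = h t \<oplus>\<^bsub>H'\<^esub> h u"
      using add[OF x(1) y(1)] h \<beta>_add[OF x(1) y(1)] x y by metis
  qed
  moreover have "bij_betw h (carrier H) (carrier H')"
    unfolding bij_betw_def \<alpha>[symmetric]
  proof
    show "inj_on h (\<alpha> ` Z)" unfolding inj_on_def using h iff by (metis imageE)
    have "h ` \<alpha> ` Z = \<beta> ` Z" unfolding image_image using h by (rule image_cong[OF refl])
    also have "\<dots> = carrier H'" using \<beta> surj by (metis image_subsetI subsetI subset_antisym imageI)
    finally show "h ` \<alpha> ` Z = carrier H'" .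
  qed
  ultimately show ?thesis by (auto simp: lmodule_isomorphic_def)
qed

section \<open>Invariance of Tor under a split surjection of algebras\<close>

text \<open>Exactness modulo \<open>N\<close> speaks only of carriers, addition and the maps, so it
  survives a change of rings.\<close>

lemma exact_mod_restrict_scalars:
  assumes ex: "exact_mod A M E N \<delta> \<eta>" and \<phi>: "\<phi> \<in> ring_hom B A" and M': "lmodule B M'"
    and eq: "carrier M' = carrier M" "zero M' = zero M" "add M' = add M"
    and act: "\<And>b m. \<lbrakk>b \<in> carrier B; m \<in> carrier M\<rbrakk> \<Longrightarrow> b \<odot>\<^bsub>M'\<^esub> m = \<phi> b \<odot>\<^bsub>M\<^esub> m"
  shows "exact_mod B M' (\<lambda>k. restrict_scalars \<phi> (E k)) N \<delta> \<eta>"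
proof -
  interpret exact_mod A M E N \<delta> \<eta> by fact
  have B: "ring B" using M' by (rule lmodule_ring)
  have mod: "lmodule B (restrict_scalars \<phi> (E k))" for k
    by (rule lmodule_restrict_scalars[OF lmodule_E B \<phi>])
  show ?thesis
  proof (rule exact_mod.intro[OF M' mod])
    fix k
    show "submodule (N k) B (restrict_scalars \<phi> (E k))"
      using submodule_N[of k] ring_hom_closed[OF \<phi>]
      by (simp add: lmodule.submodule_iff[OF mod] lmodule.submodule_iff[OF lmodule_E])
    show "\<delta> k \<in> lmodule_hom B (restrict_scalars \<phi> (E (Suc k))) (restrict_scalars \<phi> (E k))"
      using lmodule_homD[OF \<delta>_hom] ring_hom_closed[OF \<phi>] by (intro lmodule_homI) simp_all
    show "\<eta> \<in> lmodule_hom B (restrict_scalars \<phi> (E 0)) M'"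
      using lmodule_homD[OF \<eta>_hom] ring_hom_closed[OF \<phi>] by (intro lmodule_homI) (simp_all add: eq act)
  qed (use \<eta>_surj mod_exact_0 mod_exact_Suc in \<open>simp_all add: eq\<close>)
qed

text \<open>The abstract form of the projection from the Brauer algebra to the group algebra, with
  kernel \<open>I\<close> and section \<iota>. The section makes \<open>P\<close> itself a complex
  over \<open>A'\<close>, so that the \<open>A'\<close>-complex \<open>P / I P\<close> can be
  handled on \<open>P\<close> modulo \<open>I P\<close>.\<close>

locale tor_comparison =
  S: tor_scalar R A N \<chi> N P d \<epsilon> + S': tor_scalar R A' N' \<chi>' N' Q d' \<epsilon>'
  for R :: "('r, 'e) ring_scheme" and A :: "('r, 'a, 'f) module_scheme"
    and N :: "('a, 'r, 'h) module_scheme" and \<chi> :: "'a \<Rightarrow> 'r"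
    and P :: "nat \<Rightarrow> ('a, 'p) module" and d :: "nat \<Rightarrow> 'p \<Rightarrow> 'p" and \<epsilon> :: "'p \<Rightarrow> 'r"
    and A' :: "('r, 'b, 'f2) module_scheme"
    and N' :: "('b, 'r, 'h2) module_scheme" and \<chi>' :: "'b \<Rightarrow> 'r"
    and Q :: "nat \<Rightarrow> ('b, 'q) module" and d' :: "nat \<Rightarrow> 'q \<Rightarrow> 'q" and \<epsilon>' :: "'q \<Rightarrow> 'r" +
  fixes \<rho> :: "'a \<Rightarrow> 'b" and \<iota> :: "'b \<Rightarrow> 'a" and I :: "'a set"
  assumes zero_N: "zero N = zero R" and zero_N': "zero N' = zero R"
    and \<rho>_hom: "\<rho> \<in> ring_hom (op_ring A) (op_ring A')" and \<iota>_hom: "\<iota> \<in> ring_hom (op_ring A') (op_ring A)"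
    and \<rho>_\<iota>: "\<And>b. b \<in> carrier A' \<Longrightarrow> \<rho> (\<iota> b) = b"
    and \<rho>_unit: "\<And>r. r \<in> carrier R \<Longrightarrow> \<rho> (r \<odot>\<^bsub>A\<^esub> \<one>\<^bsub>A\<^esub>) = r \<odot>\<^bsub>A'\<^esub> \<one>\<^bsub>A'\<^esub>"
    and \<chi>'_\<rho>: "\<And>a. a \<in> carrier A \<Longrightarrow> \<chi>' (\<rho> a) = \<chi> a"
    and \<chi>_\<iota>: "\<And>b. b \<in> carrier A' \<Longrightarrow> \<chi> (\<iota> b) = \<chi>' b"
    and I: "right_ideal (op_ring A) I"
    and I_left: "\<And>a c. \<lbrakk>a \<in> I; c \<in> carrier (op_ring A)\<rbrakk> \<Longrightarrow> c \<otimes>\<^bsub>op_ring A\<^esub> a \<in> I"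
    and \<rho>_I: "\<And>a. a \<in> I \<Longrightarrow> \<rho> a = \<zero>\<^bsub>A'\<^esub>"
    and \<iota>_\<rho>: "\<And>a. a \<in> carrier A \<Longrightarrow> a \<ominus>\<^bsub>op_ring A\<^esub> \<iota> (\<rho> a) \<in> I"
    and acyclic_I: "S.acyclic_ideal I"
begin

lemma I_closed: "I \<subseteq> carrier (op_ring A)"
  using I by (simp add: right_ideal_def)

lemma \<chi>_I: "a \<in> I \<Longrightarrow> \<chi> a = \<zero>\<^bsub>R\<^esub>"
proof -
  assume a: "a \<in> I"
  have "additive (op_ring A') R \<chi>'"
    using S'.T.P.A.abelian_group_axioms S.R.abelian_group_axioms ring_hom_closed[OF S'.\<chi>_hom]
      ring_hom_add[OF S'.\<chi>_hom] by (auto simp: additive_def)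
  from additive_zero[OF this] have "\<chi>' \<zero>\<^bsub>A'\<^esub> = \<zero>\<^bsub>R\<^esub>" by simp
  then show "\<chi> a = \<zero>\<^bsub>R\<^esub>" using \<chi>'_\<rho>[of a] \<rho>_I[OF a] I_closed a by auto
qed

lemma I_K: "I \<subseteq> S.augmentation_ideal"
  using \<chi>_I I_closed by (auto simp: S.augmentation_ideal_def)

sublocale E: exact_mod "op_ring A" N P "\<lambda>k. ideal_smult (P k) I" d \<epsilon>
proof (rule S.exact_mod_ideal_smult[OF I I_left _ acyclic_I])
  fix a m assume "a \<in> I" "m \<in> carrier N"
  then show "a \<odot>\<^bsub>N\<^esub> m = \<zero>\<^bsub>N\<^esub>"
    using S.smult_N[of a m] I_closed \<chi>_I by (auto simp: zero_N S.carrier_N)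
qed

text \<open>\<open>C\<close> and \<open>C'\<close> supply the comparison maps in the two directions;
  \<open>D\<close> and \<open>D'\<close> supply the homotopies from their composites to the
  identities.\<close>

sublocale C: comparison "op_ring A" N P d \<epsilon> "\<lambda>k. restrict_scalars \<rho> (Q k)" "\<lambda>k. {\<zero>\<^bsub>Q k\<^esub>}" d' \<epsilon>'
proof (intro comparison.intro S.resolution_axioms)
  show "exact_mod (op_ring A) N (\<lambda>k. restrict_scalars \<rho> (Q k)) (\<lambda>k. {\<zero>\<^bsub>Q k\<^esub>}) d' \<epsilon>'"
    by (rule exact_mod_restrict_scalars[OF S'.exact_mod_axioms \<rho>_hom S.lmodule_M])
      (use ring_hom_closed[OF \<rho>_hom] in \<open>simp_all add: S.carrier_N S'.carrier_N S.add_N S'.add_N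
        zero_N zero_N' S.smult_N S'.smult_N \<chi>'_\<rho>\<close>)
qed

sublocale C': comparison "op_ring A'" N' Q d' \<epsilon>' "\<lambda>k. restrict_scalars \<iota> (P k)"
  "\<lambda>k. ideal_smult (P k) I" d \<epsilon>
proof (intro comparison.intro S'.resolution_axioms)
  show "exact_mod (op_ring A') N' (\<lambda>k. restrict_scalars \<iota> (P k)) (\<lambda>k. ideal_smult (P k) I) d \<epsilon>"
    by (rule exact_mod_restrict_scalars[OF E.exact_mod_axioms \<iota>_hom S'.lmodule_M])
      (use ring_hom_closed[OF \<iota>_hom] in \<open>simp_all add: S.carrier_N S'.carrier_N S.add_N S'.add_N
        zero_N zero_N' S.smult_N S'.smult_N \<chi>_\<iota>\<close>)
qed

sublocale D: comparison "op_ring A" N P d \<epsilon> P "\<lambda>k. ideal_smult (P k) I" d \<epsilon>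
  by (intro comparison.intro S.resolution_axioms E.exact_mod_axioms)

sublocale D': comparison "op_ring A'" N' Q d' \<epsilon>' Q "\<lambda>k. {\<zero>\<^bsub>Q k\<^esub>}" d' \<epsilon>'
  by (intro comparison.intro S'.resolution_axioms S'.exact_mod_axioms)

lemma Tor_isomorphic: "lmodule_isomorphic R (Tor R A P d N k) (Tor R A' Q d' N' k)"
proof -
  obtain f where f_hom: "\<And>k. f k \<in> lmodule_hom (op_ring A) (P k) (restrict_scalars \<rho> (Q k))"
    and \<epsilon>f: "\<And>x. x \<in> carrier (P 0) \<Longrightarrow> \<epsilon>' (f 0 x) = \<epsilon> x"
    and fd0: "\<And>k x. x \<in> carrier (P (Suc k)) \<Longrightarrow> f k (d k x) \<ominus>\<^bsub>Q k\<^esub> d' k (f (Suc k) x) \<in> {\<zero>\<^bsub>Q k\<^esub>}"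
    using C.chain_map_exists unfolding restrict_scalars_minus by blast
  obtain g where g_hom: "\<And>k. g k \<in> lmodule_hom (op_ring A') (Q k) (restrict_scalars \<iota> (P k))"
    and \<epsilon>g: "\<And>y. y \<in> carrier (Q 0) \<Longrightarrow> \<epsilon> (g 0 y) = \<epsilon>' y"
    and gd: "\<And>k y. y \<in> carrier (Q (Suc k)) \<Longrightarrow>
      g k (d' k y) \<ominus>\<^bsub>P k\<^esub> d k (g (Suc k) y) \<in> ideal_smult (P k) I"
    using C'.chain_map_exists unfolding restrict_scalars_minus restrict_scalars_simps by blast
  note groups = S.T.P.M.abelian_group_axioms S'.T.P.M.abelian_group_axioms
  have f_add: "additive (P k) (Q k) (f k)" for k
    using lmodule_homD(1,2)[OF f_hom] groups by (simp add: additive_def)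
  have g_add: "additive (Q k) (P k) (g k)" for k
    using lmodule_homD(1,2)[OF g_hom] groups by (simp add: additive_def)
  note fc = additive_closed[OF f_add] and gc = additive_closed[OF g_add]
  have f_smult: "f k (a \<odot>\<^bsub>P k\<^esub> x) = \<rho> a \<odot>\<^bsub>Q k\<^esub> f k x" if "a \<in> carrier A" "x \<in> carrier (P k)" for k a x
    using lmodule_homD(3)[OF f_hom, of a x k] that by simp
  have g_smult: "g k (b \<odot>\<^bsub>Q k\<^esub> y) = \<iota> b \<odot>\<^bsub>P k\<^esub> g k y" if "b \<in> carrier A'" "y \<in> carrier (Q k)" for k b y
    using lmodule_homD(3)[OF g_hom, of b y k] that by simp
  have \<rho>c: "\<rho> a \<in> carrier (op_ring A')" if "a \<in> carrier A" for a
    using ring_hom_closed[OF \<rho>_hom, of a] that by simp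
  have \<iota>c: "\<iota> b \<in> carrier (op_ring A)" if "b \<in> carrier A'" for b
    using ring_hom_closed[OF \<iota>_hom, of b] that by simp
  note dc = lmodule_homD(1)[OF S.d_hom] and d'c = lmodule_homD(1)[OF S'.d_hom]
  have fd: "f k (d k x) = d' k (f (Suc k) x)" if "x \<in> carrier (P (Suc k))" for k x
    using fd0[OF that] S'.T.P.M.minus_eq_zero_iff[OF fc[OF dc[OF that]] d'c[OF fc[OF that]]] by simp
  \<comment> \<open>Elements of \<open>I\<close> act on \<open>Q\<close> through \<rho>, hence by 0.
    So every defect of \<open>g\<close> modulo \<open>I P\<close> disappears after applying
    \<open>f\<close>.\<close>
  have f_I: "f k x = \<zero>\<^bsub>Q k\<^esub>" if "x \<in> ideal_smult (P k) I" for k x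
  proof (rule S.T.P.ideal_smult_annihilate[OF I_closed f_add _ that])
    fix a x assume "a \<in> I" "x \<in> carrier (P k)"
    then show "f k (a \<odot>\<^bsub>P k\<^esub> x) = \<zero>\<^bsub>Q k\<^esub>"
      using f_smult[of a x k] I_closed \<rho>_I S'.T.P.smult_l_null[OF fc] by auto
  qed
  have f_K: "f k x \<in> S'.T.KP k" if "x \<in> S.T.KP k" for k x
  proof (rule S.T.P.ideal_smult_image[OF S.T.K_closed f_add S'.T.lmodule_P S'.T.K_closed _ that])
    fix a x assume a: "a \<in> S.augmentation_ideal" and x: "x \<in> carrier (P k)"
    have "\<rho> a \<in> S'.augmentation_ideal"
      using a \<rho>c[of a] \<chi>'_\<rho>[of a] by (simp add: S.augmentation_ideal_def S'.augmentation_ideal_def)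
    then show "f k (a \<odot>\<^bsub>P k\<^esub> x) \<in> S'.T.KP k"
      using S'.T.P.ideal_smult_smult[OF S'.T.K_closed _ fc[OF x]] f_smult[of a x k] a x
      by (simp add: S.augmentation_ideal_def)
  qed
  have g_K: "g k y \<in> S.T.KP k" if "y \<in> S'.T.KP k" for k y
  proof (rule S'.T.P.ideal_smult_image[OF S'.T.K_closed g_add S.T.lmodule_P S.T.K_closed _ that])
    fix b y assume b: "b \<in> S'.augmentation_ideal" and y: "y \<in> carrier (Q k)"
    have "\<iota> b \<in> S.augmentation_ideal"
      using b \<iota>c[of b] \<chi>_\<iota>[of b] by (simp add: S.augmentation_ideal_def S'.augmentation_ideal_def)
    then show "g k (b \<odot>\<^bsub>Q k\<^esub> y) \<in> S.T.KP k"
      using S.T.P.ideal_smult_smult[OF S.T.K_closed _ gc[OF y]] g_smult[of b y k] b y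
      by (simp add: S'.augmentation_ideal_def)
  qed
  have I_KP: "x \<in> S.T.KP k" if "x \<in> ideal_smult (P k) I" for k x
    by (rule ideal_smult_mono[OF that I_K])
  have \<epsilon>_add: "additive (P 0) N \<epsilon>" "additive (Q 0) N' \<epsilon>'"
    by (rule S.additive_\<epsilon>, rule S'.additive_\<epsilon>)
  interpret N: lmodule "op_ring A" N by (rule S.lmodule_M)
  interpret N': lmodule "op_ring A'" N' by (rule S'.lmodule_M)

  text \<open>\<open>g \<circ> f\<close> is homotopic to the identity modulo \<open>I P\<close>, and \<open>f \<circ> g\<close> to the identity.\<close>
  define h where "h k x = x \<ominus>\<^bsub>P k\<^esub> g k (f k x)" for k x
  define h' where "h' k y = y \<ominus>\<^bsub>Q k\<^esub> f k (g k y)" for k y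
  have h_add: "additive (P k) (P k) (h k)" for k
    unfolding h_def[abs_def]
    by (rule additive_minus[OF additive_id[OF groups(1)] additive_comp[OF f_add g_add]])
  have h'_add: "additive (Q k) (Q k) (h' k)" for k
    unfolding h'_def[abs_def]
    by (rule additive_minus[OF additive_id[OF groups(2)] additive_comp[OF g_add f_add]])
  have "\<exists>s. (\<forall>k. s k \<in> lmodule_hom (op_ring A) (P k) (P (Suc k))) \<and>
    (\<forall>x\<in>carrier (P 0). h 0 x \<ominus>\<^bsub>P 0\<^esub> d 0 (s 0 x) \<in> ideal_smult (P 0) I) \<and>
    (\<forall>k. \<forall>x\<in>carrier (P (Suc k)). (h (Suc k) x \<ominus>\<^bsub>P (Suc k)\<^esub> s k (d k x))
       \<ominus>\<^bsub>P (Suc k)\<^esub> d (Suc k) (s (Suc k) x) \<in> ideal_smult (P (Suc k)) I)"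
  proof (rule D.homotopy_exists[OF h_add])
    fix k a x assume a: "a \<in> carrier (op_ring A)" and x: "x \<in> carrier (P k)"
    then have aA: "a \<in> carrier A" by simp
    let ?y = "g k (f k x)"
    have y: "?y \<in> carrier (P k)" by (rule gc[OF fc[OF x]])
    note \<iota>\<rho> = \<iota>c[OF \<rho>c[OF aA, simplified]]
    note ax = S.T.P.smult_closed[OF a x] and ay = S.T.P.smult_closed[OF a y]
      and ry = S.T.P.smult_closed[OF \<iota>\<rho> y]
    \<comment> \<open>Passing through \<open>Q\<close> replaces the action of \<open>a\<close> by
      that of \<open>\<iota> (\<rho> a)\<close>. The two differ by an element of \<open>I\<close>,
      so \<open>h\<close> is linear modulo \<open>I P\<close>.\<close>
    have "g k (f k (a \<odot>\<^bsub>P k\<^esub> x)) = \<iota> (\<rho> a) \<odot>\<^bsub>P k\<^esub> ?y"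
      using f_smult[OF aA x] g_smult[OF \<rho>c[OF aA, simplified] fc[OF x]] by simp
    then have "h k (a \<odot>\<^bsub>P k\<^esub> x) \<ominus>\<^bsub>P k\<^esub> a \<odot>\<^bsub>P k\<^esub> h k x =
      \<ominus>\<^bsub>P k\<^esub> (\<iota> (\<rho> a) \<odot>\<^bsub>P k\<^esub> ?y \<ominus>\<^bsub>P k\<^esub> a \<odot>\<^bsub>P k\<^esub> ?y)"
      unfolding h_def S.T.P.smult_r_diff[OF a x y]
      using ax ay ry by (simp add: S.T.P.M.minus_minus_swap S.T.P.M.self_minus)
        (simp add: a_minus_def)
    also have "\<dots> = (a \<ominus>\<^bsub>op_ring A\<^esub> \<iota> (\<rho> a)) \<odot>\<^bsub>P k\<^esub> ?y"
      unfolding S.T.P.smult_l_diff[OF a \<iota>\<rho> y] by (rule S.T.P.M.inv_minus[OF ry ay])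
    also have "\<dots> \<in> ideal_smult (P k) I"
      by (rule S.T.P.ideal_smult_smult[OF I_closed \<iota>_\<rho>[OF aA] y])
    finally show "h k (a \<odot>\<^bsub>P k\<^esub> x) \<ominus>\<^bsub>P k\<^esub> a \<odot>\<^bsub>P k\<^esub> h k x \<in> ideal_smult (P k) I" .
  next
    fix x assume x: "x \<in> carrier (P 0)"
    show "\<epsilon> (h 0 x) = \<zero>\<^bsub>N\<^esub>"
      unfolding h_def additive_diff[OF \<epsilon>_add(1) x gc[OF fc[OF x]]] \<epsilon>g[OF fc[OF x]] \<epsilon>f[OF x]
      by (rule N.M.self_minus[OF additive_closed[OF \<epsilon>_add(1) x]])
  next
    fix k x assume x: "x \<in> carrier (P (Suc k))"
    note fx = fc[OF x] and dx = dc[OF x]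
    note gf = gc[OF fx] and dgf = dc[OF gc[OF fx]] and gdf = gc[OF d'c[OF fx]]
    have "h k (d k x) \<ominus>\<^bsub>P k\<^esub> d k (h (Suc k) x) =
        \<ominus>\<^bsub>P k\<^esub> (g k (d' k (f (Suc k) x)) \<ominus>\<^bsub>P k\<^esub> d k (g (Suc k) (f (Suc k) x)))"
      unfolding h_def additive_diff[OF S.additive_d x gf] fd[OF x]
      using dx dgf gdf by (simp add: S.T.P.M.minus_minus_swap S.T.P.M.self_minus) (simp add: a_minus_def)
    then show "h k (d k x) \<ominus>\<^bsub>P k\<^esub> d k (h (Suc k) x) \<in> ideal_smult (P k) I"
      using S.T.P.ideal_smult_inv[OF I_closed gd[OF fx]] by simp
  qed
  then obtain s where s_hom: "\<And>k. s k \<in> lmodule_hom (op_ring A) (P k) (P (Suc k))"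
    and s0: "\<And>x. x \<in> carrier (P 0) \<Longrightarrow> h 0 x \<ominus>\<^bsub>P 0\<^esub> d 0 (s 0 x) \<in> ideal_smult (P 0) I"
    and sS: "\<And>k x. x \<in> carrier (P (Suc k)) \<Longrightarrow> (h (Suc k) x \<ominus>\<^bsub>P (Suc k)\<^esub> s k (d k x))
       \<ominus>\<^bsub>P (Suc k)\<^esub> d (Suc k) (s (Suc k) x) \<in> ideal_smult (P (Suc k)) I"
    by blast
  have "\<exists>s. (\<forall>k. s k \<in> lmodule_hom (op_ring A') (Q k) (Q (Suc k))) \<and>
    (\<forall>y\<in>carrier (Q 0). h' 0 y \<ominus>\<^bsub>Q 0\<^esub> d' 0 (s 0 y) \<in> {\<zero>\<^bsub>Q 0\<^esub>}) \<and>
    (\<forall>k. \<forall>y\<in>carrier (Q (Suc k)). (h' (Suc k) y \<ominus>\<^bsub>Q (Suc k)\<^esub> s k (d' k y))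
       \<ominus>\<^bsub>Q (Suc k)\<^esub> d' (Suc k) (s (Suc k) y) \<in> {\<zero>\<^bsub>Q (Suc k)\<^esub>})"
  proof (rule D'.homotopy_exists[OF h'_add])
    fix k b y assume b: "b \<in> carrier (op_ring A')" and y: "y \<in> carrier (Q k)"
    then have bA: "b \<in> carrier A'" by simp
    let ?z = "f k (g k y)"
    have z: "?z \<in> carrier (Q k)" by (rule fc[OF gc[OF y]])
    note b_y = S'.T.P.smult_closed[OF b y] and bz = S'.T.P.smult_closed[OF b z]
    have "f k (g k (b \<odot>\<^bsub>Q k\<^esub> y)) = b \<odot>\<^bsub>Q k\<^esub> ?z"
      using g_smult[OF bA y] f_smult[OF \<iota>c[OF bA, simplified] gc[OF y]] \<rho>_\<iota>[OF bA] by simp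
    then show "h' k (b \<odot>\<^bsub>Q k\<^esub> y) \<ominus>\<^bsub>Q k\<^esub> b \<odot>\<^bsub>Q k\<^esub> h' k y \<in> {\<zero>\<^bsub>Q k\<^esub>}"
      unfolding h'_def S'.T.P.smult_r_diff[OF b y z] using b_y bz by (simp add: S'.T.P.M.self_minus)
  next
    fix y assume y: "y \<in> carrier (Q 0)"
    show "\<epsilon>' (h' 0 y) = \<zero>\<^bsub>N'\<^esub>"
      unfolding h'_def additive_diff[OF \<epsilon>_add(2) y fc[OF gc[OF y]]] \<epsilon>f[OF gc[OF y]] \<epsilon>g[OF y]
      by (rule N'.M.self_minus[OF additive_closed[OF \<epsilon>_add(2) y]])
  next
    fix k y assume y: "y \<in> carrier (Q (Suc k))"
    note gy = gc[OF y] and dy = d'c[OF y]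
    note fg = fc[OF gy] and gdy = gc[OF dy] and dgy = dc[OF gy]
    \<comment> \<open>The failure of \<open>g\<close> to be a chain map lies in \<open>I P\<close>,
      where \<open>f\<close> vanishes; hence \<open>f g\<close> is a chain map without
      correction.\<close>
    have "f k (g k (d' k y)) \<ominus>\<^bsub>Q k\<^esub> f k (d k (g (Suc k) y)) = \<zero>\<^bsub>Q k\<^esub>"
      using f_I[OF gd[OF y]] additive_diff[OF f_add gdy dgy] by simp
    then have "f k (g k (d' k y)) = d' k (f (Suc k) (g (Suc k) y))"
      using S'.T.P.M.minus_eq_zero_iff fc[OF gdy] fc[OF dgy] fd[OF gy] by simp
    then show "h' k (d' k y) \<ominus>\<^bsub>Q k\<^esub> d' k (h' (Suc k) y) \<in> {\<zero>\<^bsub>Q k\<^esub>}"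
      unfolding h'_def additive_diff[OF S'.additive_d y fg]
      using dy d'c[OF fg] by (simp add: S'.T.P.M.self_minus)
  qed
  then obtain s' where s'_hom: "\<And>k. s' k \<in> lmodule_hom (op_ring A') (Q k) (Q (Suc k))"
    and s'0: "\<And>y. y \<in> carrier (Q 0) \<Longrightarrow> h' 0 y \<ominus>\<^bsub>Q 0\<^esub> d' 0 (s' 0 y) = \<zero>\<^bsub>Q 0\<^esub>"
    and s'S: "\<And>k y. y \<in> carrier (Q (Suc k)) \<Longrightarrow> (h' (Suc k) y \<ominus>\<^bsub>Q (Suc k)\<^esub> s' k (d' k y))
       \<ominus>\<^bsub>Q (Suc k)\<^esub> d' (Suc k) (s' (Suc k) y) = \<zero>\<^bsub>Q (Suc k)\<^esub>"
    by blast
  note sc = lmodule_homD(1)[OF s_hom] and s'c = lmodule_homD(1)[OF s'_hom]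
  have car: "x \<in> carrier (P k)" if "x \<in> S.rel_cycles k" for x k using that by (simp add: S.rel_cycles_def)
  have car': "y \<in> carrier (Q k)" if "y \<in> S'.rel_cycles k" for y k using that by (simp add: S'.rel_cycles_def)
  \<comment> \<open>Serves to discard the homotopy term \<open>s (d x)\<close>, which lies in
    \<open>K P\<close> as soon as \<open>d x\<close> does.\<close>
  have drop: "u \<ominus>\<^bsub>L\<^esub> w \<in> V" if "submodule V B L" "lmodule B L" "u \<in> carrier L" "w \<in> carrier L" "v \<in> V"
      "(u \<ominus>\<^bsub>L\<^esub> v) \<ominus>\<^bsub>L\<^esub> w \<in> V" for u v w V and B :: "('c, 'e2) ring_scheme" and L :: "('c, 'l) module"
  proof -
    interpret L: lmodule B L by fact
    have v: "v \<in> carrier L" by (rule L.submoduleD(1)[OF that(1,5)])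
    have "u \<ominus>\<^bsub>L\<^esub> w = ((u \<ominus>\<^bsub>L\<^esub> v) \<oplus>\<^bsub>L\<^esub> v) \<ominus>\<^bsub>L\<^esub> w"
      by (simp only: L.M.minus_add_cancel[OF that(3) v])
    also have "\<dots> = ((u \<ominus>\<^bsub>L\<^esub> v) \<ominus>\<^bsub>L\<^esub> w) \<oplus>\<^bsub>L\<^esub> v"
      using that v by (simp add: a_minus_def L.M.a_ac)
    finally show ?thesis using L.submoduleD(3)[OF that(1,6,5)] by simp
  qed
  have homotopy: "h k x \<ominus>\<^bsub>P k\<^esub> d k (s k x) \<in> S.T.KP k" if x: "x \<in> S.rel_cycles k" for k x
  proof (cases k)
    case 0 then show ?thesis using I_KP[OF s0] car[OF x] by simp
  next
    case (Suc j)
    note xc = car[OF x, unfolded Suc]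
    have "d j x \<in> S.T.KP j" using x by (simp add: S.rel_cycles_def Suc)
    then have "s j (d j x) \<in> S.T.KP (Suc j)"
      by (rule S.T.P.ideal_smult_hom[OF S.T.K_closed S.lmodule_P s_hom])
    then show ?thesis unfolding Suc
      by (rule drop[OF S.T.submodule_KP S.lmodule_P additive_closed[OF h_add xc] dc[OF sc[OF xc]]
            _ I_KP[OF sS[OF xc]]])
  qed
  have homotopy': "h' k y \<ominus>\<^bsub>Q k\<^esub> d' k (s' k y) \<in> S'.T.KP k" if y: "y \<in> S'.rel_cycles k" for k y
  proof (cases k)
    case 0 then show ?thesis using s'0[of y] car'[OF y] by (simp add: ideal_smult.zero)
  next
    case (Suc j)
    note yc = car'[OF y, unfolded Suc]
    have "d' j y \<in> S'.T.KP j" using y by (simp add: S'.rel_cycles_def Suc)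
    then have "s' j (d' j y) \<in> S'.T.KP (Suc j)"
      by (rule S'.T.P.ideal_smult_hom[OF S'.T.K_closed S'.lmodule_P s'_hom])
    moreover have "(h' (Suc j) y \<ominus>\<^bsub>Q (Suc j)\<^esub> s' j (d' j y))
       \<ominus>\<^bsub>Q (Suc j)\<^esub> d' (Suc j) (s' (Suc j) y) \<in> S'.T.KP (Suc j)"
      unfolding s'S[OF yc] by (rule ideal_smult.zero)
    ultimately show ?thesis unfolding Suc
      by (rule drop[OF S'.T.submodule_KP S'.lmodule_P additive_closed[OF h'_add yc] d'c[OF s'c[OF yc]]])
  qed
  have f_cyc: "f k x \<in> S'.rel_cycles k" if "x \<in> S.rel_cycles k" for k x
  proof (cases k)
    case 0 then show ?thesis using that fc[of x 0] by (simp add: S.rel_cycles_def S'.rel_cycles_def)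
  next
    case (Suc j)
    then show ?thesis using that fc[of x "Suc j"] f_K[of "d j x" j] fd[of x j]
      by (simp add: S.rel_cycles_def S'.rel_cycles_def)
  qed
  have g_cyc: "g k y \<in> S.rel_cycles k" if y: "y \<in> S'.rel_cycles k" for k y
  proof (cases k)
    case 0 then show ?thesis using y gc[of y 0] by (simp add: S.rel_cycles_def S'.rel_cycles_def)
  next
    case (Suc j)
    note yc = car'[OF y, unfolded Suc]
    have "g j (d' j y) \<in> S.T.KP j" using y Suc by (intro g_K) (simp add: S'.rel_cycles_def)
    \<comment> \<open>\<open>g\<close> commutes with the differentials only modulo
      \<open>I P\<close>, which suffices because \<chi> factors through \<rho> and so
      \<open>I\<close> lies in \<open>K\<close>.\<close>
    moreover have "d j (g (Suc j) y) \<ominus>\<^bsub>P j\<^esub> g j (d' j y) \<in> S.T.KP j"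
      by (rule S.T.P.submodule_diff_sym[OF S.T.submodule_KP gc[OF d'c[OF yc]] dc[OF gc[OF yc]] I_KP[OF gd[OF yc]]])
    ultimately have "d j (g (Suc j) y) \<in> S.T.KP j"
      using S.T.P.submodule_diff_mem[OF S.T.submodule_KP dc[OF gc[OF yc]]] by blast
    then show ?thesis using gc[OF yc] Suc by (simp add: S.rel_cycles_def)
  qed
  obtain \<alpha> where \<alpha>: "\<alpha> ` S.rel_cycles k = carrier (Tor R A P d N k)"
    "\<And>x y. \<lbrakk>x \<in> S.rel_cycles k; y \<in> S.rel_cycles k\<rbrakk> \<Longrightarrow>
      \<alpha> (x \<oplus>\<^bsub>P k\<^esub> y) = \<alpha> x \<oplus>\<^bsub>Tor R A P d N k\<^esub> \<alpha> y"
    "\<And>r x. \<lbrakk>r \<in> carrier R; x \<in> S.rel_cycles k\<rbrakk> \<Longrightarrow>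
      \<alpha> (S.unit r \<odot>\<^bsub>P k\<^esub> x) = r \<odot>\<^bsub>Tor R A P d N k\<^esub> \<alpha> x"
    "\<And>x y. \<lbrakk>x \<in> S.rel_cycles k; y \<in> S.rel_cycles k\<rbrakk> \<Longrightarrow> \<alpha> x = \<alpha> y \<longleftrightarrow>
        (\<exists>w\<in>carrier (P (Suc k)). x \<ominus>\<^bsub>P k\<^esub> (d k w \<oplus>\<^bsub>P k\<^esub> y) \<in> S.T.KP k)"
    using S.Tor_presentation[of k] by metis
  obtain \<alpha>' where \<alpha>': "\<alpha>' ` S'.rel_cycles k = carrier (Tor R A' Q d' N' k)"
    "\<And>x y. \<lbrakk>x \<in> S'.rel_cycles k; y \<in> S'.rel_cycles k\<rbrakk> \<Longrightarrow>
      \<alpha>' (x \<oplus>\<^bsub>Q k\<^esub> y) = \<alpha>' x \<oplus>\<^bsub>Tor R A' Q d' N' k\<^esub> \<alpha>' y"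
    "\<And>r x. \<lbrakk>r \<in> carrier R; x \<in> S'.rel_cycles k\<rbrakk> \<Longrightarrow>
      \<alpha>' (S'.unit r \<odot>\<^bsub>Q k\<^esub> x) = r \<odot>\<^bsub>Tor R A' Q d' N' k\<^esub> \<alpha>' x"
    "\<And>x y. \<lbrakk>x \<in> S'.rel_cycles k; y \<in> S'.rel_cycles k\<rbrakk> \<Longrightarrow> \<alpha>' x = \<alpha>' y \<longleftrightarrow>
        (\<exists>w\<in>carrier (Q (Suc k)). x \<ominus>\<^bsub>Q k\<^esub> (d' k w \<oplus>\<^bsub>Q k\<^esub> y) \<in> S'.T.KP k)"
    using S'.Tor_presentation[of k] by metis
  show ?thesis
  proof (rule lmodule_isomorphic_presentationI[where \<alpha> = \<alpha> and Z = "S.rel_cycles k"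
        and p = "add (P k)" and s = "\<lambda>r x. S.unit r \<odot>\<^bsub>P k\<^esub> x" and \<beta> = "\<lambda>x. \<alpha>' (f k x)"])
    show "\<alpha> ` S.rel_cycles k = carrier (Tor R A P d N k)" by (rule \<alpha>(1))
  next
    fix x y assume xy: "x \<in> S.rel_cycles k" "y \<in> S.rel_cycles k"
    note xc = car[OF xy(1)] and yc = car[OF xy(2)]
    show "x \<oplus>\<^bsub>P k\<^esub> y \<in> S.rel_cycles k \<and> \<alpha> (x \<oplus>\<^bsub>P k\<^esub> y) = \<alpha> x \<oplus>\<^bsub>Tor R A P d N k\<^esub> \<alpha> y"
      using S.rel_cycles_add[OF xy] \<alpha>(2)[OF xy] by blast
    show "\<alpha>' (f k (x \<oplus>\<^bsub>P k\<^esub> y)) = \<alpha>' (f k x) \<oplus>\<^bsub>Tor R A' Q d' N' k\<^esub> \<alpha>' (f k y)"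
      unfolding additive_add[OF f_add xc yc] by (rule \<alpha>'(2)[OF f_cyc[OF xy(1)] f_cyc[OF xy(2)]])
    show "\<alpha> x = \<alpha> y \<longleftrightarrow> \<alpha>' (f k x) = \<alpha>' (f k y)"
    proof
      assume "\<alpha> x = \<alpha> y"
      then obtain w where w: "w \<in> carrier (P (Suc k))" "x \<ominus>\<^bsub>P k\<^esub> (d k w \<oplus>\<^bsub>P k\<^esub> y) \<in> S.T.KP k"
        using \<alpha>(4)[OF xy] by blast
      note dw = dc[OF w(1)]
      have "f k x \<ominus>\<^bsub>Q k\<^esub> (d' k (f (Suc k) w) \<oplus>\<^bsub>Q k\<^esub> f k y) \<in> S'.T.KP k"
        using f_K[OF w(2)] additive_diff[OF f_add xc S.T.P.M.a_closed[OF dw yc]]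
          additive_add[OF f_add dw yc] fd[OF w(1)] by simp
      then show "\<alpha>' (f k x) = \<alpha>' (f k y)"
        using \<alpha>'(4)[OF f_cyc[OF xy(1)] f_cyc[OF xy(2)]] fc[OF w(1)] by blast
    next
      assume "\<alpha>' (f k x) = \<alpha>' (f k y)"
      then obtain w where w: "w \<in> carrier (Q (Suc k))"
        and fw: "f k x \<ominus>\<^bsub>Q k\<^esub> (d' k w \<oplus>\<^bsub>Q k\<^esub> f k y) \<in> S'.T.KP k"
        using \<alpha>'(4)[OF f_cyc[OF xy(1)] f_cyc[OF xy(2)]] by blast
      note dw = d'c[OF w] and gw = gc[OF w]
      \<comment> \<open>By additivity it is enough to show that \<open>z\<close> is a boundary
        modulo \<open>K P\<close> when \<open>f z\<close> is one modulo \<open>K Q\<close>.\<close>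
      let ?z = "x \<ominus>\<^bsub>P k\<^esub> y"
      have z: "?z \<in> carrier (P k)" using xc yc by simp
      have zcyc: "?z \<in> S.rel_cycles k"
      proof (cases k)
        case 0 then show ?thesis using z by (simp add: S.rel_cycles_def)
      next
        case (Suc j)
        then show ?thesis
          using z xy additive_diff[OF S.additive_d, of x j y] xc yc S.T.P.submoduleD(6)[OF S.T.submodule_KP]
          by (simp add: S.rel_cycles_def)
      qed
      note fz = fc[OF z] and gfz = gc[OF fc[OF z]] and dsz = dc[OF sc[OF z]]
        and dgw = dc[OF gw] and gdw = gc[OF dw]
      have "f k ?z \<ominus>\<^bsub>Q k\<^esub> d' k w = f k x \<ominus>\<^bsub>Q k\<^esub> (d' k w \<oplus>\<^bsub>Q k\<^esub> f k y)"
        unfolding additive_diff[OF f_add xc yc] using fc[OF xc] fc[OF yc] dw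
        by (simp add: a_minus_def S'.T.P.M.minus_add S'.T.P.M.a_ac)
      then have "g k (f k ?z) \<ominus>\<^bsub>P k\<^esub> g k (d' k w) \<in> S.T.KP k"
        using g_K[of "f k ?z \<ominus>\<^bsub>Q k\<^esub> d' k w" k] fw additive_diff[OF g_add fz dw] by simp
      then have 1: "g k (f k ?z) \<ominus>\<^bsub>P k\<^esub> d k (g (Suc k) w) \<in> S.T.KP k"
        using S.T.P.submodule_diff_trans[OF S.T.submodule_KP gfz gdw dgw _ I_KP[OF gd[OF w]]] by blast
      \<comment> \<open>Read off from \<open>z = g (f z) + h z\<close>: modulo \<open>K P\<close>
        the first term is \<open>d (g w)\<close> and the second is \<open>d (s z)\<close>.\<close>
      let ?w = "g (Suc k) w \<oplus>\<^bsub>P (Suc k)\<^esub> s k ?z"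
      have wc: "?w \<in> carrier (P (Suc k))" using gw sc[OF z] by simp
      have dwc: "d k ?w = d k (g (Suc k) w) \<oplus>\<^bsub>P k\<^esub> d k (s k ?z)"
        by (rule additive_add[OF S.additive_d gw sc[OF z]])
      have "x \<ominus>\<^bsub>P k\<^esub> (d k ?w \<oplus>\<^bsub>P k\<^esub> y) = ?z \<ominus>\<^bsub>P k\<^esub> d k ?w"
        using xc yc dc[OF wc] by (simp add: a_minus_def S.T.P.M.minus_add S.T.P.M.a_ac)
      also have "\<dots> = (g k (f k ?z) \<oplus>\<^bsub>P k\<^esub> h k ?z) \<ominus>\<^bsub>P k\<^esub> d k ?w"
        unfolding h_def by (simp only: S.T.P.M.add_minus_cancel[OF z gfz])
      also have "\<dots> = (g k (f k ?z) \<ominus>\<^bsub>P k\<^esub> d k (g (Suc k) w)) \<oplus>\<^bsub>P k\<^esub> (h k ?z \<ominus>\<^bsub>P k\<^esub> d k (s k ?z))"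
        unfolding dwc by (rule S.T.P.M.add_minus_swap[OF gfz additive_closed[OF h_add z] dgw dsz])
      also have "\<dots> \<in> S.T.KP k"
        by (rule S.T.P.ideal_smult_add[OF S.T.K_closed 1 homotopy[OF zcyc]])
      finally show "\<alpha> x = \<alpha> y" using \<alpha>(4)[OF xy] wc by blast
    qed
  next
    fix r x assume r: "r \<in> carrier R" and x: "x \<in> S.rel_cycles k"
    show "S.unit r \<odot>\<^bsub>P k\<^esub> x \<in> S.rel_cycles k \<and> \<alpha> (S.unit r \<odot>\<^bsub>P k\<^esub> x) = r \<odot>\<^bsub>Tor R A P d N k\<^esub> \<alpha> x"
      using S.rel_cycles_smult[OF r x] \<alpha>(3)[OF r x] by blast
    have "f k (S.unit r \<odot>\<^bsub>P k\<^esub> x) = S'.unit r \<odot>\<^bsub>Q k\<^esub> f k x"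
      using f_smult[OF S.T.unit_closed[OF r, simplified] car[OF x]] \<rho>_unit[OF r]
      by (simp add: S.unit_def S'.unit_def)
    then show "\<alpha>' (f k (S.unit r \<odot>\<^bsub>P k\<^esub> x)) = r \<odot>\<^bsub>Tor R A' Q d' N' k\<^esub> \<alpha>' (f k x)"
      using \<alpha>'(3)[OF r f_cyc[OF x]] by simp
  next
    show "\<alpha>' (f k x) \<in> carrier (Tor R A' Q d' N' k)" if "x \<in> S.rel_cycles k" for x
      using \<alpha>'(1) f_cyc[OF that] by blast
  next
    fix t assume "t \<in> carrier (Tor R A' Q d' N' k)"
    then obtain y where y: "y \<in> S'.rel_cycles k" "t = \<alpha>' y" using \<alpha>'(1) by blast
    note yc = car'[OF y(1)] and gy = g_cyc[OF y(1)]
    note fgy = fc[OF gc[OF yc]] and dsy = d'c[OF s'c[OF yc]]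
    \<comment> \<open>Surjectivity: modulo \<open>K Q\<close>, \<open>y\<close> and
      \<open>f (g y)\<close> differ by the boundary of \<open>s' y\<close>.\<close>
    have "y \<ominus>\<^bsub>Q k\<^esub> (d' k (s' k y) \<oplus>\<^bsub>Q k\<^esub> f k (g k y)) = h' k y \<ominus>\<^bsub>Q k\<^esub> d' k (s' k y)"
      unfolding h'_def using yc fgy dsy
      by (simp add: a_minus_def S'.T.P.M.minus_add S'.T.P.M.a_ac)
    then have "\<alpha>' y = \<alpha>' (f k (g k y))"
      using \<alpha>'(4)[OF y(1) f_cyc[OF gy]] homotopy'[OF y(1)] s'c[OF yc] by metis
    then show "\<exists>x\<in>S.rel_cycles k. \<alpha>' (f k x) = t" using gy y(2) by auto
  qed
qed

end

section \<open>Combinatorics of Brauer diagrams\<close>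

lemma finite_outer_nodes: "finite (outer_nodes n)"
  by (simp add: outer_nodes_def)

lemma outer_nodes_iff [simp]: "(c, i) \<in> outer_nodes n \<longleftrightarrow> (c = Lft \<or> c = Rgt) \<and> 1 \<le> i \<and> i \<le> n"
  by (auto simp: outer_nodes_def)

lemma finite_brauer_diagrams: "finite (brauer_diagrams n)"
  by (rule finite_subset[of _ "Pow (Pow (outer_nodes n))"])
    (auto simp: brauer_diagrams_def finite_outer_nodes)

text \<open>Perfect matchings are the same as involutions without fixed points. Checking the
  involution on finitely many shapes of nodes replaces arguments about unique edges.\<close>

lemma involution_diagram:
  assumes "\<And>v. v \<in> outer_nodes n \<Longrightarrow> \<tau> v \<in> outer_nodes n \<and> \<tau> v \<noteq> v \<and> \<tau> (\<tau> v) = v"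
  shows "{{v, \<tau> v} | v. v \<in> outer_nodes n} \<in> brauer_diagrams n" (is "?D \<in> _")
proof -
  have "e \<subseteq> outer_nodes n \<and> card e = 2" if e: "e \<in> ?D" for e
  proof -
    obtain v where v: "v \<in> outer_nodes n" "e = {v, \<tau> v}" using e by blast
    have "\<tau> v \<in> outer_nodes n" "\<tau> v \<noteq> v" using assms[OF v(1)] by blast+
    then show ?thesis using v by simp
  qed
  moreover have "\<exists>!e. e \<in> ?D \<and> v \<in> e" if v: "v \<in> outer_nodes n" for v
  proof (rule ex1I)
    show "{v, \<tau> v} \<in> ?D \<and> v \<in> {v, \<tau> v}" using v by blast
    fix e assume "e \<in> ?D \<and> v \<in> e"
    then obtain w where w: "w \<in> outer_nodes n" "e = {w, \<tau> w}" "v \<in> {w, \<tau> w}" by blast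
    then show "e = {v, \<tau> v}" using assms[OF w(1)] by auto
  qed
  ultimately show ?thesis by (simp add: brauer_diagrams_def)
qed

lemma edge_outer: "\<lbrakk>b \<in> brauer_diagrams n; e \<in> b\<rbrakk> \<Longrightarrow> e \<subseteq> outer_nodes n"
  by (simp add: brauer_diagrams_def)

lemma edge_unique:
  assumes "b \<in> brauer_diagrams n" "e \<in> b" "e' \<in> b" "v \<in> e" "v \<in> e'" shows "e = e'"
proof -
  have "v \<in> outer_nodes n" using edge_outer assms by blast
  then have "\<exists>!e. e \<in> b \<and> v \<in> e" using assms(1) by (simp add: brauer_diagrams_def)
  then show ?thesis using assms by blast
qed

lemma edge_exists: "\<lbrakk>b \<in> brauer_diagrams n; v \<in> outer_nodes n\<rbrakk> \<Longrightarrow> \<exists>e\<in>b. v \<in> e"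
  unfolding brauer_diagrams_def by blast

lemma edge_form:
  assumes "b \<in> brauer_diagrams n" "e \<in> b" "v \<in> e"
  shows "\<exists>w. w \<noteq> v \<and> e = {v, w} \<and> v \<in> outer_nodes n \<and> w \<in> outer_nodes n"
proof -
  have c: "card e = 2" and sub: "e \<subseteq> outer_nodes n"
    using assms by (simp_all add: brauer_diagrams_def)
  obtain x y where xy: "e = {x, y}" "x \<noteq> y" using c unfolding card_2_iff by blast
  then consider "v = x" | "v = y" using assms(3) by blast
  then show ?thesis
  proof cases
    case 1 then show ?thesis using xy sub by (intro exI[of _ y]) simp
  next
    case 2 then show ?thesis using xy sub by (intro exI[of _ x]) (simp add: insert_commute)
  qed
qed

lemma edge_pair:
  assumes "b \<in> brauer_diagrams n" "e \<in> b"
  shows "\<exists>v w. v \<noteq> w \<and> e = {v, w} \<and> v \<in> outer_nodes n \<and> w \<in> outer_nodes n"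
proof -
  have "card e = 2" using assms by (auto simp: brauer_diagrams_def)
  then have "e \<noteq> {}" by auto
  then obtain v where v: "v \<in> e" by blast
  obtain w where "w \<noteq> v" "e = {v, w}" "v \<in> outer_nodes n" "w \<in> outer_nodes n"
    using edge_form[OF assms v] by blast
  then show ?thesis by blast
qed

subsection \<open>Connectedness in concatenations\<close>

lemma connected_refl [simp]: "(u, u) \<in> connected_nodes x y"
  by (simp add: connected_nodes_def)

lemma connected_trans:
  "\<lbrakk>(u, v) \<in> connected_nodes x y; (v, w) \<in> connected_nodes x y\<rbrakk> \<Longrightarrow> (u, w) \<in> connected_nodes x y"
  unfolding connected_nodes_def by (rule rtrancl_trans)

lemma connected_sym:
  assumes "(u, v) \<in> connected_nodes x y" shows "(v, u) \<in> connected_nodes x y"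
proof -
  have "sym {(u, v). {u, v} \<in> concat_edges x y}"
    by (rule symI) (simp add: insert_commute)
  then show ?thesis using assms unfolding connected_nodes_def by (blast dest: sym_rtrancl symD)
qed

lemma connected_left:
  assumes "{u, v} \<in> x" shows "(place_left u, place_left v) \<in> connected_nodes x y"
proof -
  have "(\<lambda>e. place_left ` e) {u, v} \<in> concat_edges x y"
    unfolding concat_edges_def using assms by (intro UnI1 imageI)
  then have "{place_left u, place_left v} \<in> concat_edges x y" by simp
  then show ?thesis unfolding connected_nodes_def by (intro r_into_rtrancl) simp
qed

lemma connected_right:
  assumes "{u, v} \<in> y" shows "(place_right u, place_right v) \<in> connected_nodes x y"
proof -
  have "(\<lambda>e. place_right ` e) {u, v} \<in> concat_edges x y"
    unfolding concat_edges_def using assms by (intro UnI2 imageI)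
  then have "{place_right u, place_right v} \<in> concat_edges x y" by simp
  then show ?thesis unfolding connected_nodes_def by (intro r_into_rtrancl) simp
qed

text \<open>A labelling of the nodes that is constant along edges is constant on components. All
  statements below that two nodes are not connected come from suitable labellings.\<close>

lemma connected_label:
  assumes x: "\<And>e. e \<in> x \<Longrightarrow> \<exists>u v. e = {u, v} \<and> L (place_left u) = L (place_left v)"
    and y: "\<And>e. e \<in> y \<Longrightarrow> \<exists>u v. e = {u, v} \<and> L (place_right u) = L (place_right v)"
    and "(a, b) \<in> connected_nodes x y"
  shows "L a = L b"
  using assms(3) unfolding connected_nodes_def
proof (induction rule: rtrancl_induct)
  case (step b c)
  from step(2) have "{b, c} \<in> concat_edges x y" by simp
  then consider e where "e \<in> x" "{b, c} = place_left ` e" | e where "e \<in> y" "{b, c} = place_right ` e"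
    unfolding concat_edges_def by blast
  then have "\<exists>s t. {b, c} = {s, t} \<and> L s = L t"
  proof cases
    case 1
    obtain u v where "e = {u, v}" "L (place_left u) = L (place_left v)" using x[OF 1(1)] by blast
    then show ?thesis using 1(2) by (intro exI[of _ "place_left u"] exI[of _ "place_left v"]) simp
  next
    case 2
    obtain u v where "e = {u, v}" "L (place_right u) = L (place_right v)" using y[OF 2(1)] by blast
    then show ?thesis using 2(2) by (intro exI[of _ "place_right u"] exI[of _ "place_right v"]) simp
  qed
  then have "L b = L c" by (metis doubleton_eq_iff)
  with step.IH show ?case by simp
qed simp

lemma compI: "\<lbrakk>u \<in> outer_nodes n; v \<in> outer_nodes n; u \<noteq> v; (u, v) \<in> connected_nodes x y\<rbrakk> \<Longrightarrow>
    {u, v} \<in> brauer_comp n x y"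
  unfolding brauer_comp_def by blast

text \<open>A loop consists of middle nodes only, so it is excluded once every middle node is
  connected to a node outside the middle column.\<close>

lemma no_loops:
  assumes "\<And>i. i \<in> {1..n} \<Longrightarrow> \<exists>c j. c \<noteq> Mid \<and> ((Mid, i), (c, j)) \<in> connected_nodes x y"
  shows "brauer_loops n x y = 0"
proof -
  have "\<not> connected_nodes x y `` {(Mid, i)} \<subseteq> {Mid} \<times> {1..n}" if i: "i \<in> {1..n}" for i
  proof -
    obtain c j where "c \<noteq> Mid" "(c, j) \<in> connected_nodes x y `` {(Mid, i)}"
      using assms[OF i] by blast
    then show ?thesis by blast
  qed
  then have none: "\<not> (C \<subseteq> {Mid} \<times> {1..n} \<and> (\<exists>i\<in>{1..n}. C = connected_nodes x y `` {(Mid, i)}))" for C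
    by metis
  have "{C. C \<subseteq> {Mid} \<times> {1..n} \<and> (\<exists>i\<in>{1..n}. C = connected_nodes x y `` {(Mid, i)})} = {}"
    unfolding Collect_empty_eq using none by (rule allI)
  then show ?thesis unfolding brauer_loops_def by (simp only: card.empty)
qed

section \<open>Edges that a composite inherits from its factors\<close>

definition right_edges :: "nat \<Rightarrow> node set set" where
  "right_edges n = {{(Rgt, i), (Rgt, j)} | i j. i \<in> {1..n} \<and> j \<in> {1..n} \<and> i \<noteq> j}"

lemma finite_right_edges: "finite (right_edges n)"
  by (rule finite_subset[of _ "Pow (outer_nodes n)"]) (auto simp: right_edges_def finite_outer_nodes)

text \<open>Gluing does not touch the right column of \<open>y\<close>. Hence the diagrams
  containing a given set of right edges span a left ideal.\<close>

lemma comp_right_edge: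
  assumes "e \<in> right_edges n" "e \<in> y" shows "e \<in> brauer_comp n x y"
proof -
  obtain i j where e: "e = {(Rgt, i), (Rgt, j)}" "i \<in> {1..n}" "j \<in> {1..n}" "i \<noteq> j"
    using assms(1) by (auto simp: right_edges_def)
  have "((Rgt, i), (Rgt, j)) \<in> connected_nodes x y"
    using connected_right[of "(Rgt, i)" "(Rgt, j)" y x] assms(2) e(1) by simp
  then show ?thesis unfolding e(1) by (rule compI[rotated 3]) (use e in simp_all)
qed

lemma comp_left_edge:
  assumes "{(Lft, i), (Lft, j)} \<in> x" "i \<in> {1..n}" "j \<in> {1..n}" "i \<noteq> j"
  shows "{(Lft, i), (Lft, j)} \<in> brauer_comp n x y"
proof -
  have "((Lft, i), (Lft, j)) \<in> connected_nodes x y"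
    using connected_left[OF assms(1)] by simp
  then show ?thesis by (rule compI[rotated 3]) (use assms in simp_all)
qed

subsection \<open>Permutation diagrams and turnbacks\<close>

text \<open>The permutation is applied at the left end. In a product the right node \<open>j\<close>
  is then joined to the middle node \<open>\<tau> j\<close> and on to the left node
  \<open>\<sigma> (\<tau> j)\<close>, so products correspond to composition in the usual
  order.\<close>

definition perm_diagram :: "nat \<Rightarrow> (nat \<Rightarrow> nat) \<Rightarrow> diagram" where
  "perm_diagram n \<sigma> = {{(Lft, \<sigma> j), (Rgt, j)} | j. j \<in> {1..n}}"

lemma permutes_range:
  assumes "\<sigma> permutes {1..n}"
  shows "Suc 0 \<le> \<sigma> j \<longleftrightarrow> Suc 0 \<le> j" and "\<sigma> j \<le> n \<longleftrightarrow> j \<le> n"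
  using permutes_in_image[OF assms, of j] permutes_not_in[OF assms, of j]
  by (cases "j \<in> {1..n}"; simp)+

lemma perm_diagram_in_brauer_diagrams:
  assumes \<sigma>: "\<sigma> permutes {1..n}" shows "perm_diagram n \<sigma> \<in> brauer_diagrams n"
proof -
  define \<tau> where "\<tau> v = (if fst v = Lft then (Rgt, Hilbert_Choice.inv \<sigma> (snd v)) else (Lft, \<sigma> (snd v)))" for v
  note r = permutes_range[OF \<sigma>] permutes_range[OF permutes_inv[OF \<sigma>]] permutes_inverses[OF \<sigma>]
  have "{{v, \<tau> v} | v. v \<in> outer_nodes n} \<in> brauer_diagrams n"
    by (rule involution_diagram) (auto simp: \<tau>_def r)
  moreover have "{{v, \<tau> v} | v. v \<in> outer_nodes n} = perm_diagram n \<sigma>"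
  proof
    show "{{v, \<tau> v} | v. v \<in> outer_nodes n} \<subseteq> perm_diagram n \<sigma>"
    proof clarify
      fix c i assume ci: "(c, i) \<in> outer_nodes n"
      show "{(c, i), \<tau> (c, i)} \<in> perm_diagram n \<sigma>"
      proof (cases "c = Lft")
        case True
        then have "{(c, i), \<tau> (c, i)} = {(Lft, \<sigma> (Hilbert_Choice.inv \<sigma> i)), (Rgt, Hilbert_Choice.inv \<sigma> i)}" by (simp add: \<tau>_def r)
        moreover have "Hilbert_Choice.inv \<sigma> i \<in> {1..n}" using ci r by simp
        ultimately show ?thesis unfolding perm_diagram_def by blast
      next
        case False
        then have "{(c, i), \<tau> (c, i)} = {(Lft, \<sigma> i), (Rgt, i)}" using ci by (auto simp: \<tau>_def)
        moreover have "i \<in> {1..n}" using ci by simp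
        ultimately show ?thesis unfolding perm_diagram_def by blast
      qed
    qed
    show "perm_diagram n \<sigma> \<subseteq> {{v, \<tau> v} | v. v \<in> outer_nodes n}"
    proof (clarsimp simp: perm_diagram_def)
      fix j assume "Suc 0 \<le> j" "j \<le> n"
      then have "(Rgt, j) \<in> outer_nodes n" "{(Lft, \<sigma> j), (Rgt, j)} = {(Rgt, j), \<tau> (Rgt, j)}"
        by (auto simp: \<tau>_def)
      then show "\<exists>a b. {(Lft, \<sigma> j), (Rgt, j)} = {(a, b), \<tau> (a, b)} \<and> (a = Lft \<or> a = Rgt) \<and> Suc 0 \<le> b \<and> b \<le> n"
        by auto
    qed
  qed
  ultimately show ?thesis by simp
qed

lemma perm_diagram_no_turnback: "\<not> has_turnback (perm_diagram n \<sigma>)"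
  by (auto simp: has_turnback_def perm_diagram_def)

lemma perm_diagram_inj:
  assumes "\<sigma> permutes {1..n}" "\<tau> permutes {1..n}" "perm_diagram n \<sigma> = perm_diagram n \<tau>"
  shows "\<sigma> = \<tau>"
proof
  fix j
  show "\<sigma> j = \<tau> j"
  proof (cases "j \<in> {1..n}")
    case True
    then have "{(Lft, \<sigma> j), (Rgt, j)} \<in> perm_diagram n \<tau>"
      using assms(3) unfolding perm_diagram_def by blast
    then show ?thesis by (auto simp: perm_diagram_def doubleton_eq_iff)
  next
    case False then show ?thesis using assms by (metis permutes_not_in)
  qed
qed

lemma perm_diagram_id: "perm_diagram n id = brauer_id n"
  by (simp add: perm_diagram_def brauer_id_def)

lemma perm_diagram_comp:
  assumes \<sigma>: "\<sigma> permutes {1..n}" and \<tau>: "\<tau> permutes {1..n}"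
  shows "brauer_comp n (perm_diagram n \<sigma>) (perm_diagram n \<tau>) = perm_diagram n (\<sigma> \<circ> \<tau>)"
    and "brauer_loops n (perm_diagram n \<sigma>) (perm_diagram n \<tau>) = 0"
proof -
  let ?x = "perm_diagram n \<sigma>" and ?y = "perm_diagram n \<tau>"
  note r = permutes_range[OF \<sigma>] permutes_range[OF \<tau>]
  have left: "((Lft, \<sigma> j), (Mid, j)) \<in> connected_nodes ?x ?y" if "j \<in> {1..n}" for j
    using connected_left[of "(Lft, \<sigma> j)" "(Rgt, j)" ?x ?y] that unfolding perm_diagram_def by auto
  have right: "((Mid, \<tau> j), (Rgt, j)) \<in> connected_nodes ?x ?y" if "j \<in> {1..n}" for j
    using connected_right[of "(Lft, \<tau> j)" "(Rgt, j)" ?y ?x] that unfolding perm_diagram_def by auto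
  show "brauer_loops n ?x ?y = 0"
    by (rule no_loops) (metis left connected_sym column.distinct(1))
  \<comment> \<open>The label of a node is the left node at the end of its path.\<close>
  define L where "L v = (case fst v of Lft \<Rightarrow> snd v | Mid \<Rightarrow> \<sigma> (snd v) | Rgt \<Rightarrow> \<sigma> (\<tau> (snd v)))" for v
  have label: "L u = L v" if "(u, v) \<in> connected_nodes ?x ?y" for u v
  proof (rule connected_label[OF _ _ that])
    fix e assume "e \<in> ?x"
    then obtain j where "e = {(Lft, \<sigma> j), (Rgt, j)}" unfolding perm_diagram_def by blast
    then show "\<exists>u v. e = {u, v} \<and> L (place_left u) = L (place_left v)"
      by (intro exI[of _ "(Lft, \<sigma> j)"] exI[of _ "(Rgt, j)"]) (simp add: L_def)
  next
    fix e assume "e \<in> ?y"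
    then obtain j where "e = {(Lft, \<tau> j), (Rgt, j)}" unfolding perm_diagram_def by blast
    then show "\<exists>u v. e = {u, v} \<and> L (place_right u) = L (place_right v)"
      by (intro exI[of _ "(Lft, \<tau> j)"] exI[of _ "(Rgt, j)"]) (simp add: L_def)
  qed
  show "brauer_comp n ?x ?y = perm_diagram n (\<sigma> \<circ> \<tau>)"
  proof
    show "brauer_comp n ?x ?y \<subseteq> perm_diagram n (\<sigma> \<circ> \<tau>)"
    proof
      fix e assume "e \<in> brauer_comp n ?x ?y"
      then obtain u v where uv: "e = {u, v}" "u \<in> outer_nodes n" "v \<in> outer_nodes n" "u \<noteq> v"
        "(u, v) \<in> connected_nodes ?x ?y"
        unfolding brauer_comp_def by blast
      obtain c i c' i' where ci: "u = (c, i)" "v = (c', i')" by (cases u; cases v)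
      note e = uv(1-4)[unfolded ci] label[OF uv(5), unfolded ci]
      have inj: "\<sigma> (\<tau> i) = \<sigma> (\<tau> i') \<longleftrightarrow> i = i'"
        using permutes_inj[OF \<sigma>] permutes_inj[OF \<tau>] by (auto dest: injD)
      have "e = {(Lft, \<sigma> (\<tau> i)), (Rgt, i)} \<or> e = {(Lft, \<sigma> (\<tau> i')), (Rgt, i')}"
        using e inj by (cases c; cases c') (simp_all add: L_def insert_commute)
      moreover have "i \<in> {1..n}" "i' \<in> {1..n}" using e(2,3) by simp_all
      ultimately show "e \<in> perm_diagram n (\<sigma> \<circ> \<tau>)" unfolding perm_diagram_def by fastforce
    qed
    show "perm_diagram n (\<sigma> \<circ> \<tau>) \<subseteq> brauer_comp n ?x ?y"
    proof
      fix e assume "e \<in> perm_diagram n (\<sigma> \<circ> \<tau>)"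
      then obtain j where j: "j \<in> {1..n}" "e = {(Lft, \<sigma> (\<tau> j)), (Rgt, j)}"
        by (auto simp: perm_diagram_def)
      have "((Lft, \<sigma> (\<tau> j)), (Rgt, j)) \<in> connected_nodes ?x ?y"
        using connected_trans[OF left right] j r by simp
      then show "e \<in> brauer_comp n ?x ?y" unfolding j(2) using j(1) r by (intro compI) auto
    qed
  qed
qed

text \<open>If column \<open>c'\<close> has no internal edge, its \<open>n\<close> nodes are matched
  injectively, hence bijectively, with the \<open>n\<close> nodes of the other column, and none
  remain there for an internal edge. The columns are variables so that both sides are
  covered.\<close>

lemma one_sided_edge_free:
  assumes b: "b \<in> brauer_diagrams n" and c: "{c, c'} = {Lft, Rgt}"
    and free: "\<And>i j. {(c', i), (c', j)} \<notin> b"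
  shows "\<exists>p. p permutes {1..n} \<and> b = {{(c, p i), (c', i)} | i. i \<in> {1..n}}"
proof -
  have cc: "c \<noteq> c'" "(c = Lft \<or> c = Rgt)" "(c' = Lft \<or> c' = Rgt)"
    using c by (auto simp: doubleton_eq_iff)
  have "\<exists>j. {(c, j), (c', i)} \<in> b \<and> j \<in> {1..n}" if "i \<in> {1..n}" for i
  proof -
    have "(c', i) \<in> outer_nodes n" using that cc by auto
    then obtain e where e: "e \<in> b" "(c', i) \<in> e" using edge_exists[OF b] by blast
    obtain w where w: "e = {(c', i), w}" "w \<in> outer_nodes n" using edge_form[OF b e] by blast
    obtain k j where kj: "w = (k, j)" by (cases w)
    have "k \<noteq> c'" using free e w kj by blast
    then have "k = c" using w kj cc c by (auto simp: doubleton_eq_iff)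
    then show ?thesis using e w kj by (auto simp: insert_commute)
  qed
  then obtain q where q: "\<And>i. i \<in> {1..n} \<Longrightarrow> {(c, q i), (c', i)} \<in> b \<and> q i \<in> {1..n}" by metis
  then have q1: "\<And>i. i \<in> {1..n} \<Longrightarrow> {(c, q i), (c', i)} \<in> b" and q2: "q ` {1..n} \<subseteq> {1..n}" by blast+
  have inj: "inj_on q {1..n}"
  proof (rule inj_onI)
    fix i j assume ij: "i \<in> {1..n}" "j \<in> {1..n}" "q i = q j"
    have "{(c, q i), (c', i)} = {(c, q i), (c', j)}"
      using edge_unique[OF b q1[OF ij(1)] q1[OF ij(2)], of "(c, q i)"] ij(3) by simp
    then show "i = j" using cc(1) by (simp add: doubleton_eq_iff)
  qed
  have surj: "q ` {1..n} = {1..n}"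
    by (rule endo_inj_surj[OF finite_atLeastAtMost q2 inj])
  \<comment> \<open>\<open>permutes\<close> requires the identity outside
    \<open>{1..n}\<close>.\<close>
  define p where "p i = (if i \<in> {1..n} then q i else i)" for i
  have "p permutes {1..n}"
  proof (rule bij_imp_permutes)
    have "bij_betw q {1..n} {1..n}" using inj surj by (simp add: bij_betw_def)
    then show "bij_betw p {1..n} {1..n}"
      by (subst bij_betw_cong[where g = q]) (simp_all add: p_def)
  qed (simp only: p_def if_False)
  moreover have "b = {{(c, p i), (c', i)} | i. i \<in> {1..n}}"
  proof
    show "{{(c, p i), (c', i)} | i. i \<in> {1..n}} \<subseteq> b"
    proof
      fix e assume "e \<in> {{(c, p i), (c', i)} | i. i \<in> {1..n}}"
      then obtain i where "i \<in> {1..n}" "e = {(c, p i), (c', i)}" by blast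
      then show "e \<in> b" using q1[of i] by (simp add: p_def)
    qed
    show "b \<subseteq> {{(c, p i), (c', i)} | i. i \<in> {1..n}}"
    proof
      fix e assume e: "e \<in> b"
      obtain v where v: "v \<in> e" using edge_pair[OF b e] by blast
      then have vo: "v \<in> outer_nodes n" using edge_outer[OF b e] by blast
      obtain k j where kj: "v = (k, j)" by (cases v)
      have "\<exists>i\<in>{1..n}. v \<in> {(c, q i), (c', i)}"
      proof (cases "k = c'")
        case True then show ?thesis using vo kj by auto
      next
        case False
        then have "k = c" using vo kj cc c by (auto simp: doubleton_eq_iff)
        moreover have "j \<in> q ` {1..n}" using surj vo kj by simp
        ultimately show ?thesis using kj by auto
      qed
      then obtain i where i: "i \<in> {1..n}" "v \<in> {(c, q i), (c', i)}" by blast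
      have "e = {(c, q i), (c', i)}" by (rule edge_unique[OF b e q1[OF i(1)] v i(2)])
      then have "e = {(c, p i), (c', i)}" using i(1) by (simp add: p_def)
      then show "e \<in> {{(c, p i), (c', i)} | i. i \<in> {1..n}}" using i(1) by blast
    qed
  qed
  ultimately show ?thesis by blast
qed

lemma has_turnbackI: "{(c, i), (c, j)} \<in> b \<Longrightarrow> has_turnback b"
  unfolding has_turnback_def by (intro bexI exI[of _ c]) auto

text \<open>By counting, a diagram with an edge inside one column has one inside the other. So
  turnbacks on either side can be detected on the right, where the left ideals are defined.\<close>

lemma turnback_right_edge:
  assumes b: "b \<in> brauer_diagrams n" and t: "has_turnback b"
  shows "\<exists>e\<in>right_edges n. e \<in> b"
proof (rule ccontr)
  assume no: "\<not> ?thesis"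
  have "{(Rgt, i), (Rgt, j)} \<notin> b" for i j
  proof
    assume e: "{(Rgt, i), (Rgt, j)} \<in> b"
    obtain w where "w \<noteq> (Rgt, i)" "{(Rgt, i), (Rgt, j)} = {(Rgt, i), w}" using edge_form[OF b e] by blast
    then have "i \<noteq> j" by auto
    moreover have "i \<in> {1..n}" "j \<in> {1..n}" using edge_outer[OF b e] by auto
    ultimately have "{(Rgt, i), (Rgt, j)} \<in> right_edges n" unfolding right_edges_def by blast
    with e no show False by blast
  qed
  then obtain p where "b = {{(Lft, p i), (Rgt, i)} | i. i \<in> {1..n}}"
    using one_sided_edge_free[OF b, of Lft Rgt] by auto
  then show False using t perm_diagram_no_turnback[of n p] by (simp add: perm_diagram_def)
qed

text \<open>A left edge of \<open>x\<close> survives in every product with \<open>x\<close> as left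
  factor. This gives closure of the turnback ideal under multiplication from the right.\<close>

lemma turnback_left_edge:
  assumes b: "b \<in> brauer_diagrams n" and t: "has_turnback b"
  shows "\<exists>i j. {(Lft, i), (Lft, j)} \<in> b \<and> i \<in> {1..n} \<and> j \<in> {1..n} \<and> i \<noteq> j"
proof (rule ccontr)
  assume no: "\<not> ?thesis"
  have "{(Lft, i), (Lft, j)} \<notin> b" for i j
  proof
    assume e: "{(Lft, i), (Lft, j)} \<in> b"
    obtain w where "w \<noteq> (Lft, i)" "{(Lft, i), (Lft, j)} = {(Lft, i), w}" using edge_form[OF b e] by blast
    then have "i \<noteq> j" by auto
    moreover have "i \<in> {1..n}" "j \<in> {1..n}" using edge_outer[OF b e] by auto
    ultimately show False using e no by blast
  qed
  then obtain p where "b = {{(Rgt, p i), (Lft, i)} | i. i \<in> {1..n}}"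
    using one_sided_edge_free[OF b, of Rgt Lft] by auto
  then show False using t by (auto simp: has_turnback_def insert_commute)
qed

lemma turnback_iff_right_edge:
  "b \<in> brauer_diagrams n \<Longrightarrow> has_turnback b \<longleftrightarrow> (\<exists>e\<in>right_edges n. e \<in> b)"
  using turnback_right_edge has_turnbackI unfolding right_edges_def by blast

lemma no_turnback_perm_diagram:
  assumes b: "b \<in> brauer_diagrams n" and t: "\<not> has_turnback b"
  shows "\<exists>\<sigma>. \<sigma> permutes {1..n} \<and> b = perm_diagram n \<sigma>"
proof -
  have "{(Rgt, i), (Rgt, j)} \<notin> b" for i j
    using t has_turnbackI by blast
  then show ?thesis
    using one_sided_edge_free[OF b, of Lft Rgt] unfolding perm_diagram_def by auto
qed

lemma comp_turnback_left:
  assumes "x \<in> brauer_diagrams n" "has_turnback x" shows "has_turnback (brauer_comp n x y)"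
proof -
  obtain i j where "{(Lft, i), (Lft, j)} \<in> brauer_comp n x y"
    using turnback_left_edge[OF assms] comp_left_edge by blast
  then show ?thesis by (rule has_turnbackI)
qed

lemma comp_turnback_right:
  assumes "y \<in> brauer_diagrams n" "has_turnback y" shows "has_turnback (brauer_comp n x y)"
proof -
  obtain e where "e \<in> right_edges n" "e \<in> brauer_comp n x y"
    using turnback_right_edge[OF assms] comp_right_edge by blast
  then show ?thesis using has_turnbackI unfolding right_edges_def by blast
qed

subsection \<open>Absorbing diagrams\<close>

text \<open>The diagram with right edge \<open>{i, j}\<close>, left edge \<open>{k, i}\<close>, an edge from \<open>j\<close> on the left to
  \<open>k\<close> on the right, and horizontal edges elsewhere. In the product with a diagram with right edge
  \<open>{i, j}\<close> the middle edges \<open>{k, i}\<close>, \<open>{i, j}\<close> and the edge from \<open>j\<close> to \<open>k\<close> join up to a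
  single path, whatever \<open>\<delta>\<close> is.\<close>

definition zigzag_partner :: "nat \<Rightarrow> nat \<Rightarrow> nat \<Rightarrow> node \<Rightarrow> node" where
  "zigzag_partner i j k v =
     (if v = (Rgt, i) then (Rgt, j) else if v = (Rgt, j) then (Rgt, i)
      else if v = (Lft, k) then (Lft, i) else if v = (Lft, i) then (Lft, k)
      else if v = (Lft, j) then (Rgt, k) else if v = (Rgt, k) then (Lft, j)
      else (if fst v = Lft then Rgt else Lft, snd v))"

definition zigzag :: "nat \<Rightarrow> nat \<Rightarrow> nat \<Rightarrow> nat \<Rightarrow> diagram" where
  "zigzag n i j k = {{v, zigzag_partner i j k v} | v. v \<in> outer_nodes n}"

context
  fixes n i j k :: nat
  assumes ijk: "i \<in> {1..n}" "j \<in> {1..n}" "k \<in> {1..n}" "i \<noteq> j" "i \<noteq> k" "j \<noteq> k"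
begin

lemma zigzag_in_brauer_diagrams: "zigzag n i j k \<in> brauer_diagrams n"
  unfolding zigzag_def
proof (rule involution_diagram)
  fix v assume v: "v \<in> outer_nodes n"
  obtain c l where cl: "v = (c, l)" by (cases v)
  from v cl have c: "c = Lft \<or> c = Rgt" and l: "l \<in> {1..n}" by auto
  consider "l = i" | "l = j" | "l = k" | "l \<noteq> i" "l \<noteq> j" "l \<noteq> k" by blast
  then show "zigzag_partner i j k v \<in> outer_nodes n \<and> zigzag_partner i j k v \<noteq> v \<and>
      zigzag_partner i j k (zigzag_partner i j k v) = v"
    using c by (elim disjE; cases) (use ijk l in \<open>simp_all add: cl zigzag_partner_def\<close>)
qed

lemma zigzag_edge: "v \<in> outer_nodes n \<Longrightarrow> {v, zigzag_partner i j k v} \<in> zigzag n i j k"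
  unfolding zigzag_def by blast

lemma zigzag_horizontal:
  assumes "l \<in> {1..n}" "l \<notin> {i, j, k}"
  shows "((Mid, l), (Rgt, l)) \<in> connected_nodes b (zigzag n i j k)"
  using connected_right[OF zigzag_edge[of "(Lft, l)"], of b] assms
  by (simp add: zigzag_partner_def)

lemma zigzag_right_edge: "{(Rgt, i), (Rgt, j)} \<in> zigzag n i j k"
  using zigzag_edge[of "(Rgt, i)"] ijk by (simp add: zigzag_partner_def)

lemma comp_zigzag_right_edge: "{(Rgt, i), (Rgt, j)} \<in> brauer_comp n b (zigzag n i j k)"
  by (rule comp_right_edge[OF _ zigzag_right_edge]) (use ijk in \<open>auto simp: right_edges_def\<close>)

text \<open>The zigzag is horizontal away from \<open>i\<close>, \<open>j\<close> and
  \<open>k\<close>, so right edges of \<open>b\<close> that avoid these nodes pass through it. This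
  keeps the edges already secured when one more zigzag is multiplied on.\<close>

lemma comp_zigzag_other_edge:
  assumes e: "{(Rgt, p), (Rgt, q)} \<in> b" "p \<in> {1..n}" "q \<in> {1..n}" "p \<noteq> q"
    and pq: "p \<notin> {i, j, k}" "q \<notin> {i, j, k}"
  shows "{(Rgt, p), (Rgt, q)} \<in> brauer_comp n b (zigzag n i j k)"
proof (rule compI)
  have "((Mid, p), (Mid, q)) \<in> connected_nodes b (zigzag n i j k)"
    using connected_left[OF e(1), of "zigzag n i j k"] by simp
  then show "((Rgt, p), (Rgt, q)) \<in> connected_nodes b (zigzag n i j k)"
    using zigzag_horizontal[OF e(2) pq(1)] zigzag_horizontal[OF e(3) pq(2)]
      connected_sym connected_trans by metis
qed (use e in auto)

context
  fixes b assumes b: "b \<in> brauer_diagrams n" and ij: "{(Rgt, i), (Rgt, j)} \<in> b"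
begin

text \<open>The middle nodes \<open>k\<close>, \<open>i\<close>, \<open>j\<close> lie in this order
  on one path, which ends in the right node \<open>k\<close>; every other middle node has a
  horizontal edge. So each middle node reaches the right column and no loop can form.\<close>

lemma zigzag_mid:
  assumes "l \<in> {1..n}"
  shows "((Mid, l), (Rgt, if l \<in> {i, j} then k else l)) \<in> connected_nodes b (zigzag n i j k)"
proof -
  have 1: "((Mid, j), (Rgt, k)) \<in> connected_nodes b (zigzag n i j k)"
    using connected_right[OF zigzag_edge[of "(Lft, j)"], of b] ijk by (simp add: zigzag_partner_def)
  have 2: "((Mid, k), (Mid, i)) \<in> connected_nodes b (zigzag n i j k)"
    using connected_right[OF zigzag_edge[of "(Lft, k)"], of b] ijk by (simp add: zigzag_partner_def)
  have 3: "((Mid, i), (Mid, j)) \<in> connected_nodes b (zigzag n i j k)"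
    using connected_left[OF ij, of "zigzag n i j k"] by simp
  have 4: "((Mid, i), (Rgt, k)) \<in> connected_nodes b (zigzag n i j k)"
    using 3 1 by (rule connected_trans)
  have 5: "((Mid, k), (Rgt, k)) \<in> connected_nodes b (zigzag n i j k)"
    using 2 4 by (rule connected_trans)
  consider "l = i" | "l = j" | "l = k" | "l \<notin> {i, j, k}" by blast
  then show ?thesis
  proof cases
    case 4 with zigzag_horizontal[OF assms, of b] show ?thesis by simp
  qed (use ijk 1 4 5 in simp_all)
qed

lemma zigzag_loops: "brauer_loops n b (zigzag n i j k) = 0"
proof (rule no_loops)
  fix l assume "l \<in> {1..n}"
  from zigzag_mid[OF this] show "\<exists>c l'. c \<noteq> Mid \<and> ((Mid, l), (c, l')) \<in> connected_nodes b (zigzag n i j k)"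
    by (intro exI[of _ Rgt] exI conjI) simp
qed

text \<open>The edge of \<open>b\<close> at the right node \<open>k\<close> is carried along the
  path through \<open>i\<close> and \<open>j\<close> back to \<open>k\<close>, the right edge of the
  zigzag restores the edge between \<open>i\<close> and \<open>j\<close>, and the remaining edges of
  \<open>b\<close> continue horizontally.\<close>

lemma zigzag_absorb: "brauer_comp n b (zigzag n i j k) = b"
proof
  define part where "part v = (THE e. e \<in> b \<and> v \<in> e)" for v
  have part: "part v = e" if "e \<in> b" "v \<in> e" for v e
    unfolding part_def
  proof (rule the_equality)
    show "e \<in> b \<and> v \<in> e" using that by blast
    show "f = e" if "f \<in> b \<and> v \<in> f" for f
      using edge_unique[OF b] that \<open>e \<in> b\<close> \<open>v \<in> e\<close> by blast
  qed
  \<comment> \<open>The label of a node is the edge of \<open>b\<close> to which its component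
    belongs. The middle nodes \<open>i\<close> and \<open>j\<close> get the label of
    \<open>k\<close>, since in the product they are interior to the path that continues the edge of
    \<open>b\<close> at \<open>k\<close>.\<close>
  define L where "L v = (if fst v = Mid then part (Rgt, if snd v \<in> {i, j} then k else snd v) else part v)" for v
  have ijp: "part (Rgt, i) = part (Rgt, j)" using part[OF ij] by simp
  have label: "L u = L v" if "(u, v) \<in> connected_nodes b (zigzag n i j k)" for u v
  proof (rule connected_label[OF _ _ that])
    fix e assume e: "e \<in> b"
    obtain v w where vw: "e = {v, w}" "v \<noteq> w" "v \<in> outer_nodes n" "w \<in> outer_nodes n"
      using edge_pair[OF b e] by blast
    have same: "part v = part w" using part[OF e] vw by simp
    show "\<exists>u v. e = {u, v} \<and> L (place_left u) = L (place_left v)"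
    proof (cases "(Rgt, i) \<in> e \<or> (Rgt, j) \<in> e")
      case True
      then have "e = {(Rgt, i), (Rgt, j)}" using edge_unique[OF b e ij] by blast
      then show ?thesis
        by (intro exI[of _ "(Rgt, i)"] exI[of _ "(Rgt, j)"] conjI) (simp_all add: L_def)
    next
      case False
      have "L (place_left u) = part u" if "u \<in> outer_nodes n" "u \<noteq> (Rgt, i)" "u \<noteq> (Rgt, j)" for u
        using that by (cases u) (auto simp: L_def)
      then have "L (place_left v) = part v" "L (place_left w) = part w" using vw False by blast+
      then show ?thesis using vw(1) same by (intro exI[of _ v] exI[of _ w] conjI) simp_all
    qed
  next
    fix e assume "e \<in> zigzag n i j k"
    then obtain v where v: "v \<in> outer_nodes n" "e = {v, zigzag_partner i j k v}"
      unfolding zigzag_def by blast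
    obtain c l where cl: "v = (c, l)" by (cases v)
    have c: "c = Lft \<or> c = Rgt" using v(1) cl by simp
    consider "l = i" | "l = j" | "l = k" | "l \<noteq> i" "l \<noteq> j" "l \<noteq> k" by blast
    then have "L (place_right v) = L (place_right (zigzag_partner i j k v))"
      using c by (elim disjE; cases) (use ijk ijp in \<open>simp_all add: cl L_def zigzag_partner_def\<close>)
    then show "\<exists>u v. e = {u, v} \<and> L (place_right u) = L (place_right v)" using v by blast
  qed
  show "brauer_comp n b (zigzag n i j k) \<subseteq> b"
  proof
    fix e assume "e \<in> brauer_comp n b (zigzag n i j k)"
    then obtain u v where e: "e = {u, v}" "u \<in> outer_nodes n" "v \<in> outer_nodes n" "u \<noteq> v"
      and c: "(u, v) \<in> connected_nodes b (zigzag n i j k)"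
      unfolding brauer_comp_def by blast
    have "L w = part w" if "w \<in> outer_nodes n" for w
      using that by (cases w) (auto simp: L_def)
    then have uv: "part u = part v" using label[OF c] e by metis
    obtain f where f: "f \<in> b" "u \<in> f" using edge_exists[OF b e(2)] by blast
    obtain g where g: "g \<in> b" "v \<in> g" using edge_exists[OF b e(3)] by blast
    have "f = g" using part[OF f] part[OF g] uv by simp
    obtain w where "f = {u, w}" using edge_form[OF b f] by blast
    then have "f = e" using g \<open>f = g\<close> e by auto
    then show "e \<in> b" using f by simp
  qed
  show "b \<subseteq> brauer_comp n b (zigzag n i j k)"
  proof
    fix e assume e: "e \<in> b"
    show "e \<in> brauer_comp n b (zigzag n i j k)"
    proof (cases "(Rgt, i) \<in> e \<or> (Rgt, j) \<in> e")
      case True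
      then have "e = {(Rgt, i), (Rgt, j)}" using edge_unique[OF b e ij] by blast
      then show ?thesis using comp_zigzag_right_edge by simp
    next
      case False
      obtain v w where vw: "e = {v, w}" "v \<noteq> w" "v \<in> outer_nodes n" "w \<in> outer_nodes n"
        using edge_pair[OF b e] by blast
      have step: "(place_left u, u) \<in> connected_nodes b (zigzag n i j k)"
        if u: "u \<in> outer_nodes n" "u \<noteq> (Rgt, i)" "u \<noteq> (Rgt, j)" for u
      proof (cases "fst u = Lft")
        case True then show ?thesis by (cases u) simp
      next
        case False
        then obtain l where l: "u = (Rgt, l)" "l \<in> {1..n}" "l \<noteq> i" "l \<noteq> j"
          using u by (cases u) auto
        then show ?thesis using zigzag_mid[OF l(2)] by simp
      qed
      have "(place_left v, place_left w) \<in> connected_nodes b (zigzag n i j k)"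
        using connected_left e vw by blast
      then have "(v, w) \<in> connected_nodes b (zigzag n i j k)"
        using step[OF vw(3)] step[OF vw(4)] False vw(1) connected_sym connected_trans
        by (metis insertCI)
      then show ?thesis unfolding vw(1) using vw by (intro compI)
    qed
  qed
qed

end

end

text \<open>The only use of parity: the edges in \<open>S\<close> are disjoint pairs and cover an
  even number of right nodes.\<close>

lemma unmatched_node:
  assumes b: "b \<in> brauer_diagrams n" and S: "S \<subseteq> b" "S \<subseteq> right_edges n" and "odd n"
  shows "\<exists>k\<in>{1..n}. (Rgt, k) \<notin> \<Union>S"
proof (rule ccontr)
  assume "\<not> ?thesis"
  then have "\<Union>S = {Rgt} \<times> {1..n}" using S(2) by (auto simp: right_edges_def)
  then have "card (\<Union>S) = n" by (simp add: card_cartesian_product)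
  moreover have "card (\<Union>S) = sum card S"
  proof (rule card_Union_disjoint)
    show "pairwise disjnt S" using edge_unique[OF b] S(1) by (auto simp: pairwise_def disjnt_iff) blast+
    show "finite e" if "e \<in> S" for e using that S(2) by (auto simp: right_edges_def)
  qed
  moreover have "sum card S = 2 * card S"
  proof -
    have "card e = 2" if "e \<in> S" for e using that S(1) b by (auto simp: brauer_diagrams_def)
    then show ?thesis by simp
  qed
  ultimately have "n = 2 * card S" by metis
  then show False using \<open>odd n\<close> by simp
qed

section \<open>Algebras with a finite basis\<close>

text \<open>The ring axioms enter as an assumption and will be read off the given resolutions.
  \<open>m\<close> is not assumed to map into \<open>X\<close>, so the closure conditions on sets of
  basis elements below carry the premise that the product lies in \<open>X\<close>.\<close>

locale finite_basis_algebra =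
  fixes R :: "('r, 'e) ring_scheme" and X :: "'x set" and c :: "'x \<Rightarrow> 'x \<Rightarrow> 'r"
    and m :: "'x \<Rightarrow> 'x \<Rightarrow> 'x" and u :: 'x
  assumes cring_R: "cring R" and finite_X: "finite X" and u_X: "u \<in> X"
    and c_closed: "\<And>x y. c x y \<in> carrier R"
    and ring_op: "ring (op_ring (basis_algebra R X c m u))"
begin

sublocale R: cring R by (rule cring_R)

abbreviation "A \<equiv> basis_algebra R X c m u"

sublocale B: ring "op_ring A" by (rule ring_op)

lemma carrier_A: "carrier A = X \<rightarrow>\<^sub>E carrier R"
  using finite_subset[OF supp_subset finite_X] by (auto simp: basis_algebra_def)

lemma A_simps [simp]:
  "zero A = (\<lambda>x\<in>X. \<zero>\<^bsub>R\<^esub>)" "f \<oplus>\<^bsub>A\<^esub> g = (\<lambda>x\<in>X. f x \<oplus>\<^bsub>R\<^esub> g x)"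
  "r \<odot>\<^bsub>A\<^esub> f = (\<lambda>x\<in>X. r \<otimes>\<^bsub>R\<^esub> f x)" "one A = basis_elt R X u"
  by (simp_all add: basis_algebra_def)

lemma A_closed: "\<lbrakk>f \<in> carrier A; x \<in> X\<rbrakk> \<Longrightarrow> f x \<in> carrier R"
  by (auto simp: carrier_A)

lemma A_ext: "\<lbrakk>f \<in> carrier A; g \<in> carrier A; \<And>x. x \<in> X \<Longrightarrow> f x = g x\<rbrakk> \<Longrightarrow> f = g"
  unfolding carrier_A by (rule PiE_ext)

lemma basis_elt_A: "x \<in> X \<Longrightarrow> basis_elt R X x \<in> carrier A"
  by (auto simp: carrier_A basis_elt_def)

lemma mult_A_closed: "\<lbrakk>f \<in> carrier A; g \<in> carrier A\<rbrakk> \<Longrightarrow> f \<otimes>\<^bsub>A\<^esub> g \<in> carrier A"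
  using B.m_closed[of g f] by simp

lemma add_A_closed: "\<lbrakk>f \<in> carrier A; g \<in> carrier A\<rbrakk> \<Longrightarrow> f \<oplus>\<^bsub>A\<^esub> g \<in> carrier A"
  using B.a_closed[of f g] by simp

lemma smult_A_closed: "\<lbrakk>r \<in> carrier R; f \<in> carrier A\<rbrakk> \<Longrightarrow> r \<odot>\<^bsub>A\<^esub> f \<in> carrier A"
  by (auto simp: carrier_A)

lemma mult_A_assoc:
  "\<lbrakk>f \<in> carrier A; g \<in> carrier A; h \<in> carrier A\<rbrakk> \<Longrightarrow> (f \<otimes>\<^bsub>A\<^esub> g) \<otimes>\<^bsub>A\<^esub> h = f \<otimes>\<^bsub>A\<^esub> (g \<otimes>\<^bsub>A\<^esub> h)"
  using B.m_assoc[of h g f] by simp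

lemma mult_A_one: "f \<in> carrier A \<Longrightarrow> f \<otimes>\<^bsub>A\<^esub> \<one>\<^bsub>A\<^esub> = f" "f \<in> carrier A \<Longrightarrow> \<one>\<^bsub>A\<^esub> \<otimes>\<^bsub>A\<^esub> f = f"
  using B.l_one[of f] B.r_one[of f] by simp_all

lemma fibre_term_closed:
  assumes "f \<in> carrier A" "g \<in> carrier A"
  shows "(\<lambda>p. c (fst p) (snd p) \<otimes>\<^bsub>R\<^esub> (f (fst p) \<otimes>\<^bsub>R\<^esub> g (snd p))) \<in> {p \<in> X \<times> X. m (fst p) (snd p) = z} \<rightarrow> carrier R"
  using assms by (auto simp: A_closed c_closed)

text \<open>The defining sum runs over the supports of the factors. The full fibre of
  \<open>m\<close> is an index set independent of \<open>f\<close> and \<open>g\<close>, and adding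
  it costs only zero terms.\<close>

lemma mult_A:
  assumes f: "f \<in> carrier A" and g: "g \<in> carrier A" and z: "z \<in> X"
  shows "(f \<otimes>\<^bsub>A\<^esub> g) z = (\<Oplus>\<^bsub>R\<^esub>p\<in>{p \<in> X \<times> X. m (fst p) (snd p) = z}.
    c (fst p) (snd p) \<otimes>\<^bsub>R\<^esub> (f (fst p) \<otimes>\<^bsub>R\<^esub> g (snd p)))"
proof -
  have "(f \<otimes>\<^bsub>A\<^esub> g) z = (\<Oplus>\<^bsub>R\<^esub>p\<in>{p \<in> supp R X f \<times> supp R X g. m (fst p) (snd p) = z}.
      c (fst p) (snd p) \<otimes>\<^bsub>R\<^esub> (f (fst p) \<otimes>\<^bsub>R\<^esub> g (snd p)))"
    using z by (simp add: basis_algebra_def)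
  also have "\<dots> = (\<Oplus>\<^bsub>R\<^esub>p\<in>{p \<in> X \<times> X. m (fst p) (snd p) = z}.
      c (fst p) (snd p) \<otimes>\<^bsub>R\<^esub> (f (fst p) \<otimes>\<^bsub>R\<^esub> g (snd p)))"
  proof (rule R.add.finprod_mono_neutral_cong_left[OF _ _ _ refl fibre_term_closed[OF f g]])
    show "finite {p \<in> X \<times> X. m (fst p) (snd p) = z}" using finite_X by simp
    show "{p \<in> supp R X f \<times> supp R X g. m (fst p) (snd p) = z} \<subseteq> {p \<in> X \<times> X. m (fst p) (snd p) = z}"
      by (auto simp: supp_def)
    fix p assume p: "p \<in> {p \<in> X \<times> X. m (fst p) (snd p) = z} - {p \<in> supp R X f \<times> supp R X g. m (fst p) (snd p) = z}"
    then have "fst p \<in> X" "snd p \<in> X" "f (fst p) = \<zero>\<^bsub>R\<^esub> \<or> g (snd p) = \<zero>\<^bsub>R\<^esub>"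
      by (auto simp: supp_def)
    then show "c (fst p) (snd p) \<otimes>\<^bsub>R\<^esub> (f (fst p) \<otimes>\<^bsub>R\<^esub> g (snd p)) = \<zero>\<^bsub>R\<^esub>"
      using A_closed[OF f] A_closed[OF g] c_closed by auto
  qed
  finally show ?thesis .
qed

text \<open>A nonzero coefficient of a product has a source in both factors. The absorption
  properties of spans of basis elements are derived from this without computing any sum.\<close>

lemma mult_A_supp:
  assumes f: "f \<in> carrier A" and g: "g \<in> carrier A" and z: "z \<in> X" and nz: "(f \<otimes>\<^bsub>A\<^esub> g) z \<noteq> \<zero>\<^bsub>R\<^esub>"
  shows "\<exists>x\<in>X. \<exists>y\<in>X. f x \<noteq> \<zero>\<^bsub>R\<^esub> \<and> g y \<noteq> \<zero>\<^bsub>R\<^esub> \<and> m x y = z"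
proof (rule ccontr)
  assume no: "\<not> ?thesis"
  have "(f \<otimes>\<^bsub>A\<^esub> g) z = \<zero>\<^bsub>R\<^esub>"
    unfolding mult_A[OF f g z]
  proof (rule R.add.finprod_one_eqI)
    fix p assume "p \<in> {p \<in> X \<times> X. m (fst p) (snd p) = z}"
    then have p: "fst p \<in> X" "snd p \<in> X" "m (fst p) (snd p) = z" by auto
    then have "f (fst p) = \<zero>\<^bsub>R\<^esub> \<or> g (snd p) = \<zero>\<^bsub>R\<^esub>" using no by blast
    then show "c (fst p) (snd p) \<otimes>\<^bsub>R\<^esub> (f (fst p) \<otimes>\<^bsub>R\<^esub> g (snd p)) = \<zero>\<^bsub>R\<^esub>"
      using p A_closed[OF f] A_closed[OF g] c_closed by auto
  qed
  with nz show False by simp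
qed

lemma smult_mult_A:
  assumes r: "r \<in> carrier R" and f: "f \<in> carrier A" and g: "g \<in> carrier A"
  shows "(r \<odot>\<^bsub>A\<^esub> f) \<otimes>\<^bsub>A\<^esub> g = r \<odot>\<^bsub>A\<^esub> (f \<otimes>\<^bsub>A\<^esub> g)"
proof (rule A_ext)
  note rf = smult_A_closed[OF r f] and fg = mult_A_closed[OF f g]
  show "(r \<odot>\<^bsub>A\<^esub> f) \<otimes>\<^bsub>A\<^esub> g \<in> carrier A" by (rule mult_A_closed[OF rf g])
  show "r \<odot>\<^bsub>A\<^esub> (f \<otimes>\<^bsub>A\<^esub> g) \<in> carrier A" by (rule smult_A_closed[OF r fg])
  fix z assume z: "z \<in> X"
  let ?Y = "{p \<in> X \<times> X. m (fst p) (snd p) = z}"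
  let ?t = "\<lambda>p. c (fst p) (snd p) \<otimes>\<^bsub>R\<^esub> (f (fst p) \<otimes>\<^bsub>R\<^esub> g (snd p))"
  have "((r \<odot>\<^bsub>A\<^esub> f) \<otimes>\<^bsub>A\<^esub> g) z = (\<Oplus>\<^bsub>R\<^esub>p\<in>?Y. r \<otimes>\<^bsub>R\<^esub> ?t p)"
    unfolding mult_A[OF rf g z]
  proof (rule R.finsum_cong'[OF refl])
    show "(\<lambda>p. r \<otimes>\<^bsub>R\<^esub> ?t p) \<in> ?Y \<rightarrow> carrier R"
      by (rule funcsetI, rule R.m_closed[OF r], erule funcset_mem[OF fibre_term_closed[OF f g]])
    show "c (fst p) (snd p) \<otimes>\<^bsub>R\<^esub> ((r \<odot>\<^bsub>A\<^esub> f) (fst p) \<otimes>\<^bsub>R\<^esub> g (snd p)) = r \<otimes>\<^bsub>R\<^esub> ?t p"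
      if "p \<in> ?Y" for p
    proof -
      have p: "fst p \<in> X" "snd p \<in> X" using that by auto
      note cl = A_closed[OF f p(1)] A_closed[OF g p(2)] c_closed[of "fst p" "snd p"]
      show ?thesis using p r cl by (simp add: R.m_lcomm[of r] R.m_assoc)
    qed
  qed
  also have "\<dots> = r \<otimes>\<^bsub>R\<^esub> (f \<otimes>\<^bsub>A\<^esub> g) z"
    unfolding mult_A[OF f g z]
    by (rule R.finsum_rdistr[symmetric, OF _ r fibre_term_closed[OF f g]]) (use finite_X in simp)
  also have "\<dots> = (r \<odot>\<^bsub>A\<^esub> (f \<otimes>\<^bsub>A\<^esub> g)) z" using z by simp
  finally show "((r \<odot>\<^bsub>A\<^esub> f) \<otimes>\<^bsub>A\<^esub> g) z = (r \<odot>\<^bsub>A\<^esub> (f \<otimes>\<^bsub>A\<^esub> g)) z" .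
qed

lemma unit_ring_hom: "(\<lambda>r. r \<odot>\<^bsub>A\<^esub> \<one>\<^bsub>A\<^esub>) \<in> ring_hom R (op_ring A)"
proof (rule ring_hom_memI)
  have one: "\<one>\<^bsub>A\<^esub> \<in> carrier A" using B.one_closed by (simp only: op_ring_simps)
  have oneX: "\<one>\<^bsub>A\<^esub> x \<in> carrier R" if "x \<in> X" for x by (rule A_closed[OF one that])
  fix r assume r: "r \<in> carrier R"
  show "r \<odot>\<^bsub>A\<^esub> \<one>\<^bsub>A\<^esub> \<in> carrier (op_ring A)" using smult_A_closed[OF r one] by simp
  fix s assume s: "s \<in> carrier R"
  show "(r \<oplus>\<^bsub>R\<^esub> s) \<odot>\<^bsub>A\<^esub> \<one>\<^bsub>A\<^esub> = r \<odot>\<^bsub>A\<^esub> \<one>\<^bsub>A\<^esub> \<oplus>\<^bsub>op_ring A\<^esub> s \<odot>\<^bsub>A\<^esub> \<one>\<^bsub>A\<^esub>"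
    using r s oneX by (auto simp: R.l_distr intro!: restrict_ext)
  have "(s \<odot>\<^bsub>A\<^esub> \<one>\<^bsub>A\<^esub>) \<otimes>\<^bsub>A\<^esub> (r \<odot>\<^bsub>A\<^esub> \<one>\<^bsub>A\<^esub>) = s \<odot>\<^bsub>A\<^esub> (r \<odot>\<^bsub>A\<^esub> \<one>\<^bsub>A\<^esub>)"
    unfolding smult_mult_A[OF s one smult_A_closed[OF r one]] mult_A_one(2)[OF smult_A_closed[OF r one]] ..
  also have "\<dots> = (r \<otimes>\<^bsub>R\<^esub> s) \<odot>\<^bsub>A\<^esub> \<one>\<^bsub>A\<^esub>"
    using r s oneX by (auto simp: R.m_ac intro!: restrict_ext)
  finally show "(r \<otimes>\<^bsub>R\<^esub> s) \<odot>\<^bsub>A\<^esub> \<one>\<^bsub>A\<^esub> = (r \<odot>\<^bsub>A\<^esub> \<one>\<^bsub>A\<^esub>) \<otimes>\<^bsub>op_ring A\<^esub> (s \<odot>\<^bsub>A\<^esub> \<one>\<^bsub>A\<^esub>)"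
    by (simp only: op_ring_simps)
next
  have one: "\<one>\<^bsub>A\<^esub> \<in> carrier A" using B.one_closed by (simp only: op_ring_simps)
  have "\<one>\<^bsub>R\<^esub> \<odot>\<^bsub>A\<^esub> \<one>\<^bsub>A\<^esub> = \<one>\<^bsub>A\<^esub>"
    by (rule A_ext[OF smult_A_closed[OF R.one_closed one] one]) (use A_closed[OF one] in simp)
  then show "\<one>\<^bsub>R\<^esub> \<odot>\<^bsub>A\<^esub> \<one>\<^bsub>A\<^esub> = \<one>\<^bsub>op_ring A\<^esub>" by (simp only: op_ring_simps)
qed

section \<open>Characters and the scalar modules they define\<close>

definition character :: "('x \<Rightarrow> 'r) \<Rightarrow> ('x \<Rightarrow> 'r) \<Rightarrow> 'r" where
  "character \<chi> f = (\<Oplus>\<^bsub>R\<^esub>x\<in>supp R X f. f x \<otimes>\<^bsub>R\<^esub> \<chi> x)"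

context
  fixes \<chi> :: "'x \<Rightarrow> 'r" assumes \<chi>: "\<And>x. \<chi> x \<in> carrier R"
begin

lemma character_eq:
  assumes f: "f \<in> carrier A" shows "character \<chi> f = (\<Oplus>\<^bsub>R\<^esub>x\<in>X. f x \<otimes>\<^bsub>R\<^esub> \<chi> x)"
  unfolding character_def
proof (rule R.add.finprod_mono_neutral_cong_left[OF finite_X supp_subset _ refl])
  show "f x \<otimes>\<^bsub>R\<^esub> \<chi> x = \<zero>\<^bsub>R\<^esub>" if "x \<in> X - supp R X f" for x
    using that \<chi> by (simp add: supp_def)
  show "(\<lambda>x. f x \<otimes>\<^bsub>R\<^esub> \<chi> x) \<in> X \<rightarrow> carrier R" using A_closed[OF f] \<chi> by simp
qed

lemma character_closed: "f \<in> carrier A \<Longrightarrow> character \<chi> f \<in> carrier R"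
  unfolding character_eq using A_closed \<chi> by (intro R.finsum_closed) simp

lemma character_smult:
  assumes r: "r \<in> carrier R" and f: "f \<in> carrier A"
  shows "character \<chi> (r \<odot>\<^bsub>A\<^esub> f) = r \<otimes>\<^bsub>R\<^esub> character \<chi> f"
proof -
  have fx: "(\<lambda>x. f x \<otimes>\<^bsub>R\<^esub> \<chi> x) \<in> X \<rightarrow> carrier R" using A_closed[OF f] \<chi> by simp
  have "character \<chi> (r \<odot>\<^bsub>A\<^esub> f) = (\<Oplus>\<^bsub>R\<^esub>x\<in>X. r \<otimes>\<^bsub>R\<^esub> (f x \<otimes>\<^bsub>R\<^esub> \<chi> x))"
    unfolding character_eq[OF smult_A_closed[OF r f]]
    by (rule R.finsum_cong'[OF refl]) (use r A_closed[OF f] \<chi> in \<open>simp_all add: R.m_assoc\<close>)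
  also have "\<dots> = r \<otimes>\<^bsub>R\<^esub> character \<chi> f"
    unfolding character_eq[OF f] by (rule R.finsum_rdistr[symmetric, OF finite_X r fx])
  finally show ?thesis .
qed

lemma smult_scalar_module: "a \<odot>\<^bsub>scalar_module R X \<chi>\<^esub> r = character \<chi> a \<otimes>\<^bsub>R\<^esub> r"
  by (simp add: scalar_module_def character_def)

text \<open>That the character is a ring homomorphism is not computed from the basis: it is the
  module axioms of the scalar module evaluated at the element 1.\<close>

lemma augmented_algebra:
  assumes N: "lmodule (op_ring A) (scalar_module R X \<chi>)"
  shows "augmented_algebra R A (scalar_module R X \<chi>) (character \<chi>)"
proof -
  interpret N: lmodule "op_ring A" "scalar_module R X \<chi>" by (rule N)
  have N_simps: "carrier (scalar_module R X \<chi>) = carrier R" "add (scalar_module R X \<chi>) = add R"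
    by (simp_all add: scalar_module_def)
  have one: "\<one>\<^bsub>A\<^esub> \<in> carrier A" using B.one_closed by (simp only: op_ring_simps)
  have \<chi>1: "character \<chi> \<one>\<^bsub>A\<^esub> = \<one>\<^bsub>R\<^esub>"
    using N.smult_one[of "\<one>\<^bsub>R\<^esub>"] character_closed[OF one]
    by (simp only: N_simps smult_scalar_module op_ring_simps R.one_closed R.r_one)
  have hom: "character \<chi> \<in> ring_hom (op_ring A) R"
  proof (rule ring_hom_memI)
    fix a assume a: "a \<in> carrier (op_ring A)"
    then show a': "character \<chi> a \<in> carrier R" using character_closed by simp
    fix b assume b: "b \<in> carrier (op_ring A)"
    then have b': "character \<chi> b \<in> carrier R" using character_closed by simp
    have ab: "character \<chi> (a \<otimes>\<^bsub>op_ring A\<^esub> b) \<in> carrier R" "character \<chi> (a \<oplus>\<^bsub>op_ring A\<^esub> b) \<in> carrier R"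
      using character_closed B.m_closed[OF a b] B.a_closed[OF a b] by (simp_all only: op_ring_simps)
    show "character \<chi> (a \<otimes>\<^bsub>op_ring A\<^esub> b) = character \<chi> a \<otimes>\<^bsub>R\<^esub> character \<chi> b"
      using N.smult_assoc[OF a b, of "\<one>\<^bsub>R\<^esub>"] a' b' ab
      by (simp only: N_simps smult_scalar_module R.one_closed R.r_one)
    show "character \<chi> (a \<oplus>\<^bsub>op_ring A\<^esub> b) = character \<chi> a \<oplus>\<^bsub>R\<^esub> character \<chi> b"
      using N.smult_l_distr[OF a b, of "\<one>\<^bsub>R\<^esub>"] a' b' ab
      by (simp only: N_simps smult_scalar_module R.one_closed R.r_one)
  qed (simp only: op_ring_simps \<chi>1)
  show ?thesis
  proof (rule augmented_algebra.intro[OF cring_R unit_ring_hom hom])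
    show "character \<chi> (r \<odot>\<^bsub>A\<^esub> \<one>\<^bsub>A\<^esub>) = r" if "r \<in> carrier R" for r
      using character_smult[OF that one] \<chi>1 that by (simp only: R.r_one)
  qed (simp_all only: N_simps smult_scalar_module)
qed

end

section \<open>Spans of sets of basis elements\<close>

definition supported :: "'x set \<Rightarrow> ('x \<Rightarrow> 'r) set" where
  "supported D = {f \<in> carrier A. \<forall>x\<in>X. x \<notin> D \<longrightarrow> f x = \<zero>\<^bsub>R\<^esub>}"

lemma supported_closed: "supported D \<subseteq> carrier A"
  by (auto simp: supported_def)

lemma supported_mono: "D \<inter> X \<subseteq> D' \<Longrightarrow> supported D \<subseteq> supported D'"
  by (auto simp: supported_def)

text \<open>Immediate because spans are described by vanishing coefficients. It is the reason why
  intersections of the left ideals attached to edge sets are again of this kind.\<close>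

lemma supported_Int: "supported D \<inter> supported D' = supported (D \<inter> D')"
  by (auto simp: supported_def)

lemma supported_empty: "D \<inter> X = {} \<Longrightarrow> supported D = {\<zero>\<^bsub>op_ring A\<^esub>}"
proof -
  assume D: "D \<inter> X = {}"
  have z: "\<zero>\<^bsub>A\<^esub> \<in> carrier A" using B.zero_closed by (simp only: op_ring_simps)
  have "f = \<zero>\<^bsub>A\<^esub>" if "f \<in> supported D" for f
    by (rule A_ext[OF _ z]) (use that D in \<open>auto simp: supported_def\<close>)
  moreover have "\<zero>\<^bsub>A\<^esub> \<in> supported D" using z by (auto simp: supported_def)
  ultimately show ?thesis unfolding op_ring_simps by blast
qed

lemma supported_mult_left:
  assumes D: "\<And>x y. \<lbrakk>x \<in> X; y \<in> X; y \<in> D; m x y \<in> X\<rbrakk> \<Longrightarrow> m x y \<in> D"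
    and f: "f \<in> carrier A" and g: "g \<in> supported D"
  shows "f \<otimes>\<^bsub>A\<^esub> g \<in> supported D"
proof -
  have gA: "g \<in> carrier A" using g supported_closed by blast
  have "(f \<otimes>\<^bsub>A\<^esub> g) z = \<zero>\<^bsub>R\<^esub>" if z: "z \<in> X" "z \<notin> D" for z
  proof (rule ccontr)
    assume "(f \<otimes>\<^bsub>A\<^esub> g) z \<noteq> \<zero>\<^bsub>R\<^esub>"
    then obtain x y where "x \<in> X" "y \<in> X" "g y \<noteq> \<zero>\<^bsub>R\<^esub>" "m x y = z"
      using mult_A_supp[OF f gA z(1)] by blast
    then show False using D[of x y] z g by (auto simp: supported_def)
  qed
  then show ?thesis using mult_A_closed[OF f gA] by (simp add: supported_def)
qed

lemma supported_mult_right: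
  assumes D: "\<And>x y. \<lbrakk>x \<in> X; y \<in> X; x \<in> D; m x y \<in> X\<rbrakk> \<Longrightarrow> m x y \<in> D"
    and f: "f \<in> carrier A" and g: "g \<in> supported D"
  shows "g \<otimes>\<^bsub>A\<^esub> f \<in> supported D"
proof -
  have gA: "g \<in> carrier A" using g supported_closed by blast
  have "(g \<otimes>\<^bsub>A\<^esub> f) z = \<zero>\<^bsub>R\<^esub>" if z: "z \<in> X" "z \<notin> D" for z
  proof (rule ccontr)
    assume "(g \<otimes>\<^bsub>A\<^esub> f) z \<noteq> \<zero>\<^bsub>R\<^esub>"
    then obtain x y where "x \<in> X" "y \<in> X" "g x \<noteq> \<zero>\<^bsub>R\<^esub>" "m x y = z"
      using mult_A_supp[OF gA f z(1)] by blast
    then show False using D[of x y] z g by (auto simp: supported_def)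
  qed
  then show ?thesis using mult_A_closed[OF gA f] by (simp add: supported_def)
qed

lemma right_ideal_supported:
  assumes D: "\<And>x y. \<lbrakk>x \<in> X; y \<in> X; y \<in> D; m x y \<in> X\<rbrakk> \<Longrightarrow> m x y \<in> D"
  shows "right_ideal (op_ring A) (supported D)"
proof -
  have "\<zero>\<^bsub>A\<^esub> \<in> supported D" using B.zero_closed by (auto simp: supported_def)
  moreover have "f \<oplus>\<^bsub>A\<^esub> g \<in> supported D" if "f \<in> supported D" "g \<in> supported D" for f g
    using that add_A_closed[of f g] by (auto simp: supported_def)
  ultimately show ?thesis
    using supported_closed supported_mult_left[OF D]
    by (simp add: right_ideal_def del: A_simps)
qed

lemma supported_Un:
  assumes a: "a \<in> supported (D \<union> D')"
  shows "\<exists>b\<in>supported D. \<exists>c\<in>supported D'. a = b \<oplus>\<^bsub>op_ring A\<^esub> c"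
proof -
  let ?b = "\<lambda>x\<in>X. if x \<in> D then a x else \<zero>\<^bsub>R\<^esub>" and ?c = "\<lambda>x\<in>X. if x \<in> D then \<zero>\<^bsub>R\<^esub> else a x"
  have aA: "a \<in> carrier A" using a supported_closed by blast
  note ax = A_closed[OF aA]
  have b: "?b \<in> supported D" using ax by (auto simp: supported_def carrier_A)
  have c: "?c \<in> supported D'" using ax a by (auto simp: supported_def carrier_A)
  have "a = ?b \<oplus>\<^bsub>A\<^esub> ?c"
  proof (rule A_ext[OF aA add_A_closed])
    show "?b \<in> carrier A" "?c \<in> carrier A" using b c supported_closed by blast+
    show "a x = (?b \<oplus>\<^bsub>A\<^esub> ?c) x" if "x \<in> X" for x using that ax[OF that] by simp
  qed
  then show ?thesis using b c by (intro bexI[of _ ?b] bexI[of _ ?c]) (simp_all only: op_ring_simps)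
qed

text \<open>In the coefficient at \<open>z\<close> only the pair \<open>(z, w)\<close> can
  contribute, since \<open>x w = x\<close> for all \<open>x\<close> in \<open>D\<close>; it does so
  with factor 1.\<close>

lemma supported_absorb:
  assumes w: "w \<in> X" and D: "\<And>x. \<lbrakk>x \<in> X; x \<in> D\<rbrakk> \<Longrightarrow> m x w = x \<and> c x w = \<one>\<^bsub>R\<^esub>"
    and a: "a \<in> supported D"
  shows "a \<otimes>\<^bsub>A\<^esub> basis_elt R X w = a"
proof (rule A_ext)
  have aA: "a \<in> carrier A" using a supported_closed by blast
  note e = basis_elt_A[OF w]
  show "a \<otimes>\<^bsub>A\<^esub> basis_elt R X w \<in> carrier A" by (rule mult_A_closed[OF aA e])
  show "a \<in> carrier A" by (rule aA)
  fix z assume z: "z \<in> X"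
  let ?Y = "{p \<in> X \<times> X. m (fst p) (snd p) = z}" and ?e = "basis_elt R X w"
  let ?t = "\<lambda>p. c (fst p) (snd p) \<otimes>\<^bsub>R\<^esub> (a (fst p) \<otimes>\<^bsub>R\<^esub> ?e (snd p))"
  let ?Z = "if z \<in> D then {(z, w)} else {}"
  have zero: "?t p = \<zero>\<^bsub>R\<^esub>" if p: "p \<in> ?Y - ?Z" for p
  proof -
    have pX: "fst p \<in> X" "snd p \<in> X" "m (fst p) (snd p) = z" using p by auto
    have "snd p \<noteq> w \<or> fst p \<notin> D"
    proof (rule ccontr)
      assume "\<not> ?thesis"
      then have "snd p = w" "fst p \<in> D" by auto
      then have "fst p = z" using D[OF pX(1)] pX(3) by simp
      then have "p = (z, w)" "z \<in> D" using \<open>snd p = w\<close> \<open>fst p \<in> D\<close> by (auto simp: prod_eq_iff)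
      then show False using p by simp
    qed
    then have "a (fst p) = \<zero>\<^bsub>R\<^esub> \<or> ?e (snd p) = \<zero>\<^bsub>R\<^esub>"
      using a pX by (auto simp: supported_def basis_elt_def)
    then show ?thesis
      using A_closed[OF aA pX(1)] A_closed[OF e pX(2)] c_closed[of "fst p" "snd p"]
      by (elim disjE) simp_all
  qed
  have sub: "?Z \<subseteq> ?Y" using D[OF z] z w by simp
  have "(a \<otimes>\<^bsub>A\<^esub> ?e) z = (\<Oplus>\<^bsub>R\<^esub>p\<in>?Z. ?t p)"
    unfolding mult_A[OF aA e z]
    by (rule R.add.finprod_mono_neutral_cong_left[symmetric, OF _ sub zero refl fibre_term_closed[OF aA e]])
      (use finite_X in simp)
  also have "\<dots> = a z"
  proof (cases "z \<in> D")
    case True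
    have t: "?t (z, w) = a z" using D[OF z True] w A_closed[OF aA z] by (simp add: basis_elt_def)
    have "(\<Oplus>\<^bsub>R\<^esub>p\<in>{(z, w)}. ?t p) = ?t (z, w) \<oplus>\<^bsub>R\<^esub> (\<Oplus>\<^bsub>R\<^esub>p\<in>{}. ?t p)"
      by (rule R.finsum_insert) (use t A_closed[OF aA z] in simp_all)
    then show ?thesis using True t A_closed[OF aA z] by simp
  next
    case False
    then show ?thesis using a z by (simp add: supported_def)
  qed
  finally show "(a \<otimes>\<^bsub>A\<^esub> ?e) z = a z" .
qed

end

section \<open>The Brauer algebra\<close>

locale brauer_tor =
  fixes R :: "('r, 'e) ring_scheme" and \<delta> :: 'r and n :: nat
    and P :: "nat \<Rightarrow> (diagram \<Rightarrow> 'r, 'p) module" and d :: "nat \<Rightarrow> 'p \<Rightarrow> 'p" and \<epsilon> :: "'p \<Rightarrow> 'r"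
    and Q :: "nat \<Rightarrow> ((nat \<Rightarrow> nat) \<Rightarrow> 'r, 'q) module" and d' :: "nat \<Rightarrow> 'q \<Rightarrow> 'q" and \<epsilon>' :: "'q \<Rightarrow> 'r"
  assumes cring_R: "cring R" and \<delta>: "\<delta> \<in> carrier R" and odd_n: "odd n"
    and res: "projective_resolution
       (op_ring (basis_algebra R (brauer_diagrams n) (\<lambda>x y. \<delta> [^]\<^bsub>R\<^esub> brauer_loops n x y) (brauer_comp n) (brauer_id n)))
       (scalar_module R (brauer_diagrams n) (\<lambda>D. if has_turnback D then \<zero>\<^bsub>R\<^esub> else \<one>\<^bsub>R\<^esub>)) P d \<epsilon>"
    and res': "projective_resolution
       (op_ring (basis_algebra R {p. p permutes {1..n}} (\<lambda>_ _. \<one>\<^bsub>R\<^esub>) (\<circ>) id))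
       (scalar_module R {p. p permutes {1..n}} (\<lambda>_. \<one>\<^bsub>R\<^esub>)) Q d' \<epsilon>'"
begin

declare One_nat_def [simp del]

interpretation R: cring R by (rule cring_R)

abbreviation "BD \<equiv> brauer_diagrams n"
abbreviation "Perm \<equiv> {p. p permutes {1..n}}"
abbreviation "pd \<equiv> perm_diagram n"
abbreviation "\<chi>\<^sub>B \<equiv> \<lambda>D. if has_turnback D then \<zero>\<^bsub>R\<^esub> else \<one>\<^bsub>R\<^esub>"
abbreviation "\<chi>\<^sub>S \<equiv> \<lambda>_ :: nat \<Rightarrow> nat. \<one>\<^bsub>R\<^esub>"

lemma pd_BD: "\<sigma> \<in> Perm \<Longrightarrow> pd \<sigma> \<in> BD"
  by (simp add: perm_diagram_in_brauer_diagrams)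

lemma pd_inj: "\<lbrakk>\<sigma> \<in> Perm; \<tau> \<in> Perm; pd \<sigma> = pd \<tau>\<rbrakk> \<Longrightarrow> \<sigma> = \<tau>"
  using perm_diagram_inj by blast

sublocale Br: finite_basis_algebra R BD "\<lambda>x y. \<delta> [^]\<^bsub>R\<^esub> brauer_loops n x y" "brauer_comp n" "brauer_id n"
proof (rule finite_basis_algebra.intro[OF cring_R finite_brauer_diagrams])
  show "brauer_id n \<in> BD" using pd_BD[of id] permutes_id[of "{1..n}"] by (simp add: perm_diagram_id)
  show "\<delta> [^]\<^bsub>R\<^esub> brauer_loops n x y \<in> carrier R" for x y using \<delta> by simp
  \<comment> \<open>A resolution is one of modules over a ring; this is the source of associativity
    for the Brauer algebra.\<close>
  show "ring (op_ring (basis_algebra R BD (\<lambda>x y. \<delta> [^]\<^bsub>R\<^esub> brauer_loops n x y) (brauer_comp n) (brauer_id n)))"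
    by (rule lmodule_ring[OF res[unfolded projective_resolution_def, THEN conjunct1]])
qed

sublocale Sy: finite_basis_algebra R Perm "\<lambda>_ _. \<one>\<^bsub>R\<^esub>" "(\<circ>)" id
proof (rule finite_basis_algebra.intro[OF cring_R])
  show "finite Perm" by (rule finite_permutations) simp
  show "id \<in> Perm" by (simp add: permutes_id)
  show "ring (op_ring (basis_algebra R Perm (\<lambda>_ _. \<one>\<^bsub>R\<^esub>) (\<circ>) id))"
    by (rule lmodule_ring[OF res'[unfolded projective_resolution_def, THEN conjunct1]])
qed simp

abbreviation "N\<^sub>B \<equiv> scalar_module R BD \<chi>\<^sub>B"
abbreviation "N\<^sub>S \<equiv> scalar_module R Perm \<chi>\<^sub>S"

sublocale S: tor_scalar R Br.A N\<^sub>B "Br.character \<chi>\<^sub>B" N\<^sub>B P d \<epsilon>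
proof (intro tor_scalar.intro resolution.intro res Br.augmented_algebra)
  show "lmodule (op_ring Br.A) N\<^sub>B" by (rule res[unfolded projective_resolution_def, THEN conjunct1])
qed simp

sublocale S': tor_scalar R Sy.A N\<^sub>S "Sy.character \<chi>\<^sub>S" N\<^sub>S Q d' \<epsilon>'
proof (intro tor_scalar.intro resolution.intro res' Sy.augmented_algebra)
  show "lmodule (op_ring Sy.A) N\<^sub>S" by (rule res'[unfolded projective_resolution_def, THEN conjunct1])
qed simp

subsection \<open>The ideal of turnbacks\<close>

definition over :: "node set set \<Rightarrow> diagram set" where "over S = {b. S \<subseteq> b}"

lemma over_left_closed:
  "\<lbrakk>S \<subseteq> right_edges n; y \<in> over S\<rbrakk> \<Longrightarrow> brauer_comp n x y \<in> over S"
  using comp_right_edge unfolding over_def by blast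

text \<open>Induction on \<open>S\<close> with one free node \<open>k\<close> throughout. If
  \<open>e\<close> is a right unit for \<open>S\<close> and \<open>w\<close> the zigzag for a
  further edge \<open>s\<close>, then \<open>e w\<close> works for both:
  \<open>a e w = a w = a\<close>. It lies in the new left ideal because \<open>s\<close> is a right
  edge of \<open>w\<close> and the edges of \<open>S\<close> pass through \<open>w\<close>. The
  diagram \<open>b\<^sub>0\<close> only certifies that the edges are pairwise disjoint. For empty
  \<open>S\<close> the unit is 1.\<close>

lemma right_unit_exists:
  assumes "finite S" "S \<subseteq> b\<^sub>0" "S \<subseteq> right_edges n" and b\<^sub>0: "b\<^sub>0 \<in> BD"
    and k: "k \<in> {1..n}" "(Rgt, k) \<notin> \<Union>S"
  shows "\<exists>e\<in>Br.supported (over S). \<forall>a\<in>Br.supported (over S). a \<otimes>\<^bsub>Br.A\<^esub> e = a"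
  using assms(1,2,3) k(2)
proof (induction S rule: finite_induct)
  case empty
  have "Br.supported (over {}) = carrier Br.A" by (auto simp: over_def Br.supported_def)
  moreover have "\<one>\<^bsub>Br.A\<^esub> \<in> carrier Br.A" using Br.B.one_closed by (simp only: op_ring_simps)
  ultimately show ?case using Br.mult_A_one(1) by (intro bexI[of _ "\<one>\<^bsub>Br.A\<^esub>"] ballI) metis+
next
  case (insert s S)
  have sb: "s \<in> b\<^sub>0" and Sb: "S \<subseteq> b\<^sub>0" and Sr: "S \<subseteq> right_edges n"
    and kS: "(Rgt, k) \<notin> \<Union>S" and ks: "(Rgt, k) \<notin> s"
    using insert.prems by simp_all
  from insert.IH[OF Sb Sr kS] obtain e where e: "e \<in> Br.supported (over S)"
    and ae: "\<And>a. a \<in> Br.supported (over S) \<Longrightarrow> a \<otimes>\<^bsub>Br.A\<^esub> e = a" by blast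
  have "s \<in> right_edges n" using insert.prems by simp
  then obtain i j where s: "s = {(Rgt, i), (Rgt, j)}" "i \<in> {1..n}" "j \<in> {1..n}" "i \<noteq> j"
    unfolding right_edges_def by blast
  have ijk: "i \<in> {1..n}" "j \<in> {1..n}" "k \<in> {1..n}" "i \<noteq> j" "i \<noteq> k" "j \<noteq> k"
    using s k(1) ks by auto
  let ?w = "zigzag n i j k"
  note w = zigzag_in_brauer_diagrams[OF ijk]
  \<comment> \<open>The new zigzag goes on the right, so that its right edge \<open>s\<close> occurs
    in all diagrams of the product.\<close>
  let ?e = "e \<otimes>\<^bsub>Br.A\<^esub> basis_elt R BD ?w"
  have eA: "e \<in> carrier Br.A" using e Br.supported_closed by blast
  note wA = Br.basis_elt_A[OF w]
  have key: "z \<in> over (insert s S)" if z: "z \<in> BD" and nz: "?e z \<noteq> \<zero>\<^bsub>R\<^esub>" for z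
  proof -
    obtain x y where xy: "x \<in> BD" "y \<in> BD" "e x \<noteq> \<zero>\<^bsub>R\<^esub>" "basis_elt R BD ?w y \<noteq> \<zero>\<^bsub>R\<^esub>"
      "brauer_comp n x y = z"
      using Br.mult_A_supp[OF eA wA z nz] by blast
    have "y = ?w" using xy(2,4) by (simp add: basis_elt_def split: if_splits)
    then have zx: "z = brauer_comp n x ?w" using xy(5) by simp
    have Sx: "S \<subseteq> x" using e xy(1,3) by (auto simp: Br.supported_def over_def)
    have "t \<in> z" if t: "t \<in> S" for t
    proof -
      have "t \<in> right_edges n" using t Sr by blast
      then obtain p q where pq: "t = {(Rgt, p), (Rgt, q)}" "p \<in> {1..n}" "q \<in> {1..n}" "p \<noteq> q"
        unfolding right_edges_def by blast
      have "t \<noteq> s" using t insert.hyps by blast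
      \<comment> \<open>Distinct edges of \<open>b\<^sub>0\<close> share no node, so
        \<open>t\<close> avoids \<open>i\<close> and \<open>j\<close>; it avoids \<open>k\<close> by
        the choice of \<open>k\<close>.\<close>
      then have disj: "v \<notin> s" if "v \<in> t" for v
        using edge_unique[OF b\<^sub>0 _ sb that] t Sb by blast
      have "(Rgt, k) \<notin> t" using insert.prems(3) t by blast
      then have "p \<notin> {i, j, k}" "q \<notin> {i, j, k}"
        using disj[of "(Rgt, p)"] disj[of "(Rgt, q)"] unfolding pq(1) s(1) by auto
      moreover have "{(Rgt, p), (Rgt, q)} \<in> x" using t Sx pq(1) by blast
      ultimately show ?thesis
        unfolding zx pq(1) using comp_zigzag_other_edge[OF ijk _ pq(2-4)] by blast
    qed
    moreover have "s \<in> z" unfolding zx s(1) by (rule comp_zigzag_right_edge[OF ijk])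
    ultimately show ?thesis by (simp add: over_def subset_iff)
  qed
  have "?e \<in> Br.supported (over (insert s S))"
    unfolding Br.supported_def using Br.mult_A_closed[OF eA wA] key by blast
  moreover have "a \<otimes>\<^bsub>Br.A\<^esub> ?e = a" if a: "a \<in> Br.supported (over (insert s S))" for a
  proof -
    have aA: "a \<in> carrier Br.A" using a Br.supported_closed by blast
    have aS: "a \<in> Br.supported (over S)"
      using a Br.supported_mono[of "over (insert s S)" "over S"] by (auto simp: over_def)
    have "a \<otimes>\<^bsub>Br.A\<^esub> ?e = a \<otimes>\<^bsub>Br.A\<^esub> basis_elt R BD ?w"
      unfolding Br.mult_A_assoc[OF aA eA wA, symmetric] ae[OF aS] ..
    also have "\<dots> = a"
    proof (rule Br.supported_absorb[OF w _ a])
      fix x assume x: "x \<in> BD" "x \<in> over (insert s S)"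
      then have sx: "{(Rgt, i), (Rgt, j)} \<in> x" using s(1) by (simp add: over_def)
      show "brauer_comp n x ?w = x \<and> \<delta> [^]\<^bsub>R\<^esub> brauer_loops n x ?w = \<one>\<^bsub>R\<^esub>"
        using zigzag_absorb[OF ijk x(1) sx] zigzag_loops[OF ijk x(1) sx] by simp
    qed
    finally show ?thesis .
  qed
  ultimately show ?case by blast
qed

lemma acyclic_over:
  assumes S: "S \<subseteq> right_edges n"
  shows "S.acyclic_ideal (Br.supported (over S))"
proof (cases "over S \<inter> BD = {}")
  \<comment> \<open>This happens when edges of \<open>S\<close> overlap; the left ideal is then
    0.\<close>
  case True
  then show ?thesis using S.acyclic_ideal_zero by (simp only: Br.supported_empty)
next
  case False
  then obtain b\<^sub>0 where b\<^sub>0: "b\<^sub>0 \<in> BD" "S \<subseteq> b\<^sub>0" by (auto simp: over_def)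
  obtain k where k: "k \<in> {1..n}" "(Rgt, k) \<notin> \<Union>S" using unmatched_node[OF b\<^sub>0 S odd_n] by blast
  obtain e where e: "e \<in> Br.supported (over S)" "\<forall>a\<in>Br.supported (over S). a \<otimes>\<^bsub>Br.A\<^esub> e = a"
    using right_unit_exists[OF finite_subset[OF S finite_right_edges] b\<^sub>0(2) S b\<^sub>0(1) k] by blast
  show ?thesis
  proof (rule S.acyclic_ideal_left_unit[OF _ e(1)])
    show "Br.supported (over S) \<subseteq> carrier (op_ring Br.A)"
      unfolding op_ring_simps by (rule Br.supported_closed)
    show "e \<otimes>\<^bsub>op_ring Br.A\<^esub> a = a" if "a \<in> Br.supported (over S)" for a
      unfolding op_ring_simps using e(2) that by blast
  qed
qed

lemma character_turnback:
  assumes "a \<in> Br.supported {b. has_turnback b}" shows "Br.character \<chi>\<^sub>B a = \<zero>\<^bsub>R\<^esub>"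
proof -
  have a: "a \<in> carrier Br.A" using assms Br.supported_closed by blast
  have "Br.character \<chi>\<^sub>B a = (\<Oplus>\<^bsub>R\<^esub>x\<in>BD. a x \<otimes>\<^bsub>R\<^esub> \<chi>\<^sub>B x)"
    by (rule Br.character_eq[OF _ a]) simp
  also have "\<dots> = \<zero>\<^bsub>R\<^esub>"
  proof (rule R.add.finprod_one_eqI)
    fix x assume x: "x \<in> BD"
    show "a x \<otimes>\<^bsub>R\<^esub> \<chi>\<^sub>B x = \<zero>\<^bsub>R\<^esub>"
      using assms x Br.A_closed[OF a x] by (cases "has_turnback x") (auto simp: Br.supported_def)
  qed
  finally show ?thesis .
qed

text \<open>Induction on the number of generating left ideals. The intersection of the new one with
  the others is generated by as many ideals of the same kind as before.\<close>

lemma acyclic_family: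
  assumes "finite F" "card F \<le> N" "\<And>S. S \<in> F \<Longrightarrow> S \<noteq> {} \<and> S \<subseteq> right_edges n"
  shows "S.acyclic_ideal (Br.supported (\<Union>S\<in>F. over S))"
  using assms
proof (induction N arbitrary: F)
  case 0
  then have "F = {}" by simp
  then have "(\<Union>S\<in>F. over S) \<inter> BD = {}" by simp
  then show ?case using S.acyclic_ideal_zero by (simp only: Br.supported_empty)
next
  case (Suc N)
  show ?case
  proof (cases "F = {}")
    case True
    then have "(\<Union>S\<in>F. over S) \<inter> BD = {}" by simp
    then show ?thesis using S.acyclic_ideal_zero by (simp only: Br.supported_empty)
  next
    case False
    then obtain S G where F: "F = insert S G" "S \<notin> G" by (metis Set.set_insert all_not_in_conv)
    have G: "finite G" "card G \<le> N" using Suc.prems(1,2) F by auto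
    have S: "S \<noteq> {}" "S \<subseteq> right_edges n" using Suc.prems(3) F by blast+
    have GS: "T \<noteq> {} \<and> T \<subseteq> right_edges n" if "T \<in> G" for T using Suc.prems(3) F that by blast
    let ?D = "\<Union>T\<in>G. over T" and ?D' = "over S"
    have FD: "(\<Union>T\<in>F. over T) = ?D \<union> ?D'" using F(1) by auto
    have closed: "brauer_comp n x y \<in> ?D" if "y \<in> ?D" for x y
      using over_left_closed GS that by blast
    show ?thesis
    proof (rule S.acyclic_ideal_sum[of "Br.supported ?D" "Br.supported ?D'"])
      show "right_ideal (op_ring Br.A) (Br.supported ?D)"
        by (rule Br.right_ideal_supported) (rule closed)
      show "right_ideal (op_ring Br.A) (Br.supported ?D')"
        by (rule Br.right_ideal_supported) (rule over_left_closed[OF S(2)])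
      show "Br.supported ?D \<subseteq> Br.supported (\<Union>T\<in>F. over T)" "Br.supported ?D' \<subseteq> Br.supported (\<Union>T\<in>F. over T)"
        unfolding FD by (rule Br.supported_mono, blast)+
      show "Br.supported (\<Union>T\<in>F. over T) \<subseteq> carrier (op_ring Br.A)"
        unfolding op_ring_simps by (rule Br.supported_closed)
      show "\<exists>b\<in>Br.supported ?D. \<exists>c\<in>Br.supported ?D'. a = b \<oplus>\<^bsub>op_ring Br.A\<^esub> c"
        if "a \<in> Br.supported (\<Union>T\<in>F. over T)" for a
        by (rule Br.supported_Un) (use that in \<open>simp only: FD\<close>)
      show "S.acyclic_ideal (Br.supported ?D)" by (rule Suc.IH[OF G GS])
      show "S.acyclic_ideal (Br.supported ?D')" by (rule acyclic_over[OF S(2)])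
      \<comment> \<open>Containing \<open>T\<close> and \<open>S\<close> means containing their
        union. Different \<open>T\<close> may yield the same union, which is why the induction runs
        over a bound on the size of the family.\<close>
      have int: "?D \<inter> ?D' = (\<Union>T\<in>(\<lambda>T. T \<union> S) ` G. over T)" by (auto simp: over_def)
      show "S.acyclic_ideal (Br.supported ?D \<inter> Br.supported ?D')"
        unfolding Br.supported_Int int
      proof (rule Suc.IH)
        show "finite ((\<lambda>T. T \<union> S) ` G)" using G by simp
        show "card ((\<lambda>T. T \<union> S) ` G) \<le> N" using card_image_le[OF G(1)] G(2) le_trans by blast
        show "T \<noteq> {} \<and> T \<subseteq> right_edges n" if "T \<in> (\<lambda>T. T \<union> S) ` G" for T using that S GS by blast
      qed
      fix a t assume a: "a \<in> Br.supported (\<Union>T\<in>F. over T)" and t: "t \<in> carrier N\<^sub>B"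
      \<comment> \<open>The sets in the family are nonempty, so every diagram in question has a
        right edge and acts by 0 on the trivial module, as the Mayer--Vietoris step requires in
        degree 0.\<close>
      have "b \<in> {b. has_turnback b}" if "b \<in> (\<Union>T\<in>F. over T) \<inter> BD" for b
      proof -
        obtain T where T: "T \<in> F" "T \<subseteq> b" and b: "b \<in> BD" using \<open>b \<in> _\<close> by (auto simp: over_def)
        then obtain s where "s \<in> T" "s \<in> right_edges n" using Suc.prems(3)[OF T(1)] by blast
        then show ?thesis using T(2) turnback_iff_right_edge[OF b] by blast
      qed
      then have "Br.supported (\<Union>T\<in>F. over T) \<subseteq> Br.supported {b. has_turnback b}"
        by (intro Br.supported_mono subsetI)
      then have "Br.character \<chi>\<^sub>B a = \<zero>\<^bsub>R\<^esub>" using character_turnback a by blast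
      moreover have "t \<in> carrier R" using t by (simp add: scalar_module_def)
      moreover have "a \<odot>\<^bsub>N\<^sub>B\<^esub> t = Br.character \<chi>\<^sub>B a \<otimes>\<^bsub>R\<^esub> t" by (rule Br.smult_scalar_module) simp
      ultimately show "a \<odot>\<^bsub>N\<^sub>B\<^esub> t = \<zero>\<^bsub>N\<^sub>B\<^esub>" by (simp add: scalar_module_def)
    qed
  qed
qed

abbreviation "I \<equiv> Br.supported {b. has_turnback b}"

text \<open>A diagram has a turnback exactly when it contains a right edge, so the singletons of
  right edges form a family whose left ideals sum to \<open>I\<close>.\<close>

lemma acyclic_I: "S.acyclic_ideal I"
proof -
  let ?F = "(\<lambda>s. {s}) ` right_edges n"
  have "I = Br.supported (\<Union>S\<in>?F. over S)"
  proof (rule subset_antisym; rule Br.supported_mono; rule subsetI)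
    fix b assume "b \<in> {b. has_turnback b} \<inter> BD"
    then show "b \<in> (\<Union>S\<in>?F. over S)" using turnback_iff_right_edge[of b n] by (auto simp: over_def)
  next
    fix b assume "b \<in> (\<Union>S\<in>?F. over S) \<inter> BD"
    then show "b \<in> {b. has_turnback b}" using turnback_iff_right_edge[of b n] by (auto simp: over_def)
  qed
  moreover have "S.acyclic_ideal (Br.supported (\<Union>S\<in>?F. over S))"
    by (rule acyclic_family[OF _ order_refl]) (use finite_right_edges in auto)
  ultimately show ?thesis by simp
qed

subsection \<open>Comparison with the group algebra\<close>

text \<open>The quotient map by \<open>I\<close> in coordinates: permutation diagrams are identified
  with permutations and the other coefficients are forgotten.\<close>

definition \<rho> :: "(diagram \<Rightarrow> 'r) \<Rightarrow> (nat \<Rightarrow> nat) \<Rightarrow> 'r" where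
  "\<rho> f = (\<lambda>\<sigma>\<in>Perm. f (pd \<sigma>))"

text \<open>Extension by 0; the \<open>THE\<close> inverts \<open>perm_diagram\<close>, which is
  injective on permutations.\<close>

definition \<iota> :: "((nat \<Rightarrow> nat) \<Rightarrow> 'r) \<Rightarrow> diagram \<Rightarrow> 'r" where
  "\<iota> g = (\<lambda>b\<in>BD. if has_turnback b then \<zero>\<^bsub>R\<^esub> else g (THE \<sigma>. \<sigma> \<in> Perm \<and> pd \<sigma> = b))"

lemma \<rho>_pd: "\<sigma> \<in> Perm \<Longrightarrow> \<rho> f \<sigma> = f (pd \<sigma>)"
  by (simp add: \<rho>_def)

lemma \<iota>_pd: assumes \<sigma>: "\<sigma> \<in> Perm" shows "\<iota> g (pd \<sigma>) = g \<sigma>"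
proof -
  have "(THE \<tau>. \<tau> \<in> Perm \<and> pd \<tau> = pd \<sigma>) = \<sigma>"
    by (rule the_equality) (use \<sigma> pd_inj in blast)+
  then show ?thesis using pd_BD[OF \<sigma>] perm_diagram_no_turnback[of n \<sigma>] by (simp add: \<iota>_def)
qed

lemma \<iota>_turnback: "\<lbrakk>b \<in> BD; has_turnback b\<rbrakk> \<Longrightarrow> \<iota> g b = \<zero>\<^bsub>R\<^esub>"
  by (simp add: \<iota>_def)

lemma BD_cases:
  assumes "b \<in> BD" obtains "has_turnback b" | \<sigma> where "\<sigma> \<in> Perm" "b = pd \<sigma>" "\<not> has_turnback b"
  using no_turnback_perm_diagram[OF assms] by blast

lemma \<rho>_closed: "f \<in> carrier Br.A \<Longrightarrow> \<rho> f \<in> carrier Sy.A"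
  unfolding Sy.carrier_A \<rho>_def using Br.A_closed[of f] pd_BD by (intro restrict_PiE_iff[THEN iffD2]) blast

lemma \<iota>_closed:
  assumes g: "g \<in> carrier Sy.A" shows "\<iota> g \<in> carrier Br.A"
proof -
  have "\<iota> g b \<in> carrier R" if b: "b \<in> BD" for b
    using b
  proof (cases rule: BD_cases)
    case 1 then show ?thesis using \<iota>_turnback[OF b] by simp
  next
    case (2 \<sigma>) then show ?thesis using \<iota>_pd[OF 2(1)] Sy.A_closed[OF g 2(1)] by simp
  qed
  then show ?thesis unfolding Br.carrier_A by (intro PiE_I) (auto simp: \<iota>_def)
qed

text \<open>A turnback in either factor survives in the composite, so only pairs of permutation
  diagrams can compose to a permutation diagram.\<close>

lemma comp_eq_perm_diagram:
  assumes \<sigma>: "\<sigma> \<in> Perm"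
  shows "{p \<in> BD \<times> BD. brauer_comp n (fst p) (snd p) = pd \<sigma>} =
    (\<lambda>q. (pd (fst q), pd (snd q))) ` {q \<in> Perm \<times> Perm. fst q \<circ> snd q = \<sigma>}"
proof
  show "{p \<in> BD \<times> BD. brauer_comp n (fst p) (snd p) = pd \<sigma>} \<subseteq>
      (\<lambda>q. (pd (fst q), pd (snd q))) ` {q \<in> Perm \<times> Perm. fst q \<circ> snd q = \<sigma>}"
  proof
    fix p assume "p \<in> {p \<in> BD \<times> BD. brauer_comp n (fst p) (snd p) = pd \<sigma>}"
    then obtain x y where p: "p = (x, y)" and x: "x \<in> BD" and y: "y \<in> BD"
      and xy: "brauer_comp n x y = pd \<sigma>" by auto
    have "\<not> has_turnback x" "\<not> has_turnback y"
      using comp_turnback_left[OF x] comp_turnback_right[OF y] xy perm_diagram_no_turnback[of n \<sigma>] by metis+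
    then obtain \<alpha> \<beta> where ab: "\<alpha> \<in> Perm" "\<beta> \<in> Perm" "x = pd \<alpha>" "y = pd \<beta>"
      using no_turnback_perm_diagram[OF x] no_turnback_perm_diagram[OF y] by blast
    then have "pd (\<alpha> \<circ> \<beta>) = pd \<sigma>" using perm_diagram_comp(1)[of \<alpha> n \<beta>] xy by simp
    then have "\<alpha> \<circ> \<beta> = \<sigma>"
      using ab \<sigma> permutes_compose[of \<beta> "{1..n}" \<alpha>] by (intro pd_inj) simp_all
    then show "p \<in> (\<lambda>q. (pd (fst q), pd (snd q))) ` {q \<in> Perm \<times> Perm. fst q \<circ> snd q = \<sigma>}"
      using ab p by (intro image_eqI[of _ _ "(\<alpha>, \<beta>)"]) simp_all
  qed
  show "(\<lambda>q. (pd (fst q), pd (snd q))) ` {q \<in> Perm \<times> Perm. fst q \<circ> snd q = \<sigma>} \<subseteq>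
      {p \<in> BD \<times> BD. brauer_comp n (fst p) (snd p) = pd \<sigma>}"
  proof (rule image_subsetI)
    fix q assume "q \<in> {q \<in> Perm \<times> Perm. fst q \<circ> snd q = \<sigma>}"
    then have q: "fst q \<in> Perm" "snd q \<in> Perm" "fst q \<circ> snd q = \<sigma>" by auto
    then show "(pd (fst q), pd (snd q)) \<in> {p \<in> BD \<times> BD. brauer_comp n (fst p) (snd p) = pd \<sigma>}"
      using pd_BD perm_diagram_comp(1)[of "fst q" n "snd q"] by simp
  qed
qed

text \<open>By the description of the fibre, the coefficient is a convolution over pairs of
  permutations. The powers of \<delta> are 1 because permutation diagrams close no loops.\<close>

lemma mult_pd:
  assumes f: "f \<in> carrier Br.A" and g: "g \<in> carrier Br.A" and \<sigma>: "\<sigma> \<in> Perm"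
  shows "(f \<otimes>\<^bsub>Br.A\<^esub> g) (pd \<sigma>) = (\<rho> f \<otimes>\<^bsub>Sy.A\<^esub> \<rho> g) \<sigma>"
proof -
  let ?t = "\<lambda>p. \<delta> [^]\<^bsub>R\<^esub> brauer_loops n (fst p) (snd p) \<otimes>\<^bsub>R\<^esub> (f (fst p) \<otimes>\<^bsub>R\<^esub> g (snd p))"
  let ?h = "\<lambda>q. (pd (fst q), pd (snd q))" and ?Y = "{q \<in> Perm \<times> Perm. fst q \<circ> snd q = \<sigma>}"
  have inj: "inj_on ?h ?Y"
  proof (rule inj_onI)
    fix q q' assume q: "q \<in> ?Y" "q' \<in> ?Y" and eq: "?h q = ?h q'"
    have "fst q = fst q'" "snd q = snd q'" by (rule pd_inj; use q eq in auto)+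
    then show "q = q'" by (rule prod_eqI)
  qed
  have cl: "?t \<in> ?h ` ?Y \<rightarrow> carrier R"
    using Br.fibre_term_closed[OF f g, of "pd \<sigma>"] unfolding comp_eq_perm_diagram[OF \<sigma>] .
  have "(f \<otimes>\<^bsub>Br.A\<^esub> g) (pd \<sigma>) = (\<Oplus>\<^bsub>R\<^esub>p\<in>?h ` ?Y. ?t p)"
    unfolding Br.mult_A[OF f g pd_BD[OF \<sigma>]] comp_eq_perm_diagram[OF \<sigma>] ..
  also have "\<dots> = (\<Oplus>\<^bsub>R\<^esub>q\<in>?Y. ?t (?h q))" by (rule R.finsum_reindex[OF cl inj])
  also have "\<dots> = (\<Oplus>\<^bsub>R\<^esub>q\<in>?Y. \<one>\<^bsub>R\<^esub> \<otimes>\<^bsub>R\<^esub> (\<rho> f (fst q) \<otimes>\<^bsub>R\<^esub> \<rho> g (snd q)))"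
  proof (rule R.finsum_cong'[OF refl Sy.fibre_term_closed[OF \<rho>_closed[OF f] \<rho>_closed[OF g]]])
    fix q assume "q \<in> ?Y"
    then have q: "fst q \<in> Perm" "snd q \<in> Perm" by auto
    then show "?t (?h q) = \<one>\<^bsub>R\<^esub> \<otimes>\<^bsub>R\<^esub> (\<rho> f (fst q) \<otimes>\<^bsub>R\<^esub> \<rho> g (snd q))"
      using perm_diagram_comp(2)[of "fst q" n "snd q"] by (simp add: \<rho>_pd)
  qed
  also have "\<dots> = (\<rho> f \<otimes>\<^bsub>Sy.A\<^esub> \<rho> g) \<sigma>"
    by (rule Sy.mult_A[OF \<rho>_closed[OF f] \<rho>_closed[OF g] \<sigma>, symmetric])
  finally show ?thesis .
qed

lemma \<rho>_\<iota>: assumes "g \<in> carrier Sy.A" shows "\<rho> (\<iota> g) = g"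
  by (rule Sy.A_ext[OF \<rho>_closed[OF \<iota>_closed[OF assms]] assms]) (simp only: \<rho>_pd \<iota>_pd)

text \<open>Splits an identity in the Brauer algebra into its image in the group algebra and its
  coefficients at diagrams with turnbacks.\<close>

lemma Br_ext:
  assumes "f \<in> carrier Br.A" "g \<in> carrier Br.A" "\<rho> f = \<rho> g"
    and "\<And>b. \<lbrakk>b \<in> BD; has_turnback b\<rbrakk> \<Longrightarrow> f b = g b"
  shows "f = g"
proof (rule Br.A_ext[OF assms(1,2)])
  fix b assume b: "b \<in> BD"
  then show "f b = g b"
  proof (cases rule: BD_cases)
    case 1 then show ?thesis using assms(4) b by blast
  next
    case (2 \<sigma>) then show ?thesis using assms(3) \<rho>_pd by metis
  qed
qed

lemma \<rho>_mult:
  assumes f: "f \<in> carrier Br.A" and g: "g \<in> carrier Br.A"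
  shows "\<rho> (f \<otimes>\<^bsub>Br.A\<^esub> g) = \<rho> f \<otimes>\<^bsub>Sy.A\<^esub> \<rho> g"
  by (rule Sy.A_ext[OF \<rho>_closed[OF Br.mult_A_closed[OF f g]] Sy.mult_A_closed[OF \<rho>_closed[OF f] \<rho>_closed[OF g]]])
    (simp only: \<rho>_pd mult_pd[OF f g])

lemma \<rho>_add:
  assumes f: "f \<in> carrier Br.A" and g: "g \<in> carrier Br.A"
  shows "\<rho> (f \<oplus>\<^bsub>Br.A\<^esub> g) = \<rho> f \<oplus>\<^bsub>Sy.A\<^esub> \<rho> g"
  by (rule Sy.A_ext[OF \<rho>_closed[OF Br.add_A_closed[OF f g]] Sy.add_A_closed[OF \<rho>_closed[OF f] \<rho>_closed[OF g]]])
    (simp add: \<rho>_pd pd_BD[simplified])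

lemma one_Br: "\<one>\<^bsub>Br.A\<^esub> \<in> carrier Br.A"
  using Br.B.one_closed by (simp only: op_ring_simps)

lemma one_Sy: "\<one>\<^bsub>Sy.A\<^esub> \<in> carrier Sy.A"
  using Sy.B.one_closed by (simp only: op_ring_simps)

lemma \<rho>_one: "\<rho> \<one>\<^bsub>Br.A\<^esub> = \<one>\<^bsub>Sy.A\<^esub>"
proof (rule Sy.A_ext[OF \<rho>_closed[OF one_Br] one_Sy])
  fix \<sigma> assume \<sigma>: "\<sigma> \<in> Perm"
  have "id \<in> Perm" by (simp add: permutes_id)
  then have "pd \<sigma> = brauer_id n \<longleftrightarrow> \<sigma> = id"
    using pd_inj[OF \<sigma>, of id] perm_diagram_id[of n] by metis
  then show "\<rho> \<one>\<^bsub>Br.A\<^esub> \<sigma> = \<one>\<^bsub>Sy.A\<^esub> \<sigma>"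
    using \<sigma> pd_BD[OF \<sigma>] by (simp add: \<rho>_pd basis_elt_def)
qed

lemma \<rho>_smult:
  assumes r: "r \<in> carrier R" and f: "f \<in> carrier Br.A"
  shows "\<rho> (r \<odot>\<^bsub>Br.A\<^esub> f) = r \<odot>\<^bsub>Sy.A\<^esub> \<rho> f"
  by (rule Sy.A_ext[OF \<rho>_closed[OF Br.smult_A_closed[OF r f]] Sy.smult_A_closed[OF r \<rho>_closed[OF f]]])
    (simp add: \<rho>_pd pd_BD[simplified])

lemma \<rho>_hom: "\<rho> \<in> ring_hom (op_ring Br.A) (op_ring Sy.A)"
  by (rule ring_hom_memI; unfold op_ring_simps) (rule \<rho>_closed \<rho>_mult \<rho>_add \<rho>_one; assumption?)+

lemma \<iota>_hom: "\<iota> \<in> ring_hom (op_ring Sy.A) (op_ring Br.A)"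
proof (rule ring_hom_memI; unfold op_ring_simps)
  show "\<iota> f \<in> carrier Br.A" if "f \<in> carrier Sy.A" for f by (rule \<iota>_closed[OF that])
next
  fix g f assume g: "g \<in> carrier Sy.A" and f: "f \<in> carrier Sy.A"
  note f' = \<iota>_closed[OF f] and g' = \<iota>_closed[OF g]
  show "\<iota> (f \<otimes>\<^bsub>Sy.A\<^esub> g) = \<iota> f \<otimes>\<^bsub>Br.A\<^esub> \<iota> g"
  proof (rule Br_ext[OF \<iota>_closed[OF Sy.mult_A_closed[OF f g]] Br.mult_A_closed[OF f' g']])
    show "\<rho> (\<iota> (f \<otimes>\<^bsub>Sy.A\<^esub> g)) = \<rho> (\<iota> f \<otimes>\<^bsub>Br.A\<^esub> \<iota> g)"
      unfolding \<rho>_mult[OF f' g'] \<rho>_\<iota>[OF f] \<rho>_\<iota>[OF g] by (rule \<rho>_\<iota>[OF Sy.mult_A_closed[OF f g]])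
    fix b assume b: "b \<in> BD" "has_turnback b"
    \<comment> \<open>Both factors live on permutation diagrams, and composites of these are
      permutation diagrams again, so no turnback can appear.\<close>
    have "(\<iota> f \<otimes>\<^bsub>Br.A\<^esub> \<iota> g) b = \<zero>\<^bsub>R\<^esub>"
    proof (rule ccontr)
      assume "(\<iota> f \<otimes>\<^bsub>Br.A\<^esub> \<iota> g) b \<noteq> \<zero>\<^bsub>R\<^esub>"
      then obtain x y where x: "x \<in> BD" "\<iota> f x \<noteq> \<zero>\<^bsub>R\<^esub>" and y: "y \<in> BD" "\<iota> g y \<noteq> \<zero>\<^bsub>R\<^esub>"
        and xy: "brauer_comp n x y = b"
        using Br.mult_A_supp[OF f' g' b(1)] by blast
      have "\<not> has_turnback x" "\<not> has_turnback y" using \<iota>_turnback x y by blast+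
      then obtain \<alpha> \<beta> where "\<alpha> permutes {1..n}" "\<beta> permutes {1..n}" "x = pd \<alpha>" "y = pd \<beta>"
        using no_turnback_perm_diagram[OF x(1)] no_turnback_perm_diagram[OF y(1)] by blast
      then have "b = pd (\<alpha> \<circ> \<beta>)" using perm_diagram_comp(1) xy by metis
      then show False using b(2) perm_diagram_no_turnback by metis
    qed
    then show "\<iota> (f \<otimes>\<^bsub>Sy.A\<^esub> g) b = (\<iota> f \<otimes>\<^bsub>Br.A\<^esub> \<iota> g) b" using \<iota>_turnback[OF b] by metis
  qed
  show "\<iota> (g \<oplus>\<^bsub>Sy.A\<^esub> f) = \<iota> g \<oplus>\<^bsub>Br.A\<^esub> \<iota> f"
  proof (rule Br_ext[OF \<iota>_closed[OF Sy.add_A_closed[OF g f]] Br.add_A_closed[OF g' f']])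
    show "\<rho> (\<iota> (g \<oplus>\<^bsub>Sy.A\<^esub> f)) = \<rho> (\<iota> g \<oplus>\<^bsub>Br.A\<^esub> \<iota> f)"
      unfolding \<rho>_add[OF g' f'] \<rho>_\<iota>[OF f] \<rho>_\<iota>[OF g] by (rule \<rho>_\<iota>[OF Sy.add_A_closed[OF g f]])
    fix b assume b: "b \<in> BD" "has_turnback b"
    then show "\<iota> (g \<oplus>\<^bsub>Sy.A\<^esub> f) b = (\<iota> g \<oplus>\<^bsub>Br.A\<^esub> \<iota> f) b"
      by (simp add: \<iota>_turnback)
  qed
next
  show "\<iota> \<one>\<^bsub>Sy.A\<^esub> = \<one>\<^bsub>Br.A\<^esub>"
  proof (rule Br_ext[OF \<iota>_closed[OF one_Sy] one_Br])
    show "\<rho> (\<iota> \<one>\<^bsub>Sy.A\<^esub>) = \<rho> \<one>\<^bsub>Br.A\<^esub>" unfolding \<rho>_one by (rule \<rho>_\<iota>[OF one_Sy])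
    fix b assume b: "b \<in> BD" "has_turnback b"
    then have "b \<noteq> brauer_id n" using perm_diagram_no_turnback[of n id] by (auto simp: perm_diagram_id)
    then show "\<iota> \<one>\<^bsub>Sy.A\<^esub> b = \<one>\<^bsub>Br.A\<^esub> b" using b by (simp add: \<iota>_turnback basis_elt_def)
  qed
qed

text \<open>The trivial character of the Brauer algebra vanishes on turnbacks, so its defining sum
  runs over permutation diagrams only.\<close>

lemma character_\<rho>:
  assumes f: "f \<in> carrier Br.A" shows "Sy.character \<chi>\<^sub>S (\<rho> f) = Br.character \<chi>\<^sub>B f"
proof -
  let ?t = "\<lambda>b. f b \<otimes>\<^bsub>R\<^esub> \<chi>\<^sub>B b"
  have t: "?t \<in> BD \<rightarrow> carrier R" using Br.A_closed[OF f] by (intro funcsetI) simp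
  have sub: "pd ` Perm \<subseteq> BD" using pd_BD by blast
  have "Sy.character \<chi>\<^sub>S (\<rho> f) = (\<Oplus>\<^bsub>R\<^esub>\<sigma>\<in>Perm. \<rho> f \<sigma> \<otimes>\<^bsub>R\<^esub> \<one>\<^bsub>R\<^esub>)"
    by (rule Sy.character_eq[OF _ \<rho>_closed[OF f]]) simp
  also have "\<dots> = (\<Oplus>\<^bsub>R\<^esub>\<sigma>\<in>Perm. ?t (pd \<sigma>))"
  proof (rule R.finsum_cong'[OF refl])
    show "(\<lambda>\<sigma>. ?t (pd \<sigma>)) \<in> Perm \<rightarrow> carrier R"
      by (rule funcsetI, rule funcset_mem[OF t], rule pd_BD)
    show "\<rho> f \<sigma> \<otimes>\<^bsub>R\<^esub> \<one>\<^bsub>R\<^esub> = ?t (pd \<sigma>)" if "\<sigma> \<in> Perm" for \<sigma>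
      unfolding \<rho>_pd[OF that] using perm_diagram_no_turnback[of n \<sigma>] by simp
  qed
  also have "\<dots> = (\<Oplus>\<^bsub>R\<^esub>b\<in>pd ` Perm. ?t b)"
  proof (rule R.finsum_reindex[symmetric])
    show "?t \<in> pd ` Perm \<rightarrow> carrier R" using t sub by blast
    show "inj_on pd Perm" using pd_inj by (intro inj_onI) blast
  qed
  also have "\<dots> = (\<Oplus>\<^bsub>R\<^esub>b\<in>BD. ?t b)"
  proof (rule R.add.finprod_mono_neutral_cong_left[OF finite_brauer_diagrams sub _ refl t])
    fix b assume b: "b \<in> BD - pd ` Perm"
    then have "has_turnback b" using no_turnback_perm_diagram[of b n] by blast
    then show "?t b = \<zero>\<^bsub>R\<^esub>" using Br.A_closed[OF f, of b] b by simp
  qed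
  also have "\<dots> = Br.character \<chi>\<^sub>B f" by (rule Br.character_eq[OF _ f, symmetric]) simp
  finally show ?thesis .
qed

lemma diff_\<iota>_\<rho>:
  assumes a: "a \<in> carrier Br.A" shows "a \<ominus>\<^bsub>op_ring Br.A\<^esub> \<iota> (\<rho> a) \<in> I"
proof -
  \<comment> \<open>The part of \<open>a\<close> on turnbacks; \<open>\<iota> (\<rho> a)\<close> is
    the complementary part on permutation diagrams.\<close>
  define i where "i = (\<lambda>b\<in>BD. if has_turnback b then a b else \<zero>\<^bsub>R\<^esub>)"
  have iI: "i \<in> I" using Br.A_closed[OF a] by (auto simp: Br.supported_def Br.carrier_A i_def)
  then have i: "i \<in> carrier Br.A" using Br.supported_closed by blast
  note \<iota>\<rho> = \<iota>_closed[OF \<rho>_closed[OF a]]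
  have "a = i \<oplus>\<^bsub>Br.A\<^esub> \<iota> (\<rho> a)"
  proof (rule Br_ext[OF a Br.add_A_closed[OF i \<iota>\<rho>]])
    have "\<rho> i \<sigma> = \<zero>\<^bsub>R\<^esub>" if "\<sigma> \<in> Perm" for \<sigma>
      using pd_BD[OF that] perm_diagram_no_turnback[of n \<sigma>] by (simp add: \<rho>_pd[OF that] i_def)
    then have "\<rho> i \<oplus>\<^bsub>Sy.A\<^esub> \<rho> a = \<rho> a"
      by (intro Sy.A_ext[OF Sy.add_A_closed[OF \<rho>_closed[OF i] \<rho>_closed[OF a]] \<rho>_closed[OF a]])
        (use Sy.A_closed[OF \<rho>_closed[OF a]] in simp)
    then show "\<rho> a = \<rho> (i \<oplus>\<^bsub>Br.A\<^esub> \<iota> (\<rho> a))"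
      unfolding \<rho>_add[OF i \<iota>\<rho>] \<rho>_\<iota>[OF \<rho>_closed[OF a]] by (rule sym)
    fix b assume b: "b \<in> BD" "has_turnback b"
    then show "a b = (i \<oplus>\<^bsub>Br.A\<^esub> \<iota> (\<rho> a)) b"
      using Br.A_closed[OF a] by (simp add: \<iota>_turnback i_def)
  qed
  then have "a \<ominus>\<^bsub>op_ring Br.A\<^esub> \<iota> (\<rho> a) = (i \<oplus>\<^bsub>op_ring Br.A\<^esub> \<iota> (\<rho> a)) \<ominus>\<^bsub>op_ring Br.A\<^esub> \<iota> (\<rho> a)"
    unfolding op_ring_simps by (rule arg_cong)
  also have "\<dots> = i"
    using i \<iota>\<rho> Br.B.a_assoc[of i "\<iota> (\<rho> a)" "\<ominus>\<^bsub>op_ring Br.A\<^esub> \<iota> (\<rho> a)"]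
      Br.B.a_inv_closed[of "\<iota> (\<rho> a)"] Br.B.r_neg[of "\<iota> (\<rho> a)"] Br.B.r_zero[of i]
    unfolding a_minus_def op_ring_simps by metis
  finally show ?thesis using iI by simp
qed

section \<open>The comparison applied to the Brauer algebra and the group algebra\<close>

lemma Tor_isomorphic:
  "lmodule_isomorphic R (Tor R Br.A P d N\<^sub>B k) (Tor R Sy.A Q d' N\<^sub>S k)"
proof -
  have turnback_left: "brauer_comp n x y \<in> {b. has_turnback b}" if "y \<in> BD" "y \<in> {b. has_turnback b}" for x y
    using comp_turnback_right that by blast
  have turnback_right: "brauer_comp n x y \<in> {b. has_turnback b}" if "x \<in> BD" "x \<in> {b. has_turnback b}" for x y
    using comp_turnback_left that by blast
  interpret tor_comparison R Br.A N\<^sub>B "Br.character \<chi>\<^sub>B" P d \<epsilon> Sy.A N\<^sub>S "Sy.character \<chi>\<^sub>S" Q d' \<epsilon>' \<rho> \<iota> I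
  proof (intro tor_comparison.intro S.tor_scalar_axioms S'.tor_scalar_axioms tor_comparison_axioms.intro
      \<rho>_hom \<iota>_hom \<rho>_\<iota> character_\<rho> diff_\<iota>_\<rho> acyclic_I)
    show "zero N\<^sub>B = zero R" "zero N\<^sub>S = zero R" by (simp_all add: scalar_module_def)
    show "\<rho> (r \<odot>\<^bsub>Br.A\<^esub> \<one>\<^bsub>Br.A\<^esub>) = r \<odot>\<^bsub>Sy.A\<^esub> \<one>\<^bsub>Sy.A\<^esub>" if "r \<in> carrier R" for r
      unfolding \<rho>_smult[OF that one_Br] \<rho>_one ..
    show "Br.character \<chi>\<^sub>B (\<iota> b) = Sy.character \<chi>\<^sub>S b" if "b \<in> carrier Sy.A" for b
      using character_\<rho>[OF \<iota>_closed[OF that]] \<rho>_\<iota>[OF that] by metis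
    show "right_ideal (op_ring Br.A) I"
      by (rule Br.right_ideal_supported) (rule turnback_left)
    show "c \<otimes>\<^bsub>op_ring Br.A\<^esub> a \<in> I" if "a \<in> I" "c \<in> carrier (op_ring Br.A)" for a c
      using Br.supported_mult_right[of "{b. has_turnback b}" c a] turnback_right that
      unfolding op_ring_simps by blast
    show "\<rho> a = \<zero>\<^bsub>Sy.A\<^esub>" if a: "a \<in> I" for a
    proof -
      have aA: "a \<in> carrier Br.A" using a Br.supported_closed by blast
      have z: "\<zero>\<^bsub>Sy.A\<^esub> \<in> carrier Sy.A" using Sy.B.zero_closed by (simp only: op_ring_simps)
      show ?thesis
      proof (rule Sy.A_ext[OF \<rho>_closed[OF aA] z])
        fix \<sigma> assume \<sigma>: "\<sigma> \<in> Perm"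
        have "a (pd \<sigma>) = \<zero>\<^bsub>R\<^esub>"
          using a pd_BD[OF \<sigma>] perm_diagram_no_turnback[of n \<sigma>] unfolding Br.supported_def by blast
        then show "\<rho> a \<sigma> = \<zero>\<^bsub>Sy.A\<^esub> \<sigma>" unfolding \<rho>_pd[OF \<sigma>] using \<sigma> by simp
      qed
    qed
  qed
  show ?thesis by (rule Tor_isomorphic)
qed

end

theorem theorem1p3:
  fixes R :: "('r, 'e) ring_scheme" and \<delta> :: 'r and n :: nat
    and P :: "nat \<Rightarrow> (diagram \<Rightarrow> 'r, 'p) module" and d :: "nat \<Rightarrow> 'p \<Rightarrow> 'p" and \<epsilon> :: "'p \<Rightarrow> 'r"
    and Q :: "nat \<Rightarrow> ((nat \<Rightarrow> nat) \<Rightarrow> 'r, 'q) module" and d' :: "nat \<Rightarrow> 'q \<Rightarrow> 'q" and \<epsilon>' :: "'q \<Rightarrow> 'r"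
  assumes "cring R" and "\<delta> \<in> carrier R" and "odd n"
    and "projective_resolution (op_ring (brauer_algebra R n \<delta>)) (brauer_trivial_module R n) P d \<epsilon>"
    and "projective_resolution (op_ring (group_algebra R (sym_group n)))
           (group_trivial_module R (sym_group n)) Q d' \<epsilon>'"
  shows "\<forall>k. lmodule_isomorphic R
           (Tor R (brauer_algebra R n \<delta>) P d (brauer_trivial_module R n) k)
           (Tor R (group_algebra R (sym_group n)) Q d' (group_trivial_module R (sym_group n)) k)"
proof -
  have sym: "group_algebra R (sym_group n) = basis_algebra R {p. p permutes {1..n}} (\<lambda>_ _. \<one>\<^bsub>R\<^esub>) (\<circ>) id"
    "group_trivial_module R (sym_group n) = scalar_module R {p. p permutes {1..n}} (\<lambda>_. \<one>\<^bsub>R\<^esub>)"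
    by (simp_all add: group_algebra_def group_trivial_module_def sym_group_def)
  interpret brauer_tor R \<delta> n P d \<epsilon> Q d' \<epsilon>'
    using assms unfolding sym brauer_algebra_def brauer_trivial_module_def by (rule brauer_tor.intro)
  show ?thesis
    unfolding sym brauer_algebra_def brauer_trivial_module_def using Tor_isomorphic by blast
qed

end
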